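(* Let $k\in\mathbb{N}$ and let $Q_k$ be a polynomial of degree $\le 2k-1$ (with complex coefficients) satisfying $Q_k(x)=x^{2k}Q_k(1/x)$ and $Q_k(0)=0$. Let the numbers $a_{Q_k}(r),a'_{Q_k}(r)$, $1\le r\le k$, be defined by the decomposition $$\frac{Q_k(x)}{(1+x+x^2)^k}=\sum_{r=1}^k a_{Q_k}(r)\frac{\zeta_3x}{(1-\zeta_3x)^r}+\sum_{r=1}^k a'_{Q_k}(r)\frac{\zeta_3^{-1}x}{(1-\zeta_3^{-1}x)^r},$$ and set $$c_{Q_k}(\ell)=\sum_{r=\ell}^k\frac{a_{Q_k}(r)}{(r-1)!}\left[\begin{matrix}r-1\\ \ell-1\end{matrix}\right]\qquad(1\le\ell\le k).$$ Then, with $q=e^{2\pi i\tau}$, $\tau\in\mathbb{H}$, $$\sum_{n\ge1}\frac{Q_k(q^n)}{(1+q^n+q^{2n})^k}=-\frac{Q_k(1)}{2\cdot3^k}+i\sqrt3\sum_{\substack{\ell=1\\ \ell\text{ odd}}}^k c_{Q_k}(\ell)\,G_\ell(\chi_{3,2};\tau)+\sum_{\substack{\ell=1\\ \ell\text{ even}}}^k c_{Q_k}(\ell)\big(3^\ell G_\ell(3\tau)-G_\ell(\tau)\big).$$ In particular, the left-hand side is a linear combination of modular forms (and quasimodular forms for weight $2$) with level $3$ and highest weight $k$.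
   Context: $\mathbb{N}=\{1,2,3,\ldots\}$; $\mathbb{H}$ is the complex upper half-plane; $\zeta_N=e^{2\pi i/N}$. $\left[\begin{matrix}n\\ r\end{matrix}\right]$ denotes the unsigned Stirling number of the first kind. $\chi_{3,2}$ is the primitive Dirichlet character modulo $3$ with $\chi_{3,2}(m)=0,1,-1$ for $m\equiv0,1,2\pmod3$, respectively. For even $\ell\ge2$, $G_\ell(\tau)=\frac{\zeta(1-\ell)}{2}+\sum_{n\ge1}\sigma_{\ell-1}(n)q^n$ with $\sigma_{\ell-1}(n)=\sum_{d\mid n}d^{\ell-1}$; for odd $\ell\ge1$, $G_\ell(\chi_{3,2};\tau)=\frac{L(\chi_{3,2},1-\ell)}{2}+\sum_{n\ge1}\Big(\sum_{d\mid n}\chi_{3,2}(d)d^{\ell-1}\Big)q^n$, where $\zeta$ and $L(\chi,\cdot)$ denote the (analytically continued) Riemann zeta and Dirichlet $L$-functions. $\Gamma_0(N)=\{\begin{pmatrix}a&b\\c&d\end{pmatrix}\in\mathrm{SL}_2(\mathbb{Z}): c\equiv0 \pmod N\}$. A holomorphic function $g:\mathbb{H}\to\mathbb{C}$ is a quasimodular form of weight $w$, depth $h\ge0$ and Dirichlet character $\chi$ (modulo $N$) on $\Gamma_0(N)$ if there are holomorphic $g_0,\ldots,g_h:\mathbb{H}\to\mathbb{C}$, $g_h\ne0$, with $g\big(\frac{a\tau+b}{c\tau+d}\big)=\chi(d)(c\tau+d)^{w}\sum_{j=0}^h g_j(\tau)\big(\frac{c}{c\tau+d}\big)^j$ for all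 $\begin{pmatrix}a&b\\c&d\end{pmatrix}\in\Gamma_0(N)$, and $(c\tau+d)^{-(w-2r)}g_r\big(\frac{a\tau+b}{c\tau+d}\big)$ bounded as $\mathrm{Im}(\tau)\to\infty$ for all $r\in\{0,\ldots,h\}$ and all $\begin{pmatrix}a&b\\c&d\end{pmatrix}\in\mathrm{SL}_2(\mathbb{Z})$; the zero function is also included. Modular forms are the case $h=0$ (together with $0$). "Level $N$" means (quasi)modular on $\Gamma_0(N)$ with some Dirichlet character modulo $N$. "Linear combination with highest weight $k$" means that all weights occurring are at most $k$; different terms may have different characters modulo $N$, and constants (weight $0$) are allowed. *)

theory Defs
  imports
    "HOL-Complex_Analysis.Complex_Analysis"
    "HOL-Computational_Algebra.Polynomial"
    "HOL-Combinatorics.Stirling"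
begin

subsection \<open>L-functions and Eisenstein series\<close>

definition is_dirichlet_character :: "nat \<Rightarrow> (int \<Rightarrow> complex) \<Rightarrow> bool" where
  "is_dirichlet_character N \<psi> \<longleftrightarrow>
     \<psi> 1 = 1 \<and>
     (\<forall>a b. \<psi> (a * b) = \<psi> a * \<psi> b) \<and>
     (\<forall>a. \<psi> (a + int N) = \<psi> a) \<and>
     (\<forall>a. \<psi> a = 0 \<longleftrightarrow> \<not> coprime a (int N))"

definition chi32 :: "int \<Rightarrow> complex" where
  "chi32 m = (if m mod 3 = 0 then 0 else if m mod 3 = 1 then 1 else - 1)"

text \<open>
  The analytic continuation of \<open>\<Sum>n\<ge>1. \<psi>(n) / n\<^sup>s\<close> to the punctured plane. That set is open
  and connected, so the continuation is unique there; the value at \<open>s = 1\<close> is unspecified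
  and never used below.
\<close>

definition dirichlet_L :: "(int \<Rightarrow> complex) \<Rightarrow> complex \<Rightarrow> complex" where
  "dirichlet_L \<psi> = (SOME F. F holomorphic_on - {1} \<and>
     (\<forall>s. Re s > 1 \<longrightarrow> (\<lambda>n. \<psi> (int (Suc n)) / of_nat (Suc n) powr s) sums F s))"

definition riemann_zeta :: "complex \<Rightarrow> complex" where
  "riemann_zeta = dirichlet_L (\<lambda>_. 1)"

definition nome :: "complex \<Rightarrow> complex" where
  "nome \<tau> = exp (2 * of_real pi * \<i> * \<tau>)"

definition eisenstein :: "nat \<Rightarrow> complex \<Rightarrow> complex" where
  "eisenstein l \<tau> = riemann_zeta (1 - of_nat l) / 2 +
     (\<Sum>n. (\<Sum>d | d dvd Suc n. of_nat d ^ (l - 1)) * nome \<tau> ^ Suc n)"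

definition eisenstein_char :: "(int \<Rightarrow> complex) \<Rightarrow> nat \<Rightarrow> complex \<Rightarrow> complex" where
  "eisenstein_char \<psi> l \<tau> = dirichlet_L \<psi> (1 - of_nat l) / 2 +
     (\<Sum>n. (\<Sum>d | d dvd Suc n. \<psi> (int d) * of_nat d ^ (l - 1)) * nome \<tau> ^ Suc n)"

subsection \<open>Quasimodular forms\<close>

definition upper_half_plane :: "complex set" where
  "upper_half_plane = {\<tau>. Im \<tau> > 0}"

text \<open>A matrix with rows \<open>(a, b)\<close> and \<open>(c, d)\<close> is encoded as the tuple \<open>(a, b, c, d)\<close>.\<close>

definition SL2Z :: "(int \<times> int \<times> int \<times> int) set" where
  "SL2Z = {(a, b, c, d). a * d - b * c = 1}"

definition Gamma0 :: "nat \<Rightarrow> (int \<times> int \<times> int \<times> int) set" where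
  "Gamma0 N = {(a, b, c, d). (a, b, c, d) \<in> SL2Z \<and> int N dvd c}"

definition moebius_act :: "int \<times> int \<times> int \<times> int \<Rightarrow> complex \<Rightarrow> complex" where
  "moebius_act = (\<lambda>(a, b, c, d) \<tau>. (of_int a * \<tau> + of_int b) / (of_int c * \<tau> + of_int d))"

text \<open>
  Functions on the upper half-plane are total functions on the complex numbers whose values
  elsewhere are irrelevant. The filter \<open>filtercomap Im at_top\<close> expresses \<open>Im \<tau> \<rightarrow> \<infinity>\<close>,
  uniformly in \<open>Re \<tau>\<close>.
\<close>

definition is_quasimodular_form ::
  "nat \<Rightarrow> (int \<Rightarrow> complex) \<Rightarrow> int \<Rightarrow> nat \<Rightarrow> (complex \<Rightarrow> complex) \<Rightarrow> bool" where
  "is_quasimodular_form N \<psi> w h g \<longleftrightarrow>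
     is_dirichlet_character N \<psi> \<and>
     g holomorphic_on upper_half_plane \<and>
     ((\<forall>\<tau>\<in>upper_half_plane. g \<tau> = 0) \<or>
      (\<exists>G :: nat \<Rightarrow> complex \<Rightarrow> complex.
         (\<forall>j\<le>h. G j holomorphic_on upper_half_plane) \<and>
         (\<exists>\<tau>\<in>upper_half_plane. G h \<tau> \<noteq> 0) \<and>
         (\<forall>(a, b, c, d)\<in>Gamma0 N. \<forall>\<tau>\<in>upper_half_plane.
            g (moebius_act (a, b, c, d) \<tau>) =
              \<psi> d * (of_int c * \<tau> + of_int d) powi w *
              (\<Sum>j\<le>h. G j \<tau> * (of_int c / (of_int c * \<tau> + of_int d)) ^ j)) \<and>
         (\<forall>r\<le>h. \<forall>(a, b, c, d)\<in>SL2Z.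
            Bfun (\<lambda>\<tau>. (of_int c * \<tau> + of_int d) powi (- (w - 2 * int r)) *
                       G r (moebius_act (a, b, c, d) \<tau>))
                 (filtercomap Im at_top))))"

definition is_modular_form ::
  "nat \<Rightarrow> (int \<Rightarrow> complex) \<Rightarrow> int \<Rightarrow> (complex \<Rightarrow> complex) \<Rightarrow> bool" where
  "is_modular_form N \<psi> w g \<longleftrightarrow> is_quasimodular_form N \<psi> w 0 g"

text \<open>
  A finite linear combination of modular forms on \<open>Gamma0 N\<close> of weights at most \<open>k\<close>, where
  quasimodular forms (of any depth) are admitted in weight 2 only. The character may vary
  from term to term; constants occur as modular forms of weight 0.
\<close>

definition modular_combination :: "nat \<Rightarrow> nat \<Rightarrow> (complex \<Rightarrow> complex) \<Rightarrow> bool" where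
  "modular_combination N k F \<longleftrightarrow>
     (\<exists>(m :: nat) (b :: nat \<Rightarrow> complex) (w :: nat \<Rightarrow> nat) (\<psi> :: nat \<Rightarrow> int \<Rightarrow> complex)
        (g :: nat \<Rightarrow> complex \<Rightarrow> complex).
        (\<forall>i<m. w i \<le> k \<and>
           (is_modular_form N (\<psi> i) (int (w i)) (g i) \<or>
            w i = 2 \<and> (\<exists>h. is_quasimodular_form N (\<psi> i) 2 h (g i)))) \<and>
        (\<forall>\<tau>\<in>upper_half_plane. F \<tau> = (\<Sum>i<m. b i * g i \<tau>)))"

subsection \<open>The partial fraction coefficients\<close>

definition zeta3 :: complex where
  "zeta3 = exp (2 * of_real pi * \<i> / 3)"

text \<open>
  The identity of rational functions, required at every point that is not a pole. It
  constrains the values of \<open>a\<close> and \<open>a'\<close> on \<open>{1..k}\<close> only, and determines them there.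
\<close>

definition pf_decomposition ::
  "nat \<Rightarrow> complex poly \<Rightarrow> (nat \<Rightarrow> complex) \<Rightarrow> (nat \<Rightarrow> complex) \<Rightarrow> bool" where
  "pf_decomposition k Q a a' \<longleftrightarrow>
     (\<forall>x. 1 + x + x ^ 2 \<noteq> 0 \<longrightarrow>
        poly Q x / (1 + x + x ^ 2) ^ k =
          (\<Sum>r=1..k. a r * (zeta3 * x / (1 - zeta3 * x) ^ r)) +
          (\<Sum>r=1..k. a' r * (inverse zeta3 * x / (1 - inverse zeta3 * x) ^ r)))"

definition pf_coeff :: "nat \<Rightarrow> complex poly \<Rightarrow> nat \<Rightarrow> complex" where
  "pf_coeff k Q = (SOME a. \<exists>a'. pf_decomposition k Q a a')"

definition c_coeff :: "nat \<Rightarrow> complex poly \<Rightarrow> nat \<Rightarrow> complex" where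
  "c_coeff k Q l =
     (\<Sum>r=l..k. pf_coeff k Q r / fact (r - 1) * of_nat (stirling (r - 1) (l - 1)))"

end

theory Submission
  imports Defs
begin

text \<open>
  Let \<open>Li\<^sub>-\<^sub>j(y) = \<Sum>m. m\<^sup>j y\<^sup>m\<close>, a rational function with its only pole at \<open>y = 1\<close>. The Stirling
  numbers rewrite the partial fractions in terms of \<open>Li\<^sub>-\<^sub>j(\<zeta>x)\<close> and \<open>Li\<^sub>-\<^sub>j(x/\<zeta>)\<close>, \<open>\<zeta> = zeta3\<close>, and the
  symmetry of \<open>Q\<close> under \<open>x \<mapsto> 1/x\<close> together with \<open>Li\<^sub>-\<^sub>j(1/y) = \<plusminus>Li\<^sub>-\<^sub>j(y)\<close> (up to a constant for
  \<open>j = 0\<close>) shows that the quotient is \<open>\<Sum>j. c(j+1) (Li\<^sub>-\<^sub>j(\<zeta>x) - (-1)\<^sup>j Li\<^sub>-\<^sub>j(x/\<zeta>))\<close>.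

  Summing over \<open>x = q\<^sup>n\<close> yields Lambert series of Eisenstein type. Their constant terms are special
  \<open>L\<close>-values, which Riemann's Mellin transform argument identifies with values of \<open>Li\<^sub>-\<^sub>j\<close> at \<open>\<zeta>\<close> and
  \<open>1/\<zeta>\<close>; together they form half the value of the quotient at \<open>x = 1\<close>.

  For modularity, the sum over \<open>n\<close> of the \<open>j\<close>-th term is, up to a constant factor and a constant
  summand, the value at \<open>z = 1/3\<close> of the \<open>j\<close>-th derivative of \<open>E(z) = \<Sum>m. \<pi> cot \<pi>(z + m\<tau>)\<close>. This
  \<open>E\<close> is odd with simple poles of residue 1 on the lattice, has period 1, and satisfies
  \<open>E(z + \<tau>) = E(z) - 2\<pi>i\<close>, so Liouville's theorem gives
  \<open>E(z/(c\<tau>+d); \<gamma>\<tau>) = (c\<tau>+d) E(z; \<tau>) + 2\<pi>icz\<close>. Differentiating in \<open>z\<close> and putting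
  \<open>z = (c\<tau>+d)/3\<close> treats all weights, including 1 and 2, at once.
\<close>

subsection \<open>Polylogarithms of nonpositive integer order\<close>

text \<open>The engine is the operator y d/dy, which raises the index of \<open>polylog_neg\<close>
  by one: an identity between polylogarithms is checked for n = 0, where it is elementary, and then
  transported upwards by differentiation. The two claims rest on the same polylogarithm sums over
  powers of the nome, evaluated once through L-values and once through \<open>eis_kronecker\<close>.
  So modularity never has to be proved for Eisenstein series as sums over pairs (c, d), which fail
  to converge absolutely in weights 1 and 2; determining a function of z by its poles and
  quasi-periods replaces every rearrangement of such sums. For the L-values the obstacle is that
  \<open>dirichlet_L\<close> is a choice: a value at -j is accessible only after a continuation to
  the whole punctured plane has been exhibited. For zeta there is the further difficulty that y = 1
  is the pole of the polylogarithm, so zeta(-j) is reached only through its multiple by 3^(j+1) - 1.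
  This is exactly the multiple that occurs as the constant term of 3^l G(3\<tau>) - G(\<tau>), with
  l = j + 1.\<close>

primrec eulerian_poly :: "nat \<Rightarrow> complex poly" where
  "eulerian_poly 0 = [:0, 1:]"
| "eulerian_poly (Suc n) =
     [:0, 1:] * ([:1, -1:] * pderiv (eulerian_poly n) + smult (of_nat (Suc n)) (eulerian_poly n))"

text \<open>
  This is \<open>Li\<^sub>-\<^sub>n(y)\<close>; its value at the pole \<open>y = 1\<close> is \<open>0\<close> because \<open>x / 0 = 0\<close>.
\<close>

definition polylog_neg :: "nat \<Rightarrow> complex \<Rightarrow> complex" where
  "polylog_neg n y = poly (eulerian_poly n) y / (1 - y) ^ Suc n"

lemma polylog_neg_0: "polylog_neg 0 y = y / (1 - y)"
  by (simp add: polylog_neg_def)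

lemma polylog_neg_at_0 [simp]: "polylog_neg n 0 = 0"
  by (cases n) (simp_all add: polylog_neg_def)

text \<open>Cancelling one factor 1 - y keeps the shape of a numerator over a power, with the
  exponent up by one. Times y, the new numerator is the recursion of \<open>eulerian_poly\<close>;
  the same formula drives the Stirling recurrence.\<close>

lemma DERIV_divide_one_minus_power:
  fixes y :: "'a :: real_normed_field"
  assumes "(f has_field_derivative f') (at y)" "y \<noteq> 1"
  shows "((\<lambda>y. f y / (1 - y) ^ Suc n) has_field_derivative
           (f' * (1 - y) + of_nat (Suc n) * f y) / (1 - y) ^ Suc (Suc n)) (at y)"
proof -
  have "((\<lambda>y. (1 - y) ^ Suc n) has_field_derivative (1 + of_nat n) * (- 1 * (1 - y) ^ n)) (at y)"
    by (rule DERIV_power_Suc) (auto intro!: derivative_eq_intros)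
  from DERIV_divide[OF assms(1) this] assms(2)
  have "((\<lambda>y. f y / (1 - y) ^ Suc n) has_field_derivative
      (f' * (1 - y) ^ Suc n - f y * ((1 + of_nat n) * (- 1 * (1 - y) ^ n)))
        / ((1 - y) ^ Suc n * (1 - y) ^ Suc n)) (at y)" by simp
  also have "(f' * (1 - y) ^ Suc n - f y * ((1 + of_nat n) * (- 1 * (1 - y) ^ n)))
        / ((1 - y) ^ Suc n * (1 - y) ^ Suc n) =
      (f' * (1 - y) + of_nat (Suc n) * f y) / (1 - y) ^ Suc (Suc n)"
    using assms(2) by (simp add: divide_simps) (simp add: algebra_simps)
  finally show ?thesis .
qed

lemma DERIV_polylog_neg:
  assumes "y \<noteq> 1" "y \<noteq> 0"
  shows "(polylog_neg n has_field_derivative polylog_neg (Suc n) y / y) (at y)"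
  unfolding polylog_neg_def[abs_def]
  by (rule DERIV_cong[OF DERIV_divide_one_minus_power[OF poly_DERIV assms(1)]])
     (use assms in \<open>simp add: divide_simps, simp add: algebra_simps\<close>)

lemma DERIV_polylog_neg_comp:
  assumes "(f has_field_derivative f') (at z within S)" "f z \<noteq> 1" "f z \<noteq> 0"
    "D = polylog_neg (Suc n) (f z) * (f' / f z)"
  shows "((\<lambda>z. polylog_neg n (f z)) has_field_derivative D) (at z within S)"
  using DERIV_chain'[OF assms(1) DERIV_polylog_neg[OF assms(2,3), of n]] assms(4)
  by simp

lemma continuous_polylog_neg: "y \<noteq> 1 \<Longrightarrow> isCont (polylog_neg n) y"
  unfolding polylog_neg_def by (intro continuous_intros) auto

lemma holomorphic_polylog_neg [holomorphic_intros]: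
  assumes "f holomorphic_on S" "\<And>z. z \<in> S \<Longrightarrow> f z \<noteq> 1"
  shows "(\<lambda>z. polylog_neg n (f z)) holomorphic_on S"
proof -
  have "polylog_neg n holomorphic_on - {1}"
    unfolding polylog_neg_def by (intro holomorphic_intros) auto
  from holomorphic_on_compose_gen[OF assms(1) this] assms(2) show ?thesis
    by (fastforce simp: o_def image_subset_iff)
qed

lemma polylog_neg_sums:
  assumes "norm y < 1"
  shows "(\<lambda>m. of_nat (Suc m) ^ n * y ^ Suc m) sums polylog_neg n y"
proof -
  \<comment> \<open>The coefficient at m = 0 is forced to 0, because \<open>0 ^ n\<close> would be 1
    for n = 0 and the series has to start at m = 1 for every n.\<close>
  define c where "c = (\<lambda>(n::nat) (m::nat). if m = 0 then 0 else (of_nat m ^ n :: complex))"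
  have main: "(\<lambda>m. c n m * y ^ m) sums polylog_neg n y" if "norm y < 1" for n y
    using that
  proof (induction n arbitrary: y)
    case 0
    have "(\<lambda>m. y ^ m) sums (1 / (1 - y))" using geometric_sums[OF 0] by simp
    hence "(\<lambda>m. y * y ^ m) sums (y * (1 / (1 - y)))" by (rule sums_mult)
    hence "(\<lambda>m. c 0 (Suc m) * y ^ Suc m) sums (polylog_neg 0 y)"
      by (simp add: c_def polylog_neg_0)
    thus ?case by (subst (asm) sums_Suc_iff) (simp add: c_def)
  next
    case (Suc n)
    show ?case
    proof (cases "y = 0")
      case True
      have "(\<lambda>m. c (Suc n) m * y ^ m) = (\<lambda>m. 0)" using True by (auto simp: c_def fun_eq_iff)
      thus ?thesis using True by simp
    next
      case False
      have sm: "summable (\<lambda>m. c n m * z ^ m)" if "norm z < 1" for z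
        using Suc.IH[OF that] by (simp add: sums_iff)
      have d: "((\<lambda>z. \<Sum>m. c n m * z ^ m) has_field_derivative (\<Sum>m. diffs (c n) m * y ^ m)) (at y)"
        by (rule termdiffs_strong'[where K = 1]) (use sm Suc.prems in auto)
      have "((\<lambda>z. \<Sum>m. c n m * z ^ m) has_field_derivative polylog_neg (Suc n) y / y) (at y)"
      proof (rule has_field_derivative_transform_within_open[where S = "ball 0 1"])
        show "(polylog_neg n has_field_derivative polylog_neg (Suc n) y / y) (at y)"
          using Suc.prems False by (intro DERIV_polylog_neg) auto
        fix z :: complex assume "z \<in> ball 0 1"
        thus "polylog_neg n z = (\<Sum>m. c n m * z ^ m)"
          using Suc.IH[of z] by (simp add: sums_iff)
      qed (use Suc.prems in auto)
      with d have eq: "(\<Sum>m. diffs (c n) m * y ^ m) = polylog_neg (Suc n) y / y"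
        by (rule DERIV_unique)
      have "summable (\<lambda>m. diffs (c n) m * y ^ m)"
        by (rule termdiff_converges[where K = 1]) (use sm Suc.prems in auto)
      with eq have "(\<lambda>m. diffs (c n) m * y ^ m) sums (polylog_neg (Suc n) y / y)"
        by (simp add: sums_iff)
      hence "(\<lambda>m. y * (diffs (c n) m * y ^ m)) sums (y * (polylog_neg (Suc n) y / y))"
        by (rule sums_mult)
      hence "(\<lambda>m. c (Suc n) (Suc m) * y ^ Suc m) sums (polylog_neg (Suc n) y)"
        using False by (simp add: c_def diffs_def mult_ac)
      thus ?thesis by (subst (asm) sums_Suc_iff) (simp add: c_def)
    qed
  qed
  from main[OF assms, of n] have "(\<lambda>m. c n (Suc m) * y ^ Suc m) sums (polylog_neg n y)"
    using sums_Suc_iff[of "\<lambda>m. c n m * y ^ m"] by (simp add: c_def)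
  thus ?thesis by (simp add: c_def)
qed

text \<open>Inversion reverses the sign of y d/dy, which accounts for the alternating sign. The
  constant -1 arises for n = 0 and is killed by the first differentiation.\<close>

lemma polylog_neg_inverse:
  assumes "y \<noteq> 0" "y \<noteq> 1"
  shows "polylog_neg n (1 / y) = (- 1) ^ Suc n * polylog_neg n y - of_bool (n = 0)"
  using assms
proof (induction n arbitrary: y)
  case 0
  thus ?case by (simp add: polylog_neg_0 divide_simps)
next
  case (Suc n)
  have 1: "((\<lambda>y. polylog_neg n (1 / y)) has_field_derivative - polylog_neg (Suc n) (1 / y) / y) (at y)"
    using Suc.prems by (auto intro!: derivative_eq_intros DERIV_polylog_neg_comp simp: divide_simps)
  have "((\<lambda>y. (- 1) ^ Suc n * polylog_neg n y - of_bool (n = 0)) has_field_derivative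
      (- 1) ^ Suc n * (polylog_neg (Suc n) y / y)) (at y)"
    using Suc.prems by (auto intro!: derivative_eq_intros DERIV_polylog_neg)
  hence "((\<lambda>y. polylog_neg n (1 / y)) has_field_derivative
      (- 1) ^ Suc n * (polylog_neg (Suc n) y / y)) (at y)"
    by (rule has_field_derivative_transform_within_open[where S = "- {0, 1}"])
       (use Suc in auto)
  from DERIV_unique[OF 1 this] show ?case using Suc.prems by (simp add: field_simps)
qed

section \<open>Primitive cube roots of unity and the distribution relation\<close>

lemma zeta3_eq: "zeta3 = Complex (-1/2) (sqrt 3 / 2)"
proof -
  have "zeta3 = cis (2 * pi / 3)"
    unfolding zeta3_def cis_conv_exp by (simp add: mult_ac)
  also have "\<dots> = Complex (-1/2) (sqrt 3 / 2)"
    using cos_120 sin_120 by (auto simp: complex_eq_iff)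
  finally show ?thesis .
qed

lemma zeta3_nz [simp]: "zeta3 \<noteq> 0"
  by (simp add: zeta3_def)

lemma zeta3_pow2: "zeta3 ^ 2 = - 1 - zeta3"
  by (auto simp: zeta3_eq complex_eq_iff power2_eq_square)

lemma zeta3_pow3: "zeta3 ^ 3 = 1"
  using zeta3_pow2 by algebra

lemma inverse_zeta3: "inverse zeta3 = - 1 - zeta3"
  using zeta3_pow3 zeta3_pow2 by (simp add: field_simps) algebra

lemma zeta3_diff: "zeta3 - inverse zeta3 = \<i> * of_real (sqrt 3)"
  by (simp add: inverse_zeta3) (simp add: zeta3_eq complex_eq_iff)

lemma zeta3_neq_1 [simp]: "zeta3 \<noteq> 1" "inverse zeta3 \<noteq> 1"
  unfolding inverse_zeta3 by (auto simp: zeta3_eq complex_eq_iff)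

lemma norm_zeta3 [simp]: "norm zeta3 = 1" "norm (inverse zeta3) = 1"
  using norm_exp_i_times[of "2 * pi / 3"]
  by (auto simp: zeta3_def norm_inverse mult_ac)

lemma quadratic_factor: "1 + x + x ^ 2 = (1 - zeta3 * x) * (1 - inverse zeta3 * x)"
  unfolding inverse_zeta3 using zeta3_pow2 by algebra

text \<open>For n = 0 this is the logarithmic derivative of the factorisation of 1 - x^3; each
  application of x d/dx contributes another 3 on the left. On power series it says that the m-th
  powers of the cube roots of unity add up to 3 or 0 according to whether 3 divides m.\<close>

lemma polylog_neg_distribution:
  assumes "x ^ 3 \<noteq> 1" "x \<noteq> 0"
  shows "3 ^ Suc n * polylog_neg n (x ^ 3) =
           polylog_neg n x + polylog_neg n (zeta3 * x) + polylog_neg n (inverse zeta3 * x)"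
  using assms
proof (induction n arbitrary: x)
  case 0
  have *: "1 - x ^ 3 = (1 - x) * ((1 - zeta3 * x) * (1 - inverse zeta3 * x))"
    unfolding quadratic_factor[symmetric] by algebra
  hence nz: "1 - x \<noteq> 0" "1 - zeta3 * x \<noteq> 0" "1 - inverse zeta3 * x \<noteq> 0" "1 - x ^ 3 \<noteq> 0"
    using 0 by auto
  \<comment> \<open>With the three reciprocals as atoms, the identity follows from polynomial
    relations alone.\<close>
  define a where "a = inverse (1 - x)"
  define b where "b = inverse (1 - zeta3 * x)"
  define c where "c = inverse (1 - inverse zeta3 * x)"
  have ab: "a * (1 - x) = 1" "b * (1 - zeta3 * x) = 1" "c * (1 - inverse zeta3 * x) = 1"
    using nz by (auto simp: a_def b_def c_def)
  have d: "inverse (1 - x ^ 3) = a * b * c"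
    unfolding * a_def b_def c_def by (simp add: mult_ac)
  have "3 * (x ^ 3 * (a * b * c)) = x * a + zeta3 * x * b + inverse zeta3 * x * c"
    using ab zeta3_pow2 unfolding inverse_zeta3 by algebra
  thus ?case by (simp add: polylog_neg_0 divide_inverse d flip: a_def b_def c_def)
next
  case (Suc n)
  have *: "1 - x ^ 3 = (1 - x) * ((1 - zeta3 * x) * (1 - inverse zeta3 * x))"
    unfolding quadratic_factor[symmetric] by algebra
  hence nz: "1 \<noteq> x" "1 \<noteq> zeta3 * x" "1 \<noteq> inverse zeta3 * x"
    using Suc.prems by auto
  have 1: "((\<lambda>x. 3 ^ Suc n * polylog_neg n (x ^ 3)) has_field_derivative
     (3 ^ Suc n * (polylog_neg (Suc n) (x ^ 3) * (3 / x)))) (at x)"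
    using Suc.prems
    by (auto intro!: derivative_eq_intros DERIV_polylog_neg_comp simp: power2_eq_square power3_eq_cube)
  have "((\<lambda>x. polylog_neg n x + polylog_neg n (zeta3 * x) + polylog_neg n (inverse zeta3 * x))
     has_field_derivative (polylog_neg (Suc n) x / x + polylog_neg (Suc n) (zeta3 * x) / x
        + polylog_neg (Suc n) (inverse zeta3 * x) / x)) (at x)"
    using Suc.prems nz
    by (intro derivative_intros DERIV_polylog_neg DERIV_polylog_neg_comp)
       (auto intro!: derivative_eq_intros simp: divide_simps)
  hence "((\<lambda>x. 3 ^ Suc n * polylog_neg n (x ^ 3)) has_field_derivative
     (polylog_neg (Suc n) x / x + polylog_neg (Suc n) (zeta3 * x) / x
        + polylog_neg (Suc n) (inverse zeta3 * x) / x)) (at x)"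
  proof (rule has_field_derivative_transform_within_open[where S = "- {x. x ^ 3 = 1} \<inter> - {0}"])
    have "{x::complex. x ^ 3 = 1} = (\<lambda>x. x ^ 3) -` {1}" by auto
    moreover have "closed ((\<lambda>x::complex. x ^ 3) -` {1})"
      by (intro continuous_closed_vimage) (auto intro!: continuous_intros)
    ultimately have "closed {x::complex. x ^ 3 = 1}" by simp
    thus "open (- {x. x ^ 3 = 1} \<inter> - {0::complex})" by (intro open_Int) auto
  qed (use Suc in auto)
  from DERIV_unique[OF 1 this] show ?case using Suc.prems by (simp add: field_simps)
qed

text \<open>Origin of the Stirling numbers: with D = y d/dy and f r = y / (1 - y)^(r+1), one has D
  (f r) = (r+1) f (r+1) - r f r. Hence r! f r = D (D+1) ... (D+r-1) (f 0), and the coefficients of a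
  rising factorial are the unsigned Stirling numbers of the first kind.\<close>

lemma stirling_polylog_neg:
  assumes "y \<noteq> 1"
  shows "y / (1 - y) ^ Suc r = (\<Sum>j\<le>r. of_nat (stirling r j) * polylog_neg j y) / fact r"
proof (cases "y = 0")
  case False
  define f where "f = (\<lambda>r y :: complex. y / (1 - y) ^ Suc r)"
  have "fact r * f r y = (\<Sum>j\<le>r. of_nat (stirling r j) * polylog_neg j y)"
    using assms False
  proof (induction r arbitrary: y)
    case 0
    show ?case by (simp add: polylog_neg_0 f_def)
  next
    case (Suc r)
    have 1: "((\<lambda>y. fact r * f r y) has_field_derivative
        fact r * (of_nat (Suc r) * f (Suc r) y - of_nat r * f r y) / y) (at y)"
      using DERIV_cmult[OF DERIV_divide_one_minus_power[OF DERIV_ident, of y r], of "fact r"] Suc.prems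
      by (rule_tac DERIV_cong) (auto simp: f_def divide_simps, simp_all add: algebra_simps)
    have "((\<lambda>y. \<Sum>j\<le>r. of_nat (stirling r j) * polylog_neg j y) has_field_derivative
        (\<Sum>j\<le>r. of_nat (stirling r j) * (polylog_neg (Suc j) y / y))) (at y)"
      using Suc.prems by (auto intro!: derivative_eq_intros DERIV_polylog_neg simp: mult_ac)
    hence "((\<lambda>y. fact r * f r y) has_field_derivative
        (\<Sum>j\<le>r. of_nat (stirling r j) * (polylog_neg (Suc j) y / y))) (at y)"
      by (rule has_field_derivative_transform_within_open[where S = "- {0, 1}"]) (use Suc in auto)
    from DERIV_unique[OF 1 this] Suc.prems
    have "fact (Suc r) * f (Suc r) y = (\<Sum>j\<le>r. of_nat (stirling r j) * polylog_neg (Suc j) y)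
        + of_nat r * (fact r * f r y)"
      by (simp add: sum_divide_distrib[symmetric] field_simps)
    also have "of_nat r * (fact r * f r y) = (\<Sum>j\<le>r. of_nat (r * stirling r j) * polylog_neg j y)"
      by (subst Suc.IH) (use Suc.prems in \<open>auto simp: sum_distrib_left mult_ac\<close>)
    also have "\<dots> = (\<Sum>j\<le>Suc r. of_nat (r * stirling r j) * polylog_neg j y)"
      by simp
    also have "\<dots> = (\<Sum>j\<le>r. of_nat (r * stirling r (Suc j)) * polylog_neg (Suc j) y)"
      by (subst sum.atMost_Suc_shift) (cases r; simp)
    finally show ?case
      by (subst sum.atMost_Suc_shift) (simp add: sum.distrib ring_distribs)
  qed
  thus ?thesis by (simp add: f_def field_simps)
qed simp

lemma eulerian_poly_at_1: "poly (eulerian_poly n) 1 = fact n"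
  by (induction n) auto

text \<open>The poles at y = 1 have distinct orders, with leading coefficient j! for index j, so no
  nontrivial combination stays finite there. A finite limit is assumed instead of vanishing because
  the application has further terms that are regular at that point.\<close>

lemma polylog_neg_independent:
  assumes "((\<lambda>y. \<Sum>j<k. d j * polylog_neg j y) \<longlongrightarrow> L) (at 1)" "j < k"
  shows "d j = 0"
  using assms
proof (induction k)
  case (Suc k)
  let ?F = "\<lambda>y. (1 - y) ^ Suc k * (\<Sum>j<Suc k. d j * polylog_neg j y)"
  have "(?F \<longlongrightarrow> (1 - 1) ^ Suc k * L) (at 1)"
    by (intro tendsto_intros Suc.prems)
  hence lim0: "(?F \<longlongrightarrow> 0) (at 1)" by simp
  let ?G = "\<lambda>y. \<Sum>j<Suc k. d j * ((1 - y) ^ (k - j) * poly (eulerian_poly j) y)"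
  have "isCont ?G 1" by (intro continuous_intros)
  hence "(?G \<longlongrightarrow> ?G 1) (at 1)" by (simp add: isCont_def)
  also have "?G 1 = d k * fact k"
    by (simp add: eulerian_poly_at_1) (auto intro!: sum.neutral)
  finally have "(?G \<longlongrightarrow> d k * fact k) (at 1)" .
  moreover have "eventually (\<lambda>y. ?F y = ?G y) (at 1)"
    unfolding eventually_at_filter
  proof (intro always_eventually allI impI)
    fix y :: complex assume y: "y \<noteq> 1"
    have "(1 - y) ^ Suc k * polylog_neg j y = (1 - y) ^ (k - j) * poly (eulerian_poly j) y" if "j < Suc k" for j
    proof -
      have "Suc k = (k - j) + Suc j" using that by simp
      hence "(1 - y) ^ Suc k = (1 - y) ^ (k - j) * (1 - y) ^ Suc j" by (metis power_add)
      thus ?thesis using y by (simp add: polylog_neg_def)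
    qed
    thus "?F y = ?G y" unfolding sum_distrib_left
      by (intro sum.cong refl) (simp add: mult.left_commute)
  qed
  ultimately have "(?F \<longlongrightarrow> d k * fact k) (at 1)"
    using tendsto_cong by fast
  with lim0 have "d k * fact k = 0" using tendsto_unique[OF at_neq_bot] by blast
  hence "d k = 0" by simp
  thus ?case using Suc by (cases "j = k") auto
qed simp

text \<open>The numerator is divisible by y. The linear bound is what makes sums over powers of q
  converge geometrically; 1/2 just keeps away from the pole at 1.\<close>

lemma polylog_neg_bound:
  obtains C where "C > 0" "\<And>y. norm y \<le> 1 / 2 \<Longrightarrow> norm (polylog_neg n y) \<le> C * norm y"
proof -
  have "poly (eulerian_poly n) 0 = 0" by (cases n) auto
  hence "[:0, 1:] dvd eulerian_poly n" by (simp add: poly_eq_0_iff_dvd)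
  then obtain p where p: "eulerian_poly n = [:0, 1:] * p" by (elim dvdE)
  define R where "R = (\<lambda>y. poly p y / (1 - y) ^ Suc n)"
  have "continuous_on (cball 0 (1/2)) R"
    unfolding R_def by (intro continuous_intros) auto
  hence "bounded (R ` cball 0 (1/2))"
    by (intro compact_imp_bounded compact_continuous_image) auto
  then obtain C where C: "C > 0" "\<And>y. y \<in> cball 0 (1/2) \<Longrightarrow> norm (R y) \<le> C"
    by (auto simp: bounded_pos)
  show ?thesis
  proof (rule that[of C])
    fix y :: complex assume "norm y \<le> 1 / 2"
    hence "norm (R y) \<le> C" using C by auto
    moreover have "polylog_neg n y = R y * y"
      by (simp add: polylog_neg_def R_def p)
    ultimately show "norm (polylog_neg n y) \<le> C * norm y"
      by (simp add: norm_mult mult_right_mono)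
  qed (use C in auto)
qed

subsection \<open>Partial fractions\<close>

text \<open>The constant b makes R - b (1 - v x)^n vanish at the pole 1/u, so a factor 1 - u x
  splits off. The alternative n = 0 serves the stage at which only one pole is left.
  \<open>R = 0\<close> is listed separately because the zero polynomial has degree 0, which is not
  below m + n = 0.\<close>

lemma partial_fraction_step:
  fixes u v :: complex
  assumes "u \<noteq> 0" "u \<noteq> v \<or> n = 0" "R = 0 \<or> degree R < Suc m + n"
  obtains b R' where "R = smult b ([:1, -v:] ^ n) + [:1, -u:] * R'" "R' = 0 \<or> degree R' < m + n"
proof -
  define b where "b = poly R (1 / u) / poly ([:1, -v:] ^ n) (1 / u)"
  define S where "S = R - smult b ([:1, -v:] ^ n)"
  have nz: "poly ([:1, -v:] ^ n) (1 / u) \<noteq> 0"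
    using assms by (auto simp: poly_power field_simps)
  have "poly S (1 / u) = 0"
    using nz by (simp add: S_def b_def)
  hence "[:- (1 / u), 1:] dvd S" by (simp add: poly_eq_0_iff_dvd)
  moreover have "[:1, -u:] = smult (- u) [:- (1 / u), 1:]" using assms by simp
  ultimately have "[:1, -u:] dvd S" using assms by (metis smult_dvd_iff neg_equal_0_iff_equal)
  then obtain R' where R': "S = [:1, -u:] * R'" by (elim dvdE)
  have "degree ([:1, -v:] ^ n) \<le> n"
    by (rule order.trans[OF degree_power_le]) simp
  hence dS: "degree S < Suc m + n"
    unfolding S_def using assms(3)
    by (intro degree_diff_less) (auto intro: le_less_trans[OF degree_smult_le])
  show ?thesis
  proof (rule that[of b R'])
    show "R = smult b ([:1, -v:] ^ n) + [:1, -u:] * R'"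
      using R' unfolding S_def by (simp only: diff_eq_eq add.commute)
    show "R' = 0 \<or> degree R' < m + n"
    proof (cases "R' = 0")
      case False
      hence "degree S = 1 + degree R'"
        unfolding R' using assms(1) by (subst degree_mult_eq) auto
      thus ?thesis using dS by simp
    qed simp
  qed
qed

lemma partial_fractions_two_poles:
  fixes u v :: complex
  assumes "u \<noteq> 0" "v \<noteq> 0" "u \<noteq> v" "R = 0 \<or> degree R < m + n"
  shows "\<exists>b b'. \<forall>x. u * x \<noteq> 1 \<longrightarrow> v * x \<noteq> 1 \<longrightarrow>
           poly R x / ((1 - u * x) ^ m * (1 - v * x) ^ n) =
           (\<Sum>r=1..m. b r / (1 - u * x) ^ r) + (\<Sum>r=1..n. b' r / (1 - v * x) ^ r)"
  using assms(4)
proof (induction m arbitrary: R)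
  case 0
  thus ?case
  proof (induction n arbitrary: R)
    case 0
    thus ?case by auto
  next
    case (Suc n)
    from Suc.prems have "R = 0 \<or> degree R < Suc n + 0" by simp
    from partial_fraction_step[OF assms(2) _ this, of v] obtain b R' where
      R': "R = smult b 1 + [:1, -v:] * R'" "R' = 0 \<or> degree R' < 0 + n"
      by auto
    from Suc.IH[OF R'(2)] obtain c c' where c: "\<And>x. u * x \<noteq> 1 \<Longrightarrow> v * x \<noteq> 1 \<Longrightarrow>
           poly R' x / (1 - v * x) ^ n = (\<Sum>r=1..n. c' r / (1 - v * x) ^ r)"
      by auto
    have "poly R x / (1 - v * x) ^ Suc n = (\<Sum>r=1..Suc n. (c'(Suc n := b)) r / (1 - v * x) ^ r)"
      if x: "u * x \<noteq> 1" "v * x \<noteq> 1" for x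
    proof -
      have "poly R x / (1 - v * x) ^ Suc n = b / (1 - v * x) ^ Suc n + poly R' x / (1 - v * x) ^ n"
        using x by (simp add: R'(1) divide_simps) (simp add: algebra_simps)?
      also have "\<dots> = (\<Sum>r=1..Suc n. (c'(Suc n := b)) r / (1 - v * x) ^ r)"
        unfolding c[OF x] by (simp add: add.commute)
      finally show ?thesis .
    qed
    thus ?case
      \<comment> \<open>With m = 0 the first sum is empty, so its coefficients are
        arbitrary.\<close>
      by (intro exI[of _ undefined] exI[of _ "c'(Suc n := b)"])
         (simp del: sum.cl_ivl_Suc fun_upd_apply power_Suc)
  qed
next
  case (Suc m)
  from partial_fraction_step[OF assms(1) _ Suc.prems, of v] assms(3) obtain b R' where
    R': "R = smult b ([:1, -v:] ^ n) + [:1, -u:] * R'" "R' = 0 \<or> degree R' < m + n"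
    by auto
  from Suc.IH[OF R'(2)] obtain c c' where c: "\<And>x. u * x \<noteq> 1 \<Longrightarrow> v * x \<noteq> 1 \<Longrightarrow>
         poly R' x / ((1 - u * x) ^ m * (1 - v * x) ^ n) =
         (\<Sum>r=1..m. c r / (1 - u * x) ^ r) + (\<Sum>r=1..n. c' r / (1 - v * x) ^ r)"
    by auto
  have "poly R x / ((1 - u * x) ^ Suc m * (1 - v * x) ^ n) =
      (\<Sum>r=1..Suc m. (c(Suc m := b)) r / (1 - u * x) ^ r) + (\<Sum>r=1..n. c' r / (1 - v * x) ^ r)"
    if x: "u * x \<noteq> 1" "v * x \<noteq> 1" for x
  proof -
    have "poly R x / ((1 - u * x) ^ Suc m * (1 - v * x) ^ n) =
       b / (1 - u * x) ^ Suc m + poly R' x / ((1 - u * x) ^ m * (1 - v * x) ^ n)"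
      using x by (simp add: R'(1) divide_simps poly_power) (simp add: algebra_simps)?
    also have "\<dots> = (\<Sum>r=1..Suc m. (c(Suc m := b)) r / (1 - u * x) ^ r) +
        (\<Sum>r=1..n. c' r / (1 - v * x) ^ r)"
      unfolding c[OF x] by (simp add: add_ac)
    finally show ?thesis .
  qed
  thus ?case by blast
qed

lemma zeta3_neq_inverse: "zeta3 \<noteq> inverse zeta3"
  using zeta3_diff by auto

text \<open>Every prescribed summand carries a factor x, so Q / x is decomposed; the remaining
  factors \<open>zeta3\<close> and \<open>inverse zeta3\<close> of the numerators go into the
  coefficients. Existence is what gives the choice in \<open>pf_coeff\<close> its defining
  property.\<close>

lemma pf_decomposition_exists:
  assumes "k \<ge> 1" "degree Q \<le> 2 * k - 1" "poly Q 0 = 0"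
  shows "\<exists>a a'. pf_decomposition k Q a a'"
proof -
  from assms(3) have "[:0, 1:] dvd Q" by (simp add: poly_eq_0_iff_dvd)
  then obtain R where R: "Q = [:0, 1:] * R" by (elim dvdE)
  have "R = 0 \<or> degree R < k + k"
    using assms(1,2) by (cases "R = 0") (auto simp: R degree_mult_eq)
  from partial_fractions_two_poles[OF zeta3_nz _ zeta3_neq_inverse this] obtain b b' where
    b: "\<And>x. zeta3 * x \<noteq> 1 \<Longrightarrow> inverse zeta3 * x \<noteq> 1 \<Longrightarrow>
         poly R x / ((1 - zeta3 * x) ^ k * (1 - inverse zeta3 * x) ^ k) =
         (\<Sum>r=1..k. b r / (1 - zeta3 * x) ^ r) + (\<Sum>r=1..k. b' r / (1 - inverse zeta3 * x) ^ r)"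
    by auto
  have zz: "zeta3 * (x * (inverse zeta3 * t)) = x * t" for x t
    by (simp add: field_simps)
  have "pf_decomposition k Q (\<lambda>r. b r / zeta3) (\<lambda>r. b' r * zeta3)"
    unfolding pf_decomposition_def
  proof (intro allI impI)
    fix x :: complex assume "1 + x + x ^ 2 \<noteq> 0"
    hence nz: "zeta3 * x \<noteq> 1" "inverse zeta3 * x \<noteq> 1" by (auto simp: quadratic_factor)
    have "poly Q x / (1 + x + x ^ 2) ^ k = x * (poly R x / ((1 - zeta3 * x) ^ k * (1 - inverse zeta3 * x) ^ k))"
      by (simp add: R quadratic_factor power_mult_distrib)
    also have "\<dots> = (\<Sum>r=1..k. x * (b r / (1 - zeta3 * x) ^ r)) +
                   (\<Sum>r=1..k. x * (b' r / (1 - inverse zeta3 * x) ^ r))"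
      unfolding b[OF nz] by (simp add: sum_distrib_left ring_distribs)
    finally show "poly Q x / (1 + x + x ^ 2) ^ k =
        (\<Sum>r = 1..k. b r / zeta3 * (zeta3 * x / (1 - zeta3 * x) ^ r)) +
        (\<Sum>r = 1..k. b' r * zeta3 * (inverse zeta3 * x / (1 - inverse zeta3 * x) ^ r))"
      by (simp add: mult_ac zz)
  qed
  thus ?thesis by blast
qed

text \<open>Interchanging the sums over r and j produces the inner sum that defines
  \<open>c_coeff\<close>, with l = j + 1.\<close>

lemma partial_fraction_polylog_neg:
  assumes "y \<noteq> 1"
  shows "(\<Sum>r=1..k. a r * (y / (1 - y) ^ r)) =
         (\<Sum>j<k. (\<Sum>r=Suc j..k. a r / fact (r - 1) * of_nat (stirling (r - 1) j)) * polylog_neg j y)"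
proof -
  have "(\<Sum>r=1..k. a r * (y / (1 - y) ^ r)) = (\<Sum>r<k. a (Suc r) * (y / (1 - y) ^ Suc r))"
    by (rule sum.reindex_bij_witness[of _ Suc "\<lambda>r. r - 1"]) auto
  also have "\<dots> = (\<Sum>r<k. \<Sum>j\<le>r. a (Suc r) / fact r * of_nat (stirling r j) * polylog_neg j y)"
    unfolding stirling_polylog_neg[OF assms] sum_divide_distrib sum_distrib_left by (simp add: mult_ac)
  also have "\<dots> = (\<Sum>(r, j)\<in>(SIGMA r:{..<k}. {..r}). a (Suc r) / fact r * of_nat (stirling r j) * polylog_neg j y)"
    by (subst sum.Sigma) auto
  also have "\<dots> = (\<Sum>(j, r)\<in>(SIGMA j:{..<k}. {Suc j..k}). a r / fact (r - 1) * of_nat (stirling (r - 1) j) * polylog_neg j y)"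
    by (rule sum.reindex_bij_witness[of _ "\<lambda>(j, r). (r - 1, j)" "\<lambda>(r, j). (j, Suc r)"]) auto
  also have "\<dots> = (\<Sum>j<k. \<Sum>r=Suc j..k. a r / fact (r - 1) * of_nat (stirling (r - 1) j) * polylog_neg j y)"
    by (subst sum.Sigma) auto
  finally show ?thesis by (simp add: sum_distrib_right)
qed

text \<open>The quotient is invariant under x -> 1/x, and this map exchanges its two poles. So the
  coefficients at one pole determine those at the other, up to the sign from
  \<open>polylog_neg_inverse\<close>.\<close>

lemma quotient_eq_polylog_neg:
  assumes "k \<ge> 1" "degree Q \<le> 2 * k - 1" "poly Q 0 = 0"
    and sym: "\<And>x. x \<noteq> 0 \<Longrightarrow> poly Q x = x ^ (2 * k) * poly Q (1 / x)"
    and x: "1 + x + x ^ 2 \<noteq> 0"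
  shows "poly Q x / (1 + x + x ^ 2) ^ k =
    (\<Sum>j<k. c_coeff k Q (Suc j) *
       (polylog_neg j (zeta3 * x) - (- 1) ^ j * polylog_neg j (inverse zeta3 * x)))"
proof -
  define e where "e = (\<lambda>j. c_coeff k Q (Suc j))"
  have "\<exists>a'. pf_decomposition k Q (pf_coeff k Q) a'"
    unfolding pf_coeff_def using pf_decomposition_exists[OF assms(1-3)] by (rule someI_ex)
  then obtain a' where a': "pf_decomposition k Q (pf_coeff k Q) a'" ..
  define e' where "e' = (\<lambda>j. \<Sum>r=Suc j..k. a' r / fact (r - 1) * of_nat (stirling (r - 1) j))"
  have decomp: "poly Q x / (1 + x + x ^ 2) ^ k =
      (\<Sum>j<k. e j * polylog_neg j (zeta3 * x)) + (\<Sum>j<k. e' j * polylog_neg j (inverse zeta3 * x))"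
    if "1 + x + x ^ 2 \<noteq> 0" for x
  proof -
    have "zeta3 * x \<noteq> 1" "inverse zeta3 * x \<noteq> 1" using that by (auto simp: quadratic_factor)
    moreover have "poly Q x / (1 + x + x ^ 2) ^ k =
        (\<Sum>r=1..k. pf_coeff k Q r * (zeta3 * x / (1 - zeta3 * x) ^ r)) +
        (\<Sum>r=1..k. a' r * (inverse zeta3 * x / (1 - inverse zeta3 * x) ^ r))"
      using a' that by (simp add: pf_decomposition_def)
    ultimately show ?thesis
      by (simp only: partial_fraction_polylog_neg e_def e'_def c_coeff_def diff_Suc_1 not_False_eq_True)
  qed
  \<comment> \<open>These are the coefficients of the quotient at x minus the quotient at 1/x;
    \<open>C\<close> collects the constants that inversion leaves for j = 0.\<close>
  define d where "d = (\<lambda>j. e j - (- 1) ^ Suc j * e' j)"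
  define d' where "d' = (\<lambda>j. e' j - (- 1) ^ Suc j * e j)"
  define C where "C = (\<Sum>j<k. (e j + e' j) * of_bool (j = 0))"
  have zero: "(\<Sum>j<k. d j * polylog_neg j (zeta3 * x)) +
              (\<Sum>j<k. d' j * polylog_neg j (inverse zeta3 * x)) + C = 0"
    if x: "1 + x + x ^ 2 \<noteq> 0" "x \<noteq> 0" for x
  proof -
    have nz: "zeta3 * x \<noteq> 1" "inverse zeta3 * x \<noteq> 1" using x by (auto simp: quadratic_factor)
    have "1 + 1 / x + (1 / x) ^ 2 = (1 + x + x ^ 2) / x ^ 2"
      using x by (simp add: field_simps power2_eq_square)
    hence x': "1 + 1 / x + (1 / x) ^ 2 \<noteq> 0" and eq: "(1 + 1 / x + (1 / x) ^ 2) ^ k = (1 + x + x ^ 2) ^ k / x ^ (2 * k)"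
      using x by (simp_all add: power_divide power_mult)
    have inv: "zeta3 * (1 / x) = 1 / (inverse zeta3 * x)" "inverse zeta3 * (1 / x) = 1 / (zeta3 * x)"
      using x by (auto simp: field_simps)
    have "poly Q (1 / x) / (1 + 1 / x + (1 / x) ^ 2) ^ k = poly Q x / (1 + x + x ^ 2) ^ k"
      unfolding eq sym[OF x(2)] using x by simp
    hence "(\<Sum>j<k. e j * polylog_neg j (zeta3 * x)) + (\<Sum>j<k. e' j * polylog_neg j (inverse zeta3 * x)) -
       ((\<Sum>j<k. e j * polylog_neg j (zeta3 * (1 / x))) + (\<Sum>j<k. e' j * polylog_neg j (inverse zeta3 * (1 / x)))) = 0"
      unfolding decomp[OF x(1)] decomp[OF x'] by simp
    thus ?thesis
      unfolding inv using nz x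
      by (subst (asm) (1 2) polylog_neg_inverse)
         (auto simp: C_def d_def d'_def sum.distrib sum_subtractf sum_negf algebra_simps simp del: of_bool_eq_iff)
  qed
  \<comment> \<open>Put y = \<open>zeta3 * x\<close>. As y tends to 1, the argument of the second
    sum tends to the inverse square of \<open>zeta3\<close>, which is not 1, so only the sum with
    coefficients \<open>d\<close> could have a pole.\<close>
  have "((\<lambda>y. \<Sum>j<k. d j * polylog_neg j y) \<longlongrightarrow>
           - (\<Sum>j<k. d' j * polylog_neg j (inverse zeta3 * (inverse zeta3 * 1))) - C) (at 1)"
  proof (rule Lim_transform_eventually)
    have *: "inverse zeta3 * (inverse zeta3 * 1) \<noteq> 1"
      using zeta3_neq_inverse by (auto simp: field_simps power2_eq_square)
    show "((\<lambda>y. - (\<Sum>j<k. d' j * polylog_neg j (inverse zeta3 * (inverse zeta3 * y))) - C) \<longlongrightarrow>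
       - (\<Sum>j<k. d' j * polylog_neg j (inverse zeta3 * (inverse zeta3 * 1))) - C) (at 1)"
      by (intro tendsto_intros isCont_tendsto_compose[OF continuous_polylog_neg[OF *]])
    \<comment> \<open>The square of \<open>zeta3\<close> is the pole of the second sum in the
      variable y, and 0 is excluded because 1/x occurs.\<close>
    have "eventually (\<lambda>y. y \<in> - {zeta3 * zeta3, 0} - {1}) (at (1 :: complex))"
      using * by (intro eventually_at_in_open) (auto simp: open_Compl field_simps)
    thus "eventually (\<lambda>y. - (\<Sum>j<k. d' j * polylog_neg j (inverse zeta3 * (inverse zeta3 * y))) - C
            = (\<Sum>j<k. d j * polylog_neg j y)) (at 1)"
    proof eventually_elim
      case (elim y)
      have "1 + inverse zeta3 * y + (inverse zeta3 * y) ^ 2 \<noteq> 0"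
        unfolding quadratic_factor mult_eq_0_iff de_Morgan_disj using elim by (auto simp: field_simps)
      from zero[OF this] elim
      have "(\<Sum>j<k. d j * polylog_neg j y) +
          (\<Sum>j<k. d' j * polylog_neg j (inverse zeta3 * (inverse zeta3 * y))) + C = 0"
        by (simp add: mult.assoc[symmetric])
      thus ?case by algebra
    qed
  qed
  hence d_eq_0: "d j = 0" if "j < k" for j
    using polylog_neg_independent that by blast
  hence e': "e' j = - ((- 1) ^ j * e j)" if "j < k" for j
    using d_eq_0[OF that] by (cases "even j") (auto simp: d_def add_eq_0_iff)
  have e_eq: "c_coeff k Q (Suc j) = e j" for j by (simp add: e_def)
  show ?thesis
    unfolding decomp[OF x] sum.distrib[symmetric] e_eq
    by (intro sum.cong refl) (simp add: e' algebra_simps)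
qed

subsection \<open>Holomorphic series and Mellin integrals\<close>

text \<open>By Weierstrass, a local summable bound on the functions themselves suffices; no bound on
  the derivatives is asked for.\<close>

lemma series_termwise_derivative:
  fixes f f' :: "nat \<Rightarrow> complex \<Rightarrow> complex"
  assumes "open S" "\<And>n x. x \<in> S \<Longrightarrow> (f n has_field_derivative f' n x) (at x)"
    and dom: "\<And>x. x \<in> S \<Longrightarrow> \<exists>d h. d > 0 \<and> summable (h :: nat \<Rightarrow> real) \<and>
                (\<forall>\<^sub>F n in sequentially. \<forall>y\<in>ball x d \<inter> S. norm (f n y) \<le> h n)"
    and "x \<in> S"
  shows "summable (\<lambda>n. f n x)" "summable (\<lambda>n. f' n x)"
    "((\<lambda>x. \<Sum>n. f n x) has_field_derivative (\<Sum>n. f' n x)) (at x)"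
proof -
  have "\<exists>g g'. \<forall>x\<in>S. (\<lambda>n. f n x) sums g x \<and> (\<lambda>n. f' n x) sums g' x \<and>
          (g has_field_derivative g' x) (at x)"
  proof (rule series_and_derivative_comparison_complex[OF assms(1,2)], assumption)
    fix x assume "x \<in> S"
    from dom[OF this] obtain d and h :: "nat \<Rightarrow> real" where h: "d > 0" "summable h"
      "\<forall>\<^sub>F n in sequentially. \<forall>y\<in>ball x d \<inter> S. norm (f n y) \<le> h n" by blast
    have "\<exists>h'. summable h' \<and> (\<forall>n. 0 \<le> h' n) \<and>
       (\<forall>\<^sub>F n in sequentially. \<forall>y\<in>ball x d \<inter> S. norm (f n y) \<le> h' n)"
    proof -
      \<comment> \<open>Where the bound holds, h n is at least a norm and hence nonnegative; at the
        finitely many other indices it is replaced by 0.\<close>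
      define h' where "h' = (\<lambda>n. if \<forall>y\<in>ball x d \<inter> S. norm (f n y) \<le> h n then h n else 0)"
      have ev: "\<forall>\<^sub>F n in sequentially. h' n = h n"
        using h(3) by eventually_elim (simp add: h'_def)
      have "h' n \<ge> 0" for n
        using \<open>x \<in> S\<close> \<open>d > 0\<close> norm_ge_zero[of "f n x"] unfolding h'_def
        by (smt (verit) IntI centre_in_ball)
      moreover have "summable h'" using summable_cong[OF ev] h(2) by simp
      moreover have "\<forall>\<^sub>F n in sequentially. \<forall>y\<in>ball x d \<inter> S. norm (f n y) \<le> h' n"
        using h(3) ev by eventually_elim auto
      ultimately show ?thesis by blast
    qed
    then obtain h' where "summable h'" "\<And>n. 0 \<le> h' n"
       "\<forall>\<^sub>F n in sequentially. \<forall>y\<in>ball x d \<inter> S. norm (f n y) \<le> h' n" by blast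
    thus "\<exists>d h. 0 < d \<and> summable h \<and> range h \<subseteq> \<real>\<^sub>\<ge>\<^sub>0 \<and>
      (\<forall>\<^sub>F n in sequentially. \<forall>y\<in>ball x d \<inter> S. cmod (f n y) \<le> cmod (h n))"
      using \<open>d > 0\<close>
      by (intro exI[of _ d] exI[of _ "\<lambda>n. complex_of_real (h' n)"])
         (auto intro!: summable_of_real simp: nonneg_Reals_def)
  qed
  then obtain g g' where g: "\<And>x. x \<in> S \<Longrightarrow> (\<lambda>n. f n x) sums g x" "\<And>x. x \<in> S \<Longrightarrow> (\<lambda>n. f' n x) sums g' x"
    "\<And>x. x \<in> S \<Longrightarrow> (g has_field_derivative g' x) (at x)" by blast
  show "summable (\<lambda>n. f n x)" "summable (\<lambda>n. f' n x)"
    using g(1,2)[OF assms(4)] by (auto simp: sums_iff)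
  have "((\<lambda>x. \<Sum>n. f n x) has_field_derivative g' x) (at x)"
    by (rule has_field_derivative_transform_within_open[OF g(3)[OF assms(4)] assms(1,4)])
       (use g(1) in \<open>auto simp: sums_iff\<close>)
  thus "((\<lambda>x. \<Sum>n. f n x) has_field_derivative (\<Sum>n. f' n x)) (at x)"
    using g(2)[OF assms(4)] by (simp add: sums_iff)
qed

lemma series_holomorphic:
  fixes f :: "nat \<Rightarrow> complex \<Rightarrow> complex"
  assumes "open S" "\<And>n. f n holomorphic_on S"
    and "\<And>x. x \<in> S \<Longrightarrow> \<exists>d h. d > 0 \<and> summable (h :: nat \<Rightarrow> real) \<and>
                (\<forall>\<^sub>F n in sequentially. \<forall>y\<in>ball x d \<inter> S. norm (f n y) \<le> h n)"
  shows "(\<lambda>x. \<Sum>n. f n x) holomorphic_on S"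
proof -
  have *: "((\<lambda>x. \<Sum>n. f n x) has_field_derivative (\<Sum>n. deriv (f n) x)) (at x)" if "x \<in> S" for x
    by (rule series_termwise_derivative(3)[OF assms(1) _ assms(3) that])
       (use assms(1,2) in \<open>auto intro: holomorphic_derivI\<close>)
  show ?thesis using * assms(1) by (auto simp: holomorphic_on_open)
qed

text \<open>The substitution t -> a t in Euler's integral. With a = n + 1 it is the Mellin transform
  of one exponential, which is how the terms of a Dirichlet series arise.\<close>

lemma Gamma_integral_scaled:
  assumes "Re z > 0" "a > 0"
  shows "((\<lambda>t. of_real t powr (z - 1) * of_real (exp (- (a * t)))) has_integral
            (Gamma z / of_real a powr z)) {0..}"
proof -
  define f where "f = (\<lambda>t. complex_of_real t powr (z - 1) / of_real (exp t))"
  have "f absolutely_integrable_on {0<..}" "integral {0<..} f = Gamma z"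
    using absolutely_integrable_Gamma_integral'[OF assms(1)] Gamma_integral_complex'[OF assms(1)]
    by (auto simp: f_def)
  moreover have img: "(\<lambda>t. a * t) ` {0<..} = {0<..}"
  proof safe
    fix x :: real assume "x > 0"
    thus "x \<in> (\<lambda>t. a * t) ` {0<..}" using assms by (intro image_eqI[of _ _ "x / a"]) auto
  qed (use assms in auto)
  moreover have "(\<lambda>x. \<bar>a\<bar> *\<^sub>R f (a * x)) absolutely_integrable_on {0<..} \<and>
      integral {0<..} (\<lambda>x. \<bar>a\<bar> *\<^sub>R f (a * x)) = Gamma z
      \<longleftrightarrow> f absolutely_integrable_on (\<lambda>t. a * t) ` {0<..} \<and> integral ((\<lambda>t. a * t) ` {0<..}) f = Gamma z"
    by (rule has_absolute_integral_change_of_variables_real)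
       (use assms in \<open>auto intro!: derivative_eq_intros inj_onI\<close>)
  ultimately have "(\<lambda>x. \<bar>a\<bar> *\<^sub>R f (a * x)) absolutely_integrable_on {0<..} \<and>
      integral {0<..} (\<lambda>x. \<bar>a\<bar> *\<^sub>R f (a * x)) = Gamma z"
    by simp
  hence "((\<lambda>x. \<bar>a\<bar> *\<^sub>R f (a * x)) has_integral Gamma z) {0<..}"
    by (auto simp: absolutely_integrable_on_def has_integral_integrable_integral)
  hence "((\<lambda>x. (1 / of_real a powr z) * (\<bar>a\<bar> *\<^sub>R f (a * x))) has_integral (1 / of_real a powr z) * Gamma z) {0<..}"
    by (rule has_integral_mult_right)
  also have "?this \<longleftrightarrow> ((\<lambda>t. of_real t powr (z - 1) * of_real (exp (- (a * t)))) has_integral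
            (1 / of_real a powr z) * Gamma z) {0<..}"
  proof (rule has_integral_cong)
    fix t :: real assume "t \<in> {0<..}"
    hence "f (a * t) = complex_of_real a powr (z - 1) * of_real t powr (z - 1) * of_real (exp (- (a * t)))"
      using assms by (simp add: f_def powr_times_real exp_minus field_simps)
    moreover have "complex_of_real a powr (z - 1) = of_real a powr z / of_real a"
      using assms by (simp add: powr_diff)
    ultimately show "(1 / of_real a powr z) * (\<bar>a\<bar> *\<^sub>R f (a * t)) =
        of_real t powr (z - 1) * of_real (exp (- (a * t)))"
      using assms by (simp add: scaleR_conv_of_real)
  qed
  also have "\<dots> \<longleftrightarrow> ?thesis"
  proof -
    have "((\<lambda>t. of_real t powr (z - 1) * of_real (exp (- (a * t)))) has_integral I) {0<..} \<longleftrightarrow>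
      ((\<lambda>t. of_real t powr (z - 1) * of_real (exp (- (a * t)))) has_integral I) {0..}" for I
      by (rule has_integral_spike_set_eq; rule negligible_subset[of "{0}"]; auto)
    thus ?thesis by simp
  qed
  finally show ?thesis .
qed

lemma has_integral_complex_powr_01:
  assumes "Re z > 0"
  shows "((\<lambda>t. of_real t powr (z - 1)) has_integral (1 / z)) {0..1}"
proof -
  have z: "z \<noteq> 0" using assms by auto
  have "((\<lambda>t. of_real t powr (z - 1)) has_integral (of_real 1 powr z / z - of_real 0 powr z / z)) {0..1}"
  proof (rule fundamental_theorem_of_calculus_interior)
    show "continuous_on {0..1} (\<lambda>t. complex_of_real t powr z / z)"
      using assms z by (intro continuous_intros) auto
    fix t :: real assume t: "t \<in> {0<..<1}"
    have "((\<lambda>w. w powr z / z) has_field_derivative (of_real t powr (z - 1))) (at (of_real t))"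
      using t z by (auto intro!: derivative_eq_intros simp: complex_nonpos_Reals_iff)
    thus "((\<lambda>t. of_real t powr z / z) has_vector_derivative of_real t powr (z - 1)) (at t)"
      by (rule has_vector_derivative_real_field)
  qed simp
  thus ?thesis by simp
qed

lemma powr_exp_integrable:
  fixes a x :: real
  assumes "a > 0" "x > -1"
  shows "(\<lambda>t. t powr x * exp (- (a * t))) integrable_on {0..}"
proof -
  have "(\<lambda>t. Re (of_real t powr (complex_of_real (x + 1) - 1) * of_real (exp (- (a * t))))) integrable_on {0..}"
    using has_integral_Re[OF Gamma_integral_scaled[of "of_real (x + 1)" a]] assms by auto
  also have "?this \<longleftrightarrow> ?thesis"
    by (rule integrable_cong) (simp add: powr_of_real)
  finally show ?thesis .
qed

lemma holomorphic_on_parametric_integral: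
  assumes "0 < a" "a \<le> b" "continuous_on {a..b} A"
  shows "(\<lambda>s. integral {a..b} (\<lambda>t. of_real t powr (s - 1) * A t)) holomorphic_on UNIV"
proof -
  have ne: "complex_of_real t \<noteq> 0" if "t \<in> {a..b}" for t using that assms by auto
  have cont: "continuous_on (UNIV \<times> {a..b}) (\<lambda>(s, t). (ln (of_real t) * of_real t powr (s - 1)) * A t)"
    unfolding case_prod_unfold using assms
    by (intro continuous_intros continuous_on_compose2[OF assms(3)]) auto
  have "(\<lambda>s. integral (cbox a b) (\<lambda>t. of_real t powr (s - 1) * A t)) field_differentiable at s within UNIV" for s
  proof (rule leibniz_rule_field_differentiable)
    show "((\<lambda>s. of_real t powr (s - 1) * A t) has_field_derivative
           (ln (of_real t) * of_real t powr (s - 1)) * A t) (at s within UNIV)" if "t \<in> cbox a b" for s t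
      using DERIV_cmult_right[OF DERIV_chain2[OF has_field_derivative_powr_right[OF ne[of t]],
              of "\<lambda>s. s - 1" 1 s UNIV], of "A t"] that
      by (simp add: DERIV_diff[where E = 0, simplified])
    show "(\<lambda>t. of_real t powr (s - 1) * A t) integrable_on cbox a b" for s
      by (rule integrable_continuous) (use assms ne in \<open>auto intro!: continuous_intros\<close>)
    show "continuous_on (UNIV \<times> cbox a b) (\<lambda>(s, t). (ln (of_real t) * of_real t powr (s - 1)) * A t)"
      using cont by simp
  qed auto
  thus ?thesis by (simp add: holomorphic_on_def)
qed

text \<open>The integrals over [1, n + 1] are entire by differentiation under the integral sign, and
  the exponential decay makes them converge uniformly on discs, so the limit is entire too.\<close>

lemma
  fixes A :: "real \<Rightarrow> complex"
  assumes cont: "continuous_on {1..} A" and bnd: "\<And>t. t \<ge> 1 \<Longrightarrow> norm (A t) \<le> B * exp (- (t / 2))"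
  shows mellin_tail_integrable: "(\<lambda>t. of_real t powr (s - 1) * A t) integrable_on {1..}"
    and mellin_tail_holomorphic: "(\<lambda>s. integral {1..} (\<lambda>t. of_real t powr (s - 1) * A t)) holomorphic_on UNIV"
proof -
  define f where "f = (\<lambda>s t. complex_of_real t powr (s - 1) * A t)"
  define h where "h = (\<lambda>R t. B * (t powr R * exp (- (1 / 2 * t))))"
  \<comment> \<open>An indicator function as a factor: integrals over growing intervals become
    integrals over a fixed domain, to which dominated convergence applies.\<close>
  define cut where "cut = (\<lambda>n t. if t \<in> {1..real n + 1} then 1 else (0 :: real))"
  have B: "B \<ge> 0" using bnd[of 1] by (smt (verit, best) exp_gt_zero norm_ge_zero order_refl zero_le_mult_iff)
  have h_nonneg: "h R t \<ge> 0" for R t using B by (auto simp: h_def)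
  have "h R integrable_on {0..}" if "R \<ge> 0" for R
    unfolding h_def using that by (intro integrable_on_mult_right powr_exp_integrable) auto
  hence "h R absolutely_integrable_on {0..}" if "R \<ge> 0" for R
    using that h_nonneg by (intro nonnegative_absolutely_integrable_1) auto
  hence "h R absolutely_integrable_on {1..}" if "R \<ge> 0" for R
    by (rule set_integrable_subset) (use that in auto)
  hence h_int: "h R integrable_on {1..}" if "R \<ge> 0" for R
    using that by (auto simp: absolutely_integrable_on_def)
  have f_h: "norm (f s t) \<le> h R t" if "Re s \<le> R + 1" "t \<ge> 1" for s R t
  proof -
    have "norm (complex_of_real t powr (s - 1)) = t powr (Re s - 1)"
      using that by (subst norm_powr_real_powr) auto
    also have "\<dots> \<le> t powr R" using that by (intro powr_mono) auto
    finally show ?thesis unfolding f_def h_def norm_mult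
      using bnd[OF that(2)] B by (subst mult.left_commute, intro mult_mono) auto
  qed
  have f_int_fin: "f s integrable_on {1..real n + 1}" for s n
    unfolding f_def
    by (intro integrable_continuous_interval continuous_intros continuous_on_subset[OF cont]) auto
  have cut_int: "(\<lambda>t. cut n t *\<^sub>R f s t) integrable_on {1..}"
    and cut_integral: "integral {1..} (\<lambda>t. cut n t *\<^sub>R f s t) = integral {1..real n + 1} (f s)" for n s
  proof -
    have "(f s has_integral integral {1..real n + 1} (f s)) {1..real n + 1}"
      using f_int_fin by blast
    hence "((\<lambda>t. if t \<in> {1..real n + 1} then f s t else 0) has_integral integral {1..real n + 1} (f s)) {1..}"
      by (subst has_integral_restrict) auto
    also have "(\<lambda>t. if t \<in> {1..real n + 1} then f s t else 0) = (\<lambda>t. cut n t *\<^sub>R f s t)"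
      by (auto simp: cut_def fun_eq_iff)
    finally show "(\<lambda>t. cut n t *\<^sub>R f s t) integrable_on {1..}"
      "integral {1..} (\<lambda>t. cut n t *\<^sub>R f s t) = integral {1..real n + 1} (f s)"
      by auto
  qed
  have cut_lim: "(\<lambda>n. cut n t) \<longlonglongrightarrow> 1" if "t \<ge> 1" for t
  proof (rule tendsto_eventually)
    have "eventually (\<lambda>n. real n \<ge> t) sequentially"
      using filterlim_real_sequentially by (auto simp: filterlim_at_top)
    thus "eventually (\<lambda>n. cut n t = 1) sequentially"
      by eventually_elim (use that in \<open>auto simp: cut_def\<close>)
  qed
  have cut_le: "0 \<le> cut n t" "cut n t \<le> 1" for n t by (auto simp: cut_def)
  have f_int: "f s integrable_on {1..}" for s
  proof (rule dominated_convergence(1)[OF cut_int[of _ s] h_int[of "\<bar>Re s\<bar>"]])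
    fix k and t :: real assume "t \<in> {1..}"
    hence "norm (cut k t *\<^sub>R f s t) \<le> 1 * norm (f s t)"
      unfolding norm_scaleR using cut_le[of k t] by (intro mult_right_mono) auto
    also have "\<dots> \<le> h \<bar>Re s\<bar> t" using f_h[of s "\<bar>Re s\<bar>" t] \<open>t \<in> {1..}\<close> by auto
    finally show "norm (cut k t *\<^sub>R f s t) \<le> h \<bar>Re s\<bar> t" .
  next
    fix t :: real assume "t \<in> {1..}"
    hence "(\<lambda>k. cut k t *\<^sub>R f s t) \<longlonglongrightarrow> 1 *\<^sub>R f s t"
      by (intro tendsto_intros cut_lim) auto
    thus "(\<lambda>k. cut k t *\<^sub>R f s t) \<longlonglongrightarrow> f s t" by simp
  qed simp
  thus "(\<lambda>t. of_real t powr (s - 1) * A t) integrable_on {1..}" unfolding f_def by simp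
  have "(\<lambda>s. integral {1..} (f s)) holomorphic_on UNIV"
  proof (rule holomorphic_uniform_sequence)
    show "(\<lambda>s. integral {1..real n + 1} (f s)) holomorphic_on UNIV" for n
      unfolding f_def
      by (rule holomorphic_on_parametric_integral) (auto intro: continuous_on_subset[OF cont])
    fix x :: complex
    \<comment> \<open>On the closed unit disc about x the real part of s is at most this R, so the
      single function \<open>h R\<close> dominates all integrands there.\<close>
    define R where "R = norm x + 1"
    have R: "R \<ge> 0" by (simp add: R_def add_nonneg_nonneg)
    have cut_h: "(\<lambda>t. (1 - cut n t) * h R t) integrable_on {1..}" for n
    proof -
      have "h R integrable_on {1..real n + 1}"
        by (rule integrable_on_subinterval[OF h_int[OF R]]) auto
      hence "(\<lambda>t. if t \<in> {1..real n + 1} then h R t else 0) integrable_on {1..}"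
        by (subst integrable_restrict_Int) (simp add: Int_absorb1)
      from integrable_diff[OF h_int[OF R] this] show ?thesis
        by (rule integrable_eq) (auto simp: cut_def)
    qed
    have lim: "(\<lambda>n. integral {1..} (\<lambda>t. (1 - cut n t) * h R t)) \<longlonglongrightarrow> integral {1..} (\<lambda>t :: real. 0)"
    proof (rule dominated_convergence(2)[OF cut_h h_int[OF R]])
      fix n and t :: real
      show "norm ((1 - cut n t) * h R t) \<le> h R t"
        using h_nonneg[of R t] cut_le[of n t] by (auto simp: abs_mult mult_left_le_one_le)
      show "(\<lambda>k. (1 - cut k t) * h R t) \<longlonglongrightarrow> 0" if "t \<in> {1..}"
        using that by (auto intro!: tendsto_eq_intros cut_lim)
    qed
    have "uniform_limit (cball x 1) (\<lambda>n s. integral {1..real n + 1} (f s)) (\<lambda>s. integral {1..} (f s)) sequentially"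
    proof (rule uniform_limitI)
      fix e :: real assume "e > 0"
      with lim have "eventually (\<lambda>n. norm (integral {1..} (\<lambda>t. (1 - cut n t) * h R t)) < e) sequentially"
        using tendstoD[OF lim, of e] by simp
      thus "\<forall>\<^sub>F n in sequentially. \<forall>s\<in>cball x 1. dist (integral {1..real n + 1} (f s)) (integral {1..} (f s)) < e"
      proof eventually_elim
        case (elim n)
        show ?case
        proof
          fix s assume s: "s \<in> cball x 1"
          have "Re s \<le> norm s" by (rule complex_Re_le_cmod)
          also have "\<dots> \<le> R" using s norm_triangle_sub[of s x]
            by (auto simp: R_def dist_norm norm_minus_commute)
          finally have Re: "Re s \<le> R + 1" by simp
          have "integral {1..} (f s) - integral {1..real n + 1} (f s) =
                integral {1..} (\<lambda>t. f s t - cut n t *\<^sub>R f s t)"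
            by (subst integral_diff) (simp_all add: f_int cut_int cut_integral)
          also have "norm \<dots> \<le> integral {1..} (\<lambda>t. (1 - cut n t) * h R t)"
          proof (rule integral_norm_bound_integral)
            show "(\<lambda>t. f s t - cut n t *\<^sub>R f s t) integrable_on {1..}"
              by (intro integrable_diff f_int cut_int)
            fix t :: real assume "t \<in> {1..}"
            have "f s t - cut n t *\<^sub>R f s t = (1 - cut n t) *\<^sub>R f s t" by (simp add: algebra_simps)
            also have "norm \<dots> \<le> (1 - cut n t) * h R t"
              unfolding norm_scaleR using cut_le[of n t] f_h[OF Re] \<open>t \<in> {1..}\<close> by (simp add: mult_left_mono)
            finally show "norm (f s t - cut n t *\<^sub>R f s t) \<le> (1 - cut n t) * h R t" .
          qed (fact cut_h)
          also have "\<dots> < e" using elim by simp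
          finally show "dist (integral {1..real n + 1} (f s)) (integral {1..} (f s)) < e"
            by (simp add: dist_norm norm_minus_commute)
        qed
      qed
    qed
    thus "\<exists>d>0. cball x d \<subseteq> UNIV \<and>
         uniform_limit (cball x d) (\<lambda>n s. integral {1..real n + 1} (f s)) (\<lambda>s. integral {1..} (f s)) sequentially"
      by (intro exI[of _ 1]) auto
  qed simp
  thus "(\<lambda>s. integral {1..} (\<lambda>t. of_real t powr (s - 1) * A t)) holomorphic_on UNIV"
    by (simp add: f_def)
qed

text \<open>The left side is exp(-t/2) / (2 sinh(t/2)), and 2 sinh(t/2) >= t. One bound thus covers
  both ends: 1/t near 0 and exponential decay at infinity.\<close>

lemma half_exp_bound:
  fixes t :: real
  assumes "t > 0"
  shows "exp (- t) / (1 - exp (- t)) \<le> exp (- (t / 2)) / t"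
proof -
  have "t \<le> exp (t / 2) - exp (- (t / 2))"
    using real_le_x_sinh[of "t / 2"] assms by (simp add: exp_minus)
  hence "t * exp (- (t / 2)) \<le> (exp (t / 2) - exp (- (t / 2))) * exp (- (t / 2))"
    by (intro mult_right_mono) auto
  also have "\<dots> = 1 - exp (- t)" by (simp add: algebra_simps flip: exp_add)
  finally have "t * exp (- (t / 2)) * exp (- (t / 2)) \<le> (1 - exp (- t)) * exp (- (t / 2))"
    by (intro mult_right_mono) auto
  hence "exp (- t) * t \<le> exp (- (t / 2)) * (1 - exp (- t))"
    by (simp add: algebra_simps flip: exp_add)
  thus ?thesis using assms by (simp add: field_simps)
qed

lemma exp_series_bound:
  fixes \<psi> :: "nat \<Rightarrow> complex" and t :: real
  assumes "\<And>n. norm (\<psi> n) \<le> B" "t > 0"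
  shows "norm (\<Sum>n<K. \<psi> n * of_real (exp (- (real (Suc n) * t)))) \<le> B * (exp (- (t / 2)) / t)"
proof -
  have B: "B \<ge> 0" using norm_ge_zero order.trans assms(1) by blast
  have "norm (\<Sum>n<K. \<psi> n * of_real (exp (- (real (Suc n) * t)))) \<le> (\<Sum>n<K. B * exp (- (real (Suc n) * t)))"
    by (intro sum_norm_le) (simp add: norm_mult mult_right_mono assms)
  also have "\<dots> = B * (\<Sum>n<K. exp (- t) * exp (- t) ^ n)"
    by (simp add: sum_distrib_left exp_of_nat_mult[symmetric] exp_add[symmetric] algebra_simps)
  also have "(\<Sum>n<K. exp (- t) * exp (- t) ^ n) \<le> exp (- t) / (1 - exp (- t))"
  proof -
    have s: "(\<lambda>n. exp (- t) * exp (- t) ^ n) sums (exp (- t) * (1 / (1 - exp (- t))))"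
      using assms by (intro sums_mult geometric_sums) auto
    show ?thesis using sum_le_suminf[OF sums_summable[OF s], of "{..<K}"] sums_unique[OF s] by simp
  qed
  also have "\<dots> \<le> exp (- (t / 2)) / t" by (rule half_exp_bound) fact
  finally show ?thesis using B by (simp add: mult_left_mono)
qed

lemma holomorphic_pochhammer [holomorphic_intros]:
  "f holomorphic_on S \<Longrightarrow> (\<lambda>s. pochhammer (f s) n) holomorphic_on S" for f :: "complex \<Rightarrow> complex"
  by (induction n) (auto simp: pochhammer_Suc intro!: holomorphic_intros)

text \<open>The left side is entire in s, so it is the form of \<open>rGamma s / (s + j)\<close>
  that also has the right value at the removable singularity s = -j.\<close>

lemma rGamma_div_shift:
  fixes s :: complex
  assumes "s + of_nat j \<noteq> 0"
  shows "pochhammer s j * rGamma (s + of_nat j + 1) = rGamma s / (s + of_nat j)"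
  using pochhammer_rGamma[of s "Suc j"] assms by (simp add: pochhammer_Suc field_simps)

text \<open>For i < j the Pochhammer symbol contains the factor 0; for i > j the reciprocal Gamma
  function is evaluated at one of its zeros. This is what singles out one coefficient at each
  nonpositive integer.\<close>

lemma pochhammer_rGamma_at_neg:
  "pochhammer (- of_nat i) j * rGamma (- of_nat i + of_nat j + 1 :: complex) =
     (if i = j then (- 1) ^ j * fact j else 0)"
proof (cases i j rule: linorder_cases)
  case less
  thus ?thesis by (simp add: pochhammer_of_nat_eq_0_lemma)
next
  case equal
  thus ?thesis by (simp add: pochhammer_same)
next
  case greater
  then obtain d where d: "i = Suc (j + d)" using less_imp_Suc_add by blast
  have "- of_nat i + of_nat j + 1 = (- of_nat d :: complex)"
    by (simp add: d)
  hence "rGamma (- of_nat i + of_nat j + 1 :: complex) = 0"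
    by (simp only: rGamma_eq_zero_iff) simp
  thus ?thesis using greater by simp
qed

text \<open>
  Riemann's method: split \<open>\<Gamma>(s) F(s) = \<integral> t\<^sup>s\<^sup>-\<^sup>1 A(t) dt\<close> at \<open>t = 1\<close>. The integral over \<open>[1, \<infinity>)\<close>
  is entire, the other one is \<open>c / (s - 1) + \<Sum>j. a j / (s + j)\<close>; since \<open>1 / \<Gamma>\<close> vanishes at
  \<open>-j\<close> with derivative \<open>(-1)\<^sup>j j!\<close>, division by \<open>\<Gamma>\<close> turns the pole there into a value.
\<close>

lemma dirichlet_series_continuation:
  fixes \<psi> :: "nat \<Rightarrow> complex" and A :: "real \<Rightarrow> complex"
  assumes bnd: "\<And>n. norm (\<psi> n) \<le> B"
    and A: "\<And>t. t > 0 \<Longrightarrow> (\<lambda>n. \<psi> n * of_real (exp (- (real (Suc n) * t)))) sums A t"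
    and cont: "continuous_on {0<..} A"
    and a: "summable (\<lambda>j. norm (a j))"
    and near0: "\<And>t. 0 < t \<Longrightarrow> t \<le> 1 \<Longrightarrow> A t = c / of_real t + (\<Sum>j. a j * of_real t ^ j)"
  shows "\<exists>F. F holomorphic_on - {1} \<and>
             (\<forall>s. Re s > 1 \<longrightarrow> (\<lambda>n. \<psi> n / of_nat (Suc n) powr s) sums F s) \<and>
             (\<forall>j. F (- of_nat j) = (- 1) ^ j * fact j * a j)"
proof -
  define I where "I = (\<lambda>s. integral {1..} (\<lambda>t. of_real t powr (s - 1) * A t))"
  define e where "e = (\<lambda>j s. pochhammer s j * rGamma (s + of_nat j + 1 :: complex))"
  define F where "F = (\<lambda>s. c * rGamma s / (s - 1) + (\<Sum>j. a j * e j s) + rGamma s * I s)"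
  have B: "B \<ge> 0" using norm_ge_zero order.trans bnd by blast

  have A_bound: "norm (A t) \<le> B * (exp (- (t / 2)) / t)" if "t > 0" for t
    using exp_series_bound[OF bnd that] A[OF that] unfolding sums_def
    by (intro Lim_norm_ubound[OF _ A[OF that, unfolded sums_def]] always_eventually) auto
  have cont1: "continuous_on {1..} A" by (rule continuous_on_subset[OF cont]) auto
  have bnd1: "norm (A t) \<le> B * exp (- (t / 2))" if "t \<ge> 1" for t
  proof -
    have "exp (- (t / 2)) / t \<le> exp (- (t / 2))" using that by (simp add: divide_le_eq)
    thus ?thesis using A_bound[of t] that B by (meson mult_left_mono order.trans less_le_trans zero_less_one)
  qed
  have I_hol: "I holomorphic_on UNIV"
    unfolding I_def by (rule mellin_tail_holomorphic[OF cont1 bnd1])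

  have e_eq: "e j s = rGamma s / (s + of_nat j)" if "s + of_nat j \<noteq> 0" for j s
    unfolding e_def by (rule rGamma_div_shift[OF that])
  have e_hol: "e j holomorphic_on UNIV" for j
    unfolding e_def by (intro holomorphic_intros)
  have sum_hol: "(\<lambda>s. \<Sum>j. a j * e j s) holomorphic_on UNIV"
  proof (rule series_holomorphic)
    fix x :: complex
    have "compact (rGamma ` cball x 1)"
      by (intro compact_continuous_image continuous_on_rGamma) auto
    then obtain M where M: "\<And>s. s \<in> cball x 1 \<Longrightarrow> norm (rGamma s) \<le> M"
      using compact_imp_bounded bounded_iff by (metis image_eqI)
    have ev: "\<forall>\<^sub>F j in sequentially. \<forall>s\<in>ball x 1 \<inter> UNIV. norm (a j * e j s) \<le> norm (a j) * M"
    proof -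
      have "\<forall>\<^sub>F j in sequentially. real j \<ge> norm x + 2"
        using filterlim_real_sequentially by (auto simp: filterlim_at_top)
      thus ?thesis
      proof eventually_elim
        case (elim j)
        show ?case
        proof
          fix s assume "s \<in> ball x 1 \<inter> UNIV"
          hence s: "dist x s < 1" by auto
          \<comment> \<open>Since j >= |x| + 2 and |s| <= |x| + 1, the denominator s + j has modulus
            at least 1, so \<open>e j\<close> is bounded by \<open>rGamma\<close> uniformly in
            j.\<close>
          have "real j = norm (s + of_nat j - s)" by simp
          also have "\<dots> \<le> norm (s + of_nat j) + norm s" by (rule norm_triangle_ineq4)
          also have "norm s \<le> norm x + 1"
            using s norm_triangle_sub[of s x] by (auto simp: dist_norm norm_minus_commute)
          finally have ge1: "norm (s + of_nat j) \<ge> 1" using elim by simp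
          hence "norm (e j s) = norm (rGamma s) / norm (s + of_nat j)"
            by (subst e_eq) (auto simp: norm_divide)
          also have "\<dots> \<le> norm (rGamma s) / 1" using ge1 by (intro divide_left_mono) auto
          also have "\<dots> \<le> M" using M[of s] s by auto
          finally show "norm (a j * e j s) \<le> norm (a j) * M"
            by (simp add: norm_mult mult_left_mono)
        qed
      qed
    qed
    show "\<exists>d h. d > 0 \<and> summable (h :: nat \<Rightarrow> real) \<and>
       (\<forall>\<^sub>F j in sequentially. \<forall>s\<in>ball x d \<inter> UNIV. norm (a j * e j s) \<le> h j)"
      by (intro exI[of _ 1] exI[of _ "\<lambda>j. norm (a j) * M"] conjI ev summable_mult2 a) auto
  qed (auto intro!: holomorphic_intros e_hol)

  have F_hol: "F holomorphic_on - {1}"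
    unfolding F_def
    by (intro holomorphic_intros holomorphic_on_subset[OF sum_hol] holomorphic_on_subset[OF I_hol]) auto

  have F_neg: "F (- of_nat j) = (- 1) ^ j * fact j * a j" for j
  proof -
    \<comment> \<open>At s = -j the factor \<open>rGamma s\<close> removes both the pole term and
      the tail integral, and in the series only the term with index j survives.\<close>
    have e_neg: "e i (- of_nat j) = (if j = i then (- 1) ^ i * fact i else 0)" for i
      by (simp only: e_def pochhammer_rGamma_at_neg)
    have "(\<lambda>i. a i * e i (- of_nat j)) = (\<lambda>i. if i = j then a i * e i (- of_nat j) else 0)"
      by (auto simp: e_neg)
    hence "(\<lambda>i. a i * e i (- of_nat j)) sums (a j * e j (- of_nat j))"
      using sums_single[of j "\<lambda>i. a i * e i (- of_nat j)"] by simp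
    moreover have "rGamma (- of_nat j :: complex) = 0" by (simp add: rGamma_eq_zero_iff)
    ultimately show ?thesis
      unfolding F_def by (simp add: sums_iff e_neg)
  qed

  have F_sums: "(\<lambda>n. \<psi> n / of_nat (Suc n) powr s) sums F s" if s: "Re s > 1" for s
  proof -
    define g where "g = (\<lambda>t. of_real t powr (s - 1) * A t)"
    define S where "S = (\<lambda>K t. of_real t powr (s - 1) * (\<Sum>n<K. \<psi> n * of_real (exp (- (real (Suc n) * t)))))"
    \<comment> \<open>A bound for all partial sums at once; it is integrable at 0 because Re s > 1
      makes the exponent Re s - 2 larger than -1.\<close>
    define h where "h = (\<lambda>t. B * (t powr (Re s - 2) * exp (- (1 / 2 * t))))"
    have norm_powr: "norm (complex_of_real t powr z) = t powr Re z" if "t \<ge> 0" for t z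
      using that by (subst norm_powr_real_powr) auto
    have S_int: "(S K has_integral Gamma s * (\<Sum>n<K. \<psi> n / of_nat (Suc n) powr s)) {0..}" for K
    proof -
      have "((\<lambda>t. \<Sum>n<K. \<psi> n * (of_real t powr (s - 1) * of_real (exp (- (real (Suc n) * t))))) has_integral
         (\<Sum>n<K. \<psi> n * (Gamma s / of_real (real (Suc n)) powr s))) {0..}"
        using s by (intro has_integral_sum has_integral_mult_right Gamma_integral_scaled) auto
      thus ?thesis by (simp add: S_def sum_distrib_left mult_ac)
    qed
    have h_int: "h integrable_on {0..}"
      unfolding h_def using s by (intro integrable_on_mult_right powr_exp_integrable) auto
    have S_le: "norm (S K t) \<le> h t" if "t \<in> {0..}" for K t
    proof (cases "t = 0")
      case False
      hence t: "t > 0" using that by auto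
      have "norm (S K t) \<le> t powr (Re s - 1) * (B * (exp (- (t / 2)) / t))"
        unfolding S_def norm_mult using t exp_series_bound[OF bnd t]
        by (intro mult_mono) (auto simp: norm_powr)
      also have "\<dots> = B * ((t powr (Re s - 1) / t) * exp (- (t / 2)))" by simp
      also have "t powr (Re s - 1) / t = t powr (Re s - 2)"
        using t by (simp add: powr_diff powr_numeral power2_eq_square)
      finally show ?thesis by (simp add: h_def)
    qed (use B in \<open>auto simp: S_def h_def\<close>)
    have S_lim: "(\<lambda>K. S K t) \<longlonglongrightarrow> g t" if "t \<in> {0..}" for t
    proof (cases "t = 0")
      case False
      thus ?thesis using A[of t] that unfolding S_def g_def sums_def by (intro tendsto_intros) auto
    qed (simp add: S_def g_def)
    have S_intble: "S K integrable_on {0..}" for K using S_int by blast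
    have g_int: "g integrable_on {0..}"
      by (rule dominated_convergence(1)[OF S_intble h_int S_le S_lim])
    have "(\<lambda>K. integral {0..} (S K)) \<longlonglongrightarrow> integral {0..} g"
      by (rule dominated_convergence(2)[OF S_intble h_int S_le S_lim])
    hence "(\<lambda>K. Gamma s * (\<Sum>n<K. \<psi> n / of_nat (Suc n) powr s)) \<longlonglongrightarrow> integral {0..} g"
      by (simp add: integral_unique[OF S_int])
    hence "(\<lambda>K. rGamma s * (Gamma s * (\<Sum>n<K. \<psi> n / of_nat (Suc n) powr s))) \<longlonglongrightarrow> rGamma s * integral {0..} g"
      by (intro tendsto_intros)
    moreover have "s \<notin> \<int>\<^sub>\<le>\<^sub>0" using s by (auto elim!: nonpos_Ints_cases)
    hence "rGamma s * Gamma s = 1"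
      by (simp add: rGamma_inverse_Gamma Gamma_eq_zero_iff)
    ultimately have sums: "(\<lambda>n. \<psi> n / of_nat (Suc n) powr s) sums (rGamma s * integral {0..} g)"
      unfolding sums_def by (simp add: mult.assoc[symmetric])

    \<comment> \<open>Partial sums of the expansion near 0, times t^(s-1), whose integrals over
      [0, 1] are the fractions 1 / (s + j). At t = 0 they agree with g because
      \<open>0 powr z = 0\<close>.\<close>
    define T where "T = (\<lambda>K t. c * of_real t powr (s - 1 - 1) + (\<Sum>j<K. a j * of_real t powr (s + of_nat j - 1)))"
    define M where "M = (\<Sum>j. norm (a j))"
    define h' where "h' = (\<lambda>t. norm c * t powr (Re s - 2) + M * t powr (Re s - 1))"
    have T_int: "(T K has_integral (c * (1 / (s - 1)) + (\<Sum>j<K. a j * (1 / (s + of_nat j))))) {0..1}" for K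
      unfolding T_def using s
      by (intro has_integral_add has_integral_sum has_integral_mult_right has_integral_complex_powr_01) auto
    have h'_int: "h' integrable_on {0..1}"
      unfolding h'_def using s
        has_integral_powr_from_0[of "Re s - 2" 1] has_integral_powr_from_0[of "Re s - 1" 1]
      by (intro integrable_add integrable_on_mult_right) (auto simp: integrable_on_def)
    have T_eq: "T K t = of_real t powr (s - 1) * (c / of_real t + (\<Sum>j<K. a j * of_real t ^ j))"
      if "0 < t" for K t
    proof -
      have "complex_of_real t powr (s + of_nat j - 1) = of_real t powr (s - 1) * of_real t ^ j" for j
      proof -
        have "s + of_nat j - 1 = (s - 1) + of_nat j" by simp
        thus ?thesis using that by (simp only: powr_add) simp
      qed
      moreover have "complex_of_real t powr (s - 1 - 1) = of_real t powr (s - 1) / of_real t"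
        using that by (subst powr_diff) simp
      ultimately show ?thesis unfolding T_def by (simp add: sum_distrib_left mult_ac ring_distribs)
    qed
    have T_le: "norm (T K t) \<le> h' t" if t: "t \<in> {0..1}" for K t
    proof -
      have "norm (T K t) \<le> norm c * t powr (Re s - 2) + (\<Sum>j<K. norm (a j) * t powr (Re s + real j - 1))"
        unfolding T_def using t
        by (intro order.trans[OF norm_triangle_ineq] add_mono order.trans[OF norm_sum] sum_mono)
           (auto simp: norm_mult norm_powr)
      also have "(\<Sum>j<K. norm (a j) * t powr (Re s + real j - 1)) \<le> (\<Sum>j<K. norm (a j) * t powr (Re s - 1))"
        using t s by (intro sum_mono mult_left_mono powr_mono') auto
      also have "\<dots> = (\<Sum>j<K. norm (a j)) * t powr (Re s - 1)" by (simp add: sum_distrib_right)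
      also have "\<dots> \<le> M * t powr (Re s - 1)"
        unfolding M_def by (intro mult_right_mono sum_le_suminf a) auto
      finally show ?thesis by (simp add: h'_def)
    qed
    have T_lim: "(\<lambda>K. T K t) \<longlonglongrightarrow> g t" if t: "t \<in> {0..1}" for t
    proof (cases "t = 0")
      case False
      have "summable (\<lambda>j. norm (a j * of_real t ^ j))"
        by (rule summable_comparison_test'[OF a, of 0])
           (use t in \<open>auto simp: norm_mult norm_power power_le_one intro!: mult_right_le_one_le\<close>)
      hence "(\<lambda>j. a j * of_real t ^ j) sums (\<Sum>j. a j * of_real t ^ j)"
        by (rule summable_sums[OF summable_norm_cancel])
      thus ?thesis
        using t False unfolding g_def sums_def
        by (simp add: near0 T_eq) (intro tendsto_intros)
    qed (simp add: T_def g_def)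
    have T_intble: "T K integrable_on {0..1}" for K using T_int by blast
    have "(\<lambda>K. integral {0..1} (T K)) \<longlonglongrightarrow> integral {0..1} g"
      by (rule dominated_convergence(2)[OF T_intble h'_int T_le T_lim])
    hence "(\<lambda>K. c * (1 / (s - 1)) + (\<Sum>j<K. a j * (1 / (s + of_nat j)))) \<longlonglongrightarrow> integral {0..1} g"
      unfolding integral_unique[OF T_int] .
    from tendsto_mult_left[OF this, of "rGamma s"]
    have "(\<lambda>K. c * rGamma s / (s - 1) + (\<Sum>j<K. a j * (rGamma s / (s + of_nat j)))) \<longlonglongrightarrow> rGamma s * integral {0..1} g"
      by (simp add: sum_distrib_left ring_distribs mult_ac)
    moreover have "s + of_nat j \<noteq> 0" for j using s by (auto simp: complex_eq_iff)
    ultimately have "(\<lambda>K. c * rGamma s / (s - 1) + (\<Sum>j<K. a j * e j s)) \<longlonglongrightarrow> rGamma s * integral {0..1} g"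
      by (simp add: e_eq)
    from tendsto_diff[OF this tendsto_const[of "c * rGamma s / (s - 1)"]]
    have "(\<lambda>j. a j * e j s) sums (rGamma s * integral {0..1} g - c * rGamma s / (s - 1))"
      by (simp add: sums_def)
    hence "rGamma s * integral {0..1} g = c * rGamma s / (s - 1) + (\<Sum>j. a j * e j s)"
      by (simp add: sums_iff)
    moreover have "integral {0..} g = integral {0..1} g + I s"
    proof -
      have "g integrable_on {0..1}"
        by (rule dominated_convergence(1)[OF T_intble h'_int T_le T_lim])
      moreover have "g integrable_on {1..}"
        unfolding g_def by (rule mellin_tail_integrable[OF cont1 bnd1])
      moreover have "{0..1} \<inter> {1..} = {1::real}" "{0..1} \<union> {1..} = {0::real..}" by auto
      ultimately show ?thesis
        using integral_Un[of g "{0..1}" "{1..}"] by (simp add: I_def g_def)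
    qed
    ultimately have "rGamma s * integral {0..} g = F s"
      by (simp add: F_def ring_distribs)
    with sums show ?thesis by simp
  qed
  show ?thesis using F_hol F_neg F_sums by blast
qed

subsection \<open>Special values of L-functions\<close>

text \<open>The given \<open>F\<close> witnesses that the choice in \<open>dirichlet_L\<close> is
  not void; the chosen function and \<open>F\<close> then agree on Re s > 1, hence by the identity
  theorem on the connected set \<open>- {1}\<close>.\<close>

lemma dirichlet_L_eqI:
  assumes "F holomorphic_on - {1}"
    and "\<And>s. Re s > 1 \<Longrightarrow> (\<lambda>n. \<psi> (int (Suc n)) / of_nat (Suc n) powr s) sums F s"
    and "s \<noteq> 1"
  shows "dirichlet_L \<psi> s = F s"
proof -
  have "dirichlet_L \<psi> holomorphic_on - {1} \<and>
     (\<forall>s. Re s > 1 \<longrightarrow> (\<lambda>n. \<psi> (int (Suc n)) / of_nat (Suc n) powr s) sums dirichlet_L \<psi> s)"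
    unfolding dirichlet_L_def by (rule someI[where x = F]) (use assms in auto)
  hence L: "dirichlet_L \<psi> holomorphic_on - {1}"
    "\<And>s. Re s > 1 \<Longrightarrow> (\<lambda>n. \<psi> (int (Suc n)) / of_nat (Suc n) powr s) sums dirichlet_L \<psi> s"
    by auto
  show ?thesis
  proof (rule analytic_continuation_open[of "{s. Re s > 1}" "- {1}" "dirichlet_L \<psi>" F])
    show "open {s. Re s > 1}" by (rule open_halfspace_Re_gt)
    have "(2 :: complex) \<in> {s. Re s > 1}" by simp
    thus "{s. Re s > 1} \<noteq> {}" by blast
    show "connected (- {1 :: complex})" by (intro connected_punctured_universe) auto
    show "dirichlet_L \<psi> z = F z" if "z \<in> {s. Re s > 1}" for z
      using sums_unique2[OF L(2) assms(2)] that by auto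
  qed (use L assms in auto)
qed

lemma exp_eq_1_small:
  fixes z :: complex
  assumes "exp z = 1" "norm z < 6"
  shows "z = 0"
proof -
  from assms(1) obtain n where n: "Re z = 0" "Im z = of_int (2 * n) * pi"
    by (auto simp: exp_eq_1)
  have "n = 0"
  proof (rule ccontr)
    assume "n \<noteq> 0"
    hence "1 * 6 \<le> \<bar>real_of_int n\<bar> * (2 * pi)" using pi_gt3 by (intro mult_mono) auto
    also have "\<dots> = norm z" using n abs_Im_le_cmod[of z] by (simp add: cmod_def abs_mult)
    finally show False using assms(2) by simp
  qed
  thus ?thesis using n by (simp add: complex_eq_iff)
qed

text \<open>Cubing reduces to exp (-3z) = 1 with |3z| < 6 < 2 pi. The nearest singularities have
  modulus 2 pi / 3, slightly above 2, so 2 is a usable radius of convergence.\<close>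

lemma zeta3_exp_neq_1:
  assumes "w = zeta3 \<or> w = inverse zeta3" "norm z < 2"
  shows "w * exp (- z) \<noteq> 1"
proof
  assume *: "w * exp (- z) = 1"
  have "w ^ 3 = 1" using assms(1) by (auto simp: zeta3_pow3 power_inverse)
  hence "exp (- (3 * z)) = (w * exp (- z)) ^ 3"
    by (simp add: power_mult_distrib exp_of_nat_mult[symmetric])
  hence "exp (- (3 * z)) = 1" using * by simp
  from exp_eq_1_small[OF this] have "z = 0" using assms(2) by (simp add: norm_mult)
  thus False using * assms(1) by auto
qed

text \<open>In the variable y = w exp (-z), differentiation in z is -y d/dy. At z = 0 this yields
  the Taylor coefficients, in which the wanted polylogarithm values appear.\<close>

lemma higher_deriv_polylog_neg_exp:
  assumes "w \<noteq> 0" "w * exp (- z) \<noteq> 1"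
  shows "(deriv ^^ n) (\<lambda>z. polylog_neg 0 (w * exp (- z))) z = (- 1) ^ n * polylog_neg n (w * exp (- z))"
  using assms(2)
proof (induction n arbitrary: z)
  case (Suc n)
  have "open {z. w * exp (- z) \<noteq> 1}"
    by (intro open_Collect_neq continuous_intros)
  hence "eventually (\<lambda>z. z \<in> {z. w * exp (- z) \<noteq> 1}) (nhds z)"
    using Suc.prems by (intro eventually_nhds_in_open) auto
  hence "deriv ((deriv ^^ n) (\<lambda>z. polylog_neg 0 (w * exp (- z)))) z =
         deriv (\<lambda>z. (- 1) ^ n * polylog_neg n (w * exp (- z))) z"
    by (intro deriv_cong_ev refl) (auto elim!: eventually_mono simp: Suc.IH)
  also have "\<dots> = (- 1) ^ Suc n * polylog_neg (Suc n) (w * exp (- z))"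
    using Suc.prems assms(1)
    by (intro DERIV_imp_deriv) (auto intro!: derivative_eq_intros DERIV_polylog_neg_comp)
  finally show ?case by simp
qed simp

text \<open>The Mellin argument integrates the expansion over (0, 1], so absolute convergence at 1
  is needed; convergence at 3/2 provides it.\<close>

lemma power_series_abs_summable_at_1:
  fixes f :: "complex \<Rightarrow> complex"
  assumes "f holomorphic_on ball 0 2"
  shows "summable (\<lambda>n. norm ((deriv ^^ n) f 0 / fact n))"
    "norm z < 2 \<Longrightarrow> (\<lambda>n. (deriv ^^ n) f 0 / fact n * z ^ n) sums f z"
proof -
  show sums: "(\<lambda>n. (deriv ^^ n) f 0 / fact n * z ^ n) sums f z" if "norm z < 2" for z
    using holomorphic_power_series[OF assms, of z] that by simp
  have "summable (\<lambda>n. (deriv ^^ n) f 0 / fact n * (3 / 2) ^ n)"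
    by (rule sums_summable[OF sums]) auto
  from powser_insidea[OF this, of 1] show "summable (\<lambda>n. norm ((deriv ^^ n) f 0 / fact n))" by simp
qed

lemma
  assumes w: "w = zeta3 \<or> w = inverse zeta3"
  shows polylog_neg_zeta3_abs_summable: "summable (\<lambda>n. norm ((- 1) ^ n * polylog_neg n w / fact n))"
    and polylog_neg_zeta3_sums: "norm z < 2 \<Longrightarrow>
      (\<lambda>n. (- 1) ^ n * polylog_neg n w / fact n * z ^ n) sums polylog_neg 0 (w * exp (- z))"
proof -
  have hol: "(\<lambda>z. polylog_neg 0 (w * exp (- z))) holomorphic_on ball 0 2"
    by (intro holomorphic_intros zeta3_exp_neq_1[OF w]) auto
  have eq: "(deriv ^^ n) (\<lambda>z. polylog_neg 0 (w * exp (- z))) 0 = (- 1) ^ n * polylog_neg n w" for n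
    using higher_deriv_polylog_neg_exp[of w 0 n] w by auto
  show "summable (\<lambda>n. norm ((- 1) ^ n * polylog_neg n w / fact n))"
    using power_series_abs_summable_at_1(1)[OF hol] unfolding eq .
  show "norm z < 2 \<Longrightarrow> (\<lambda>n. (- 1) ^ n * polylog_neg n w / fact n * z ^ n) sums polylog_neg 0 (w * exp (- z))"
    using power_series_abs_summable_at_1(2)[OF hol] unfolding eq .
qed

text \<open>The right side is an odd function of m modulo 3, hence a multiple of
  \<open>chi32\<close>. Its value at m = 1 is the Gauss sum, and this is where the factor i sqrt 3
  of the theorem comes from.\<close>

lemma chi32_zeta3: "\<i> * of_real (sqrt 3) * chi32 (int m) = zeta3 ^ m - inverse zeta3 ^ m"
proof -
  have inv: "inverse zeta3 = zeta3 ^ 2"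
    using zeta3_pow2 by (simp add: inverse_zeta3)
  have pow: "zeta3 ^ m = zeta3 ^ (m mod 3)" "inverse zeta3 ^ m = inverse zeta3 ^ (m mod 3)"
  proof -
    have "x ^ m = x ^ (m mod 3)" if "x ^ 3 = 1" for x :: complex
      by (subst div_mult_mod_eq[of m 3, symmetric])
         (simp only: power_add power_mult that power_one mult_1 mult.commute[of _ 3])
    thus "zeta3 ^ m = zeta3 ^ (m mod 3)" "inverse zeta3 ^ m = inverse zeta3 ^ (m mod 3)"
      by (auto simp: zeta3_pow3 power_inverse)
  qed
  have "int m mod 3 = int (m mod 3)" by (simp add: zmod_int)
  moreover have "m mod 3 = 0 \<or> m mod 3 = 1 \<or> m mod 3 = 2" by presburger
  moreover have "inverse zeta3 ^ 2 = zeta3"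
    by (simp add: inv power_mult[symmetric]) (use zeta3_pow3 in algebra)
  ultimately show ?thesis
    unfolding pow using zeta3_diff by (auto simp: chi32_def inv[symmetric] algebra_simps)
qed

lemma norm_chi32: "norm (chi32 m) \<le> 1"
  by (simp add: chi32_def)

lemma exp_neg_sums_polylog_neg:
  fixes t :: real
  assumes "t > 0" "norm w \<le> 1"
  shows "(\<lambda>n. w ^ Suc n * of_real (exp (- (real (Suc n) * t)))) sums polylog_neg 0 (w * exp (- of_real t))"
proof -
  have "norm (w * exp (- of_real t)) = norm w * exp (- t)"
    by (simp add: norm_mult)
  also have "\<dots> \<le> 1 * exp (- t)" using assms by (intro mult_right_mono) auto
  also have "\<dots> < 1" using assms by simp
  finally have "(\<lambda>n. (w * exp (- of_real t)) ^ Suc n) sums polylog_neg 0 (w * exp (- of_real t))"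
    using polylog_neg_sums[of "w * exp (- of_real t)" 0] by simp
  also have "(\<lambda>n. (w * exp (- of_real t)) ^ Suc n) = (\<lambda>n. w ^ Suc n * of_real (exp (- (real (Suc n) * t))))"
    unfolding power_mult_distrib exp_of_nat_mult[symmetric] by (simp add: exp_of_real[symmetric])
  finally show ?thesis .
qed

lemma exp_neg_neq_1:
  fixes t :: real and w :: complex
  assumes "t > 0" "norm w = 1"
  shows "w * exp (- of_real t) \<noteq> 1"
proof
  assume "w * exp (- of_real t) = 1"
  hence "norm (w * exp (- complex_of_real t)) = 1" by simp
  thus False using assms by (simp add: norm_mult)
qed

lemma continuous_on_polylog_neg_exp:
  assumes "norm w = 1"
  shows "continuous_on {0<..} (\<lambda>t. polylog_neg 0 (w * exp (- of_real t)))"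
  unfolding polylog_neg_0
  using exp_neg_neq_1[OF _ assms] by (intro continuous_intros) auto

text \<open>By the Gauss sum relation, the exponential sum of \<open>chi32\<close> is a difference
  of two polylogarithms at \<open>zeta3 * exp (-t)\<close> and
  \<open>inverse zeta3 * exp (-t)\<close>. It is regular at t = 0, hence c = 0; the sign from the
  continuation cancels the sign of the Taylor coefficients.\<close>

lemma dirichlet_L_chi32_neg:
  "\<i> * of_real (sqrt 3) * dirichlet_L chi32 (- of_nat j) = polylog_neg j zeta3 - polylog_neg j (inverse zeta3)"
proof -
  define r where "r = inverse (\<i> * complex_of_real (sqrt 3))"
  have r: "r * (\<i> * complex_of_real (sqrt 3)) = 1" unfolding r_def by (rule left_inverse) simp
  define b where "b = (\<lambda>w n. (- 1) ^ n * polylog_neg n w / fact n)"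
  define A where "A = (\<lambda>t. r * (polylog_neg 0 (zeta3 * exp (- of_real t)) - polylog_neg 0 (inverse zeta3 * exp (- of_real t))))"
  have "\<exists>F. F holomorphic_on - {1} \<and>
             (\<forall>s. Re s > 1 \<longrightarrow> (\<lambda>n. chi32 (int (Suc n)) / of_nat (Suc n) powr s) sums F s) \<and>
             (\<forall>j. F (- of_nat j) = (- 1) ^ j * fact j * (r * (b zeta3 j - b (inverse zeta3) j)))"
  proof (rule dirichlet_series_continuation[where c = 0 and A = A])
    show "norm (chi32 (int (Suc n))) \<le> 1" for n by (rule norm_chi32)
    show "(\<lambda>n. chi32 (int (Suc n)) * of_real (exp (- (real (Suc n) * t)))) sums A t" if "t > 0" for t
    proof -
      have "(\<lambda>n. r * (zeta3 ^ Suc n * of_real (exp (- (real (Suc n) * t))) -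
              inverse zeta3 ^ Suc n * of_real (exp (- (real (Suc n) * t))))) sums A t"
        unfolding A_def using that
        by (intro sums_mult sums_diff exp_neg_sums_polylog_neg) auto
      moreover have "r * (zeta3 ^ Suc n * x - inverse zeta3 ^ Suc n * x) = chi32 (int (Suc n)) * x" for n x
      proof -
        have "r * (zeta3 ^ Suc n * x - inverse zeta3 ^ Suc n * x) = r * (zeta3 ^ Suc n - inverse zeta3 ^ Suc n) * x"
          by (simp only: algebra_simps)
        also have "\<dots> = (r * (\<i> * complex_of_real (sqrt 3))) * chi32 (int (Suc n)) * x"
          unfolding chi32_zeta3[symmetric] by (simp only: mult_ac)
        finally show ?thesis using r by simp
      qed
      ultimately show ?thesis by simp
    qed
    show "continuous_on {0<..} A"
      unfolding A_def by (intro continuous_intros continuous_on_polylog_neg_exp) auto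
    have "summable (\<lambda>j. norm r * (norm (b zeta3 j) + norm (b (inverse zeta3) j)))"
      unfolding b_def by (intro summable_mult summable_add polylog_neg_zeta3_abs_summable) auto
    thus "summable (\<lambda>j. norm (r * (b zeta3 j - b (inverse zeta3) j)))"
      by (rule summable_comparison_test'[of _ 0])
         (auto simp: norm_mult intro!: mult_left_mono norm_triangle_ineq4)
    fix t :: real assume t: "0 < t" "t \<le> 1"
    have "(\<lambda>j. r * (b zeta3 j * of_real t ^ j - b (inverse zeta3) j * of_real t ^ j)) sums A t"
      unfolding A_def b_def using t by (intro sums_mult sums_diff polylog_neg_zeta3_sums) auto
    thus "A t = 0 / of_real t + (\<Sum>j. r * (b zeta3 j - b (inverse zeta3) j) * of_real t ^ j)"
      by (simp add: sums_iff algebra_simps)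
  qed
  then obtain F where F: "F holomorphic_on - {1}"
    "\<And>s. Re s > 1 \<Longrightarrow> (\<lambda>n. chi32 (int (Suc n)) / of_nat (Suc n) powr s) sums F s"
    "\<And>j. F (- of_nat j) = (- 1) ^ j * fact j * (r * (b zeta3 j - b (inverse zeta3) j))" by blast
  have ne: "- of_nat j \<noteq> (1 :: complex)" by (simp add: complex_eq_iff)
  have "dirichlet_L chi32 (- of_nat j) = F (- of_nat j)"
    using dirichlet_L_eqI[OF F(1,2) ne] by simp
  also have "\<dots> = r * ((- 1) ^ j * (- 1) ^ j) * (polylog_neg j zeta3 - polylog_neg j (inverse zeta3))"
    unfolding F(3) b_def by (simp add: field_simps)
  also have "(- 1) ^ j * (- 1) ^ j = (1 :: complex)" by (simp flip: power_mult_distrib)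
  finally have "\<i> * of_real (sqrt 3) * dirichlet_L chi32 (- of_nat j) =
      (r * (\<i> * complex_of_real (sqrt 3))) * (polylog_neg j zeta3 - polylog_neg j (inverse zeta3))"
    by (simp only: mult_ac mult_1)
  thus ?thesis unfolding r by simp
qed

text \<open>Up to its pole, 1 / (exp z - 1) is the generating function of the Bernoulli numbers.
  Only the existence of coefficients is recorded; the distribution relation identifies their needed
  multiples later.\<close>

lemma polylog_neg_exp_expansion:
  obtains a where "summable (\<lambda>n. norm (a n))"
    "\<And>z. z \<noteq> 0 \<Longrightarrow> norm z < 2 \<Longrightarrow> (\<lambda>n. a n * z ^ n) sums (polylog_neg 0 (exp (- z)) - 1 / z)"
proof -
  have nz: "exp z \<noteq> 1" if "z \<noteq> 0" "norm z < 2" for z :: complex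
    using exp_eq_1_small[of z] that by auto
  define G where "G = (\<lambda>z. if z = 0 then 1 else z / (exp z - 1 :: complex))"
  have "((\<lambda>z::complex. inverse ((exp z - 1) / z)) \<longlongrightarrow> inverse 1) (at 0)"
    by (intro tendsto_inverse lim_exp_minus_1) auto
  hence "((\<lambda>z::complex. z / (exp z - 1)) \<longlongrightarrow> 1) (at 0)" by simp
  moreover have "(\<lambda>z. z / (exp z - 1)) holomorphic_on ball 0 2 - {0}"
    using nz by (intro holomorphic_intros) auto
  ultimately have hol: "G holomorphic_on ball 0 2"
    unfolding G_def by (intro removable_singularity) auto
  define b where "b = (\<lambda>n. (deriv ^^ n) G 0 / fact n)"
  have "summable (\<lambda>n. norm (b n))"
    unfolding b_def by (rule power_series_abs_summable_at_1(1)[OF hol])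
  hence "summable (\<lambda>n. norm (b (Suc n)))" by (subst summable_Suc_iff)
  moreover have "(\<lambda>n. b (Suc n) * z ^ n) sums (polylog_neg 0 (exp (- z)) - 1 / z)"
    if z: "z \<noteq> 0" "norm z < 2" for z
  proof -
    have "(\<lambda>n. b n * z ^ n) sums G z"
      unfolding b_def by (rule power_series_abs_summable_at_1(2)[OF hol z(2)])
    hence "(\<lambda>n. b (Suc n) * z ^ Suc n) sums (G z - b 0)"
      by (subst sums_Suc_iff) simp
    hence "(\<lambda>n. b (Suc n) * z ^ Suc n * (1 / z)) sums ((G z - b 0) * (1 / z))"
      by (rule sums_mult2)
    moreover have "(G z - b 0) * (1 / z) = polylog_neg 0 (exp (- z)) - 1 / z"
      using z nz[OF z] by (simp add: G_def b_def polylog_neg_0 exp_minus field_simps)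
    ultimately show ?thesis using z by simp
  qed
  ultimately show ?thesis by (rule that)
qed

lemma power_series_zero_coeff:
  fixes d :: "nat \<Rightarrow> complex"
  assumes "r > 0" "\<And>z. z \<noteq> 0 \<Longrightarrow> norm z < r \<Longrightarrow> (\<lambda>n. d n * z ^ n) sums 0"
  shows "d n = 0"
proof (rule ccontr)
  assume nz: "d n \<noteq> 0"
  \<comment> \<open>Nothing is assumed at z = 0. Multiplying the series by z makes its sum 0 there
    as well.\<close>
  define d' where "d' = (\<lambda>n. if n = 0 then 0 else d (n - 1))"
  have "(\<lambda>n. d' n * (z - 0) ^ n) sums 0" if "norm (z - 0) < r" for z
  proof (cases "z = 0")
    case True
    have "(\<lambda>n. d' n * (z - 0) ^ n) = (\<lambda>n. 0)" using True by (auto simp: d'_def fun_eq_iff)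
    thus ?thesis by simp
  next
    case False
    from sums_mult[OF assms(2)[of z], of z] False that
    have "(\<lambda>n. d' (Suc n) * (z - 0) ^ Suc n) sums 0" by (simp add: d'_def mult_ac)
    thus ?thesis by (subst (asm) sums_Suc_iff) (simp add: d'_def)
  qed
  from powser_0_nonzero[OF assms(1) this, of "Suc n"] nz obtain s where
    "0 < s" "\<And>z. z \<in> cball 0 s - {0 :: complex} \<Longrightarrow> (0 :: complex) \<noteq> 0"
    by (auto simp: d'_def)
  moreover from this(1) have "complex_of_real s \<in> cball 0 s - {0}" by auto
  ultimately show False by blast
qed

text \<open>In the distribution relation at x = exp (-z), the poles 1/z of the two terms without
  \<open>zeta3\<close> cancel, so coefficients can be compared. This expresses the coefficients of
  the singular function by those at the regular points \<open>zeta3\<close> and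
  \<open>inverse zeta3\<close>. The radius 1/2 keeps |3z| below 2.\<close>

lemma riemann_zeta_neg:
  "(3 ^ Suc j - 1) * riemann_zeta (- of_nat j) = polylog_neg j zeta3 + polylog_neg j (inverse zeta3)"
proof -
  obtain a where a: "summable (\<lambda>n. norm (a n))"
    "\<And>z. z \<noteq> 0 \<Longrightarrow> norm z < 2 \<Longrightarrow> (\<lambda>n. a n * z ^ n) sums (polylog_neg 0 (exp (- z)) - 1 / z)"
    using polylog_neg_exp_expansion by blast
  have "\<exists>F. F holomorphic_on - {1} \<and>
             (\<forall>s. Re s > 1 \<longrightarrow> (\<lambda>n. (1 :: complex) / of_nat (Suc n) powr s) sums F s) \<and>
             (\<forall>j. F (- of_nat j) = (- 1) ^ j * fact j * a j)"
  proof (rule dirichlet_series_continuation[where c = 1 and A = "\<lambda>t. polylog_neg 0 (exp (- of_real t))"])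
    show "(\<lambda>n. 1 * of_real (exp (- (real (Suc n) * t)))) sums polylog_neg 0 (exp (- of_real t))"
      if "t > 0" for t using exp_neg_sums_polylog_neg[OF that, of 1] by simp
    show "continuous_on {0<..} (\<lambda>t. polylog_neg 0 (exp (- of_real t)))"
      using continuous_on_polylog_neg_exp[of 1] by simp
    show "polylog_neg 0 (exp (- of_real t)) = 1 / of_real t + (\<Sum>j. a j * of_real t ^ j)"
      if "0 < t" "t \<le> 1" for t using a(2)[of "of_real t"] that by (simp add: sums_iff)
  qed (use a in auto)
  then obtain F where F: "F holomorphic_on - {1}"
    "\<And>s. Re s > 1 \<Longrightarrow> (\<lambda>n. (1 :: complex) / of_nat (Suc n) powr s) sums F s"
    "\<And>j. F (- of_nat j) = (- 1) ^ j * fact j * a j" by blast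
  have ne: "- of_nat j \<noteq> (1 :: complex)" by (simp add: complex_eq_iff)
  have zeta: "riemann_zeta (- of_nat j) = (- 1) ^ j * fact j * a j"
    unfolding riemann_zeta_def using dirichlet_L_eqI[OF F(1,2) ne] F(3) by simp
  define b where "b = (\<lambda>w n. (- 1) ^ n * polylog_neg n w / fact n)"
  have "3 ^ Suc j * a j - a j - b zeta3 j - b (inverse zeta3) j = 0"
  proof (rule power_series_zero_coeff[of "1 / 2"])
    fix z :: complex assume z: "z \<noteq> 0" "norm z < 1 / 2"
    have n3: "norm (3 * z) < 2" "norm z < 2" using z by (auto simp: norm_mult)
    have "(\<lambda>n. 3 * (a n * (3 * z) ^ n) - a n * z ^ n - b zeta3 n * z ^ n - b (inverse zeta3) n * z ^ n) sums
      (3 * (polylog_neg 0 (exp (- (3 * z))) - 1 / (3 * z)) - (polylog_neg 0 (exp (- z)) - 1 / z) -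
        polylog_neg 0 (zeta3 * exp (- z)) - polylog_neg 0 (inverse zeta3 * exp (- z)))"
      unfolding b_def using n3 z
      by (intro sums_diff sums_mult a polylog_neg_zeta3_sums) auto
    also have "(\<lambda>n. 3 * (a n * (3 * z) ^ n) - a n * z ^ n - b zeta3 n * z ^ n - b (inverse zeta3) n * z ^ n) =
      (\<lambda>n. (3 ^ Suc n * a n - a n - b zeta3 n - b (inverse zeta3) n) * z ^ n)"
      by (simp add: fun_eq_iff algebra_simps)
    also have "3 * (polylog_neg 0 (exp (- (3 * z))) - 1 / (3 * z)) - (polylog_neg 0 (exp (- z)) - 1 / z) -
        polylog_neg 0 (zeta3 * exp (- z)) - polylog_neg 0 (inverse zeta3 * exp (- z)) = 0"
    proof -
      have eq: "exp (- z) ^ 3 = exp (- (3 * z))" by (simp add: exp_of_nat_mult[symmetric])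
      have "exp (- (3 * z)) \<noteq> 1" using exp_eq_1_small[of "- (3 * z)"] n3 z by auto
      with polylog_neg_distribution[of "exp (- z)" 0] show ?thesis
        unfolding eq using z by simp
    qed
    finally show "(\<lambda>n. (3 ^ Suc n * a n - a n - b zeta3 n - b (inverse zeta3) n) * z ^ n) sums 0" .
  qed auto
  hence "(3 ^ Suc j - 1) * a j = b zeta3 j + b (inverse zeta3) j" by (simp add: algebra_simps)
  hence "(3 ^ Suc j - 1) * riemann_zeta (- of_nat j) = (- 1) ^ j * fact j * (b zeta3 j + b (inverse zeta3) j)"
    unfolding zeta by (simp add: mult_ac)
  also have "\<dots> = ((- 1) ^ j * (- 1) ^ j) * (polylog_neg j zeta3 + polylog_neg j (inverse zeta3))"
    by (simp add: b_def field_simps)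
  also have "(- 1) ^ j * (- 1) ^ j = (1 :: complex)" by (simp flip: power_mult_distrib)
  finally show ?thesis by simp
qed

subsection \<open>Lambert series\<close>

text \<open>The double series over pairs (n, m) is regrouped by the product N of their successors,
  and the second factor becomes the divisor d. Absolute summability justifies the
  regrouping.\<close>

lemma lambert_series_sums:
  fixes q :: complex and b :: "nat \<Rightarrow> complex"
  assumes q: "norm q < 1" and summ: "summable (\<lambda>m. norm (b (Suc m)) * norm q ^ Suc m)"
    and g: "\<And>n. (\<lambda>m. b (Suc m) * (q ^ Suc n) ^ Suc m) sums g n"
  shows "g sums (\<Sum>N. (\<Sum>d | d dvd Suc N. b d) * q ^ Suc N)"
proof -
  define f where "f = (\<lambda>(n, m). b (Suc m) * q ^ (Suc n * Suc m))"
  define r where "r = norm q"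
  have r: "0 \<le> r" "r < 1" using q by (auto simp: r_def)
  define v where "v = (\<lambda>m. norm (b (Suc m)) * r ^ Suc m)"
  have v_nonneg: "v m \<ge> 0" for m using r by (simp add: v_def)
  have v: "v summable_on UNIV"
    using summ r by (subst summable_on_UNIV_nonneg_real_iff) (auto simp: v_def r_def)
  have u: "(\<lambda>n. r ^ n) summable_on UNIV"
    using r by (subst summable_on_UNIV_nonneg_real_iff) auto
  have "(\<lambda>x. norm ((\<lambda>(n, m). r ^ n * v m) x)) summable_on (UNIV \<times> UNIV)"
    unfolding Infinite_Sum.abs_summable_on_Sigma_iff using r v_nonneg
    by (auto simp: abs_mult infsum_cmult_right' intro!: summable_on_cmult_right summable_on_cmult_left v u)
  hence "(\<lambda>x. norm (f x)) summable_on (UNIV \<times> UNIV)"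
  proof (rule Infinite_Sum.abs_summable_on_comparison_test)
    fix nm :: "nat \<times> nat"
    obtain n m where nm: "nm = (n, m)" by (cases nm)
    \<comment> \<open>Since (n+1)(m+1) >= n + (m+1), the double series is dominated by a product of
      two single series.\<close>
    have "r ^ (Suc n * Suc m) \<le> r ^ (n + Suc m)"
      using r by (intro power_decreasing) auto
    hence "norm (b (Suc m)) * r ^ (Suc n * Suc m) \<le> norm (b (Suc m)) * r ^ (n + Suc m)"
      by (intro mult_left_mono) auto
    also have "\<dots> = r ^ n * v m" by (simp add: v_def power_add)
    also have "\<dots> = norm (r ^ n * v m)" using r v_nonneg by (simp add: abs_mult)
    finally show "norm (f nm) \<le> norm (case nm of (n, m) \<Rightarrow> r ^ n * v m)"
      by (simp add: nm f_def norm_mult norm_power r_def del: mult_Suc mult_Suc_right)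
  qed
  hence "f summable_on (UNIV \<times> UNIV)" by (rule Infinite_Sum.abs_summable_summable)
  then obtain S where S: "(f has_sum S) (UNIV \<times> UNIV)" by (auto simp: summable_on_def)
  have g_sum: "(g has_sum S) UNIV"
  proof (rule has_sum_SigmaD[OF S])
    fix n :: nat
    have "summable (\<lambda>m. norm (b (Suc m) * (q ^ Suc n) ^ Suc m))"
    proof (rule summable_comparison_test'[OF summ, of 0])
      fix m :: nat
      have "norm q ^ (Suc n * Suc m) \<le> norm q ^ Suc m"
        using q by (intro power_decreasing) auto
      thus "norm (norm (b (Suc m) * (q ^ Suc n) ^ Suc m)) \<le> norm (b (Suc m)) * norm q ^ Suc m"
        unfolding norm_mult norm_power power_mult[symmetric] by (simp add: mult_left_mono del: mult_Suc mult_Suc_right power_Suc)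
    qed
    from norm_summable_imp_has_sum[OF this g] show "((\<lambda>m. f (n, m)) has_sum g n) UNIV"
      by (simp add: f_def power_mult[symmetric] del: mult_Suc mult_Suc_right power_Suc)
  qed
  have "(f has_sum S) (UNIV \<times> UNIV) \<longleftrightarrow>
      ((\<lambda>(N, d). b d * q ^ Suc N) has_sum S) (SIGMA N:UNIV. {d. d dvd Suc N})"
  \<comment> \<open>All sums start at index 0, so the pair (n, m) stands for the factorisation of
    \<open>Suc N\<close> into \<open>Suc n\<close> and the divisor \<open>Suc m\<close>.\<close>
  proof (rule has_sum_reindex_bij_witness[where
        j = "\<lambda>(n, m). (Suc n * Suc m - 1, Suc m)" and i = "\<lambda>(N, d). (Suc N div d - 1, d - 1)"])
    fix a :: "nat \<times> nat" assume "a \<in> UNIV \<times> UNIV"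
    obtain n m where a: "a = (n, m)" by (cases a)
    have *: "Suc (Suc n * Suc m - 1) = Suc n * Suc m" by simp
    show "(case case a of (n, m) \<Rightarrow> (Suc n * Suc m - 1, Suc m) of (N, d) \<Rightarrow> (Suc N div d - 1, d - 1)) = a"
      unfolding a prod.case * by (subst nonzero_mult_div_cancel_right) auto
    show "(case a of (n, m) \<Rightarrow> (Suc n * Suc m - 1, Suc m)) \<in> (SIGMA N:UNIV. {d. d dvd Suc N})"
      unfolding a prod.case using * by (metis (mono_tags, lifting) SigmaI UNIV_I dvd_triv_right mem_Collect_eq)
    show "(case case a of (n, m) \<Rightarrow> (Suc n * Suc m - 1, Suc m) of (N, d) \<Rightarrow> b d * q ^ Suc N) = f a"
      unfolding a prod.case * by (simp add: f_def)
  next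
    fix Nd :: "nat \<times> nat" assume Nd: "Nd \<in> (SIGMA N:UNIV. {d. d dvd Suc N})"
    obtain N d where [simp]: "Nd = (N, d)" by (cases Nd)
    from Nd obtain e where e: "Suc N = d * e" by auto
    hence "d > 0" "e > 0" by (metis mult_0 mult_0_right neq0_conv nat.distinct(2))+
    moreover from this obtain d' e' where "d = Suc d'" "e = Suc e'" by (metis Suc_pred)
    ultimately show "(case case Nd of (N, d) \<Rightarrow> (Suc N div d - 1, d - 1) of (n, m) \<Rightarrow> (Suc n * Suc m - 1, Suc m)) = Nd"
      using e by (simp del: mult_Suc mult_Suc_right) (simp add: mult.commute)
  qed auto
  with S have S': "((\<lambda>(N, d). b d * q ^ Suc N) has_sum S) (SIGMA N:UNIV. {d. d dvd Suc N})" by simp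
  have "((\<lambda>N. (\<Sum>d | d dvd Suc N. b d) * q ^ Suc N) has_sum S) UNIV"
    by (rule has_sum_SigmaD[OF S']) (auto simp: sum_distrib_right intro!: has_sum_finiteI)
  from has_sum_imp_sums[OF this] has_sum_imp_sums[OF g_sum] show ?thesis
    by (simp add: sums_iff)
qed

lemma summable_power_times_power:
  assumes "0 \<le> r" "r < (1 :: real)"
  shows "summable (\<lambda>m. real (Suc m) ^ j * r ^ Suc m)"
proof -
  have "summable (\<lambda>m. of_nat (Suc m) ^ j * complex_of_real r ^ Suc m)"
    using polylog_neg_sums[of "of_real r" j] assms by (simp add: sums_iff)
  also have "(\<lambda>m. of_nat (Suc m) ^ j * complex_of_real r ^ Suc m) =
      (\<lambda>m. complex_of_real (real (Suc m) ^ j * r ^ Suc m))" by simp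
  finally show ?thesis by (simp only: summable_complex_of_real)
qed

lemma norm_nome: "norm (nome \<tau>) = exp (- (2 * pi * Im \<tau>))"
  by (simp add: nome_def)

lemma norm_nome_less_1: "\<tau> \<in> upper_half_plane \<Longrightarrow> norm (nome \<tau>) < 1"
  by (simp add: norm_nome upper_half_plane_def)

lemma nome_nz [simp]: "nome \<tau> \<noteq> 0"
  by (simp add: nome_def)

lemma nome_power: "nome \<tau> ^ n = nome (of_nat n * \<tau>)"
  by (simp add: nome_def exp_of_nat_mult[symmetric] mult_ac)

lemma sums_eisenstein:
  assumes "\<tau> \<in> upper_half_plane"
  shows "(\<lambda>n. polylog_neg j (nome \<tau> ^ Suc n)) sums
           (eisenstein (Suc j) \<tau> - riemann_zeta (- of_nat j) / 2)"
proof -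
  define q where "q = nome \<tau>"
  have q: "norm q < 1" using norm_nome_less_1[OF assms] by (simp add: q_def)
  have "(\<lambda>n. polylog_neg j (q ^ Suc n)) sums (\<Sum>N. (\<Sum>d | d dvd Suc N. of_nat d ^ j) * q ^ Suc N)"
  proof (rule lambert_series_sums[OF q])
    show "summable (\<lambda>m. norm ((of_nat (Suc m) :: complex) ^ j) * norm q ^ Suc m)"
      using summable_power_times_power[of "norm q" j] q by (simp add: norm_power del: of_nat_Suc)
    show "(\<lambda>m. of_nat (Suc m) ^ j * (q ^ Suc n) ^ Suc m) sums polylog_neg j (q ^ Suc n)" for n
    proof (rule polylog_neg_sums)
      have "norm q ^ Suc n \<le> norm q" using q power_decreasing[of 1 "Suc n" "norm q"] by simp
      thus "norm (q ^ Suc n) < 1" using q unfolding norm_power by linarith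
    qed
  qed
  thus ?thesis by (simp add: eisenstein_def q_def)
qed

lemma sums_eisenstein_char:
  assumes "\<tau> \<in> upper_half_plane"
  shows "(\<lambda>n. polylog_neg j (zeta3 * nome \<tau> ^ Suc n) - polylog_neg j (inverse zeta3 * nome \<tau> ^ Suc n)) sums
           (\<i> * of_real (sqrt 3) * (eisenstein_char chi32 (Suc j) \<tau> - dirichlet_L chi32 (- of_nat j) / 2))"
proof -
  define q where "q = nome \<tau>"
  have q: "norm q < 1" using norm_nome_less_1[OF assms] by (simp add: q_def)
  define r where "r = \<i> * complex_of_real (sqrt 3)"
  define g where "g = (\<lambda>n. (polylog_neg j (zeta3 * q ^ Suc n) - polylog_neg j (inverse zeta3 * q ^ Suc n)) / r)"
  have r: "r \<noteq> 0" by (simp add: r_def)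
  have "g sums (\<Sum>N. (\<Sum>d | d dvd Suc N. chi32 (int d) * of_nat d ^ j) * q ^ Suc N)"
  proof (rule lambert_series_sums[OF q])
    show "summable (\<lambda>m. norm (chi32 (int (Suc m)) * of_nat (Suc m) ^ j) * norm q ^ Suc m)"
    proof (rule summable_comparison_test'[OF summable_power_times_power[of "norm q" j], of 0])
      fix m
      have "norm (chi32 (int (Suc m))) * (real (Suc m) ^ j * norm q ^ Suc m) \<le> 1 * (real (Suc m) ^ j * norm q ^ Suc m)"
        by (intro mult_right_mono norm_chi32) auto
      thus "norm (norm (chi32 (int (Suc m)) * of_nat (Suc m) ^ j) * norm q ^ Suc m) \<le> real (Suc m) ^ j * norm q ^ Suc m"
        by (simp add: norm_mult norm_power mult_ac del: of_nat_Suc power_Suc)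
    qed (use q in auto)
    fix n
    have "norm q ^ Suc n \<le> norm q" using q power_decreasing[of 1 "Suc n" "norm q"] by simp
    hence lt: "norm (q ^ Suc n) < 1" using q unfolding norm_power by linarith
    have "(\<lambda>m. (of_nat (Suc m) ^ j * (zeta3 * q ^ Suc n) ^ Suc m -
                of_nat (Suc m) ^ j * (inverse zeta3 * q ^ Suc n) ^ Suc m) / r) sums g n"
      unfolding g_def using lt
      by (intro sums_divide sums_diff polylog_neg_sums) (auto simp: norm_mult simp del: power_Suc)
    moreover have "(of_nat (Suc m) ^ j * (zeta3 * q ^ Suc n) ^ Suc m -
                of_nat (Suc m) ^ j * (inverse zeta3 * q ^ Suc n) ^ Suc m) / r =
       chi32 (int (Suc m)) * of_nat (Suc m) ^ j * (q ^ Suc n) ^ Suc m" for m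
    proof -
      have "chi32 (int (Suc m)) = (zeta3 ^ Suc m - inverse zeta3 ^ Suc m) / r"
        using chi32_zeta3[of "Suc m"] r unfolding r_def by (simp add: field_simps del: power_Suc)
      moreover have "(c * (A * X) - c * (B * X)) / r = (A - B) / r * c * X" for A B c X
        by (simp add: algebra_simps diff_divide_distrib)
      ultimately show ?thesis by (simp only: power_mult_distrib)
    qed
    ultimately show "(\<lambda>m. chi32 (int (Suc m)) * of_nat (Suc m) ^ j * (q ^ Suc n) ^ Suc m) sums g n" by simp
  qed
  hence "g sums (eisenstein_char chi32 (Suc j) \<tau> - dirichlet_L chi32 (- of_nat j) / 2)"
    by (simp add: eisenstein_char_def q_def)
  from sums_mult[OF this, of r] show ?thesis using r unfolding r_def g_def q_def by simp
qed

text \<open>The sign decides the type of series: for even j the difference of powers of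
  \<open>zeta3\<close> is a multiple of the character, for odd j the sum turns by the distribution
  relation into a difference of level 3 and level 1. In both cases the constant term is half the
  same expression with the nome replaced by 1.\<close>

lemma sums_eisenstein_combination:
  assumes \<tau>: "\<tau> \<in> upper_half_plane"
  shows "(\<lambda>n. polylog_neg j (zeta3 * nome \<tau> ^ Suc n) - (- 1) ^ j * polylog_neg j (inverse zeta3 * nome \<tau> ^ Suc n)) sums
    ((if even j then \<i> * of_real (sqrt 3) * eisenstein_char chi32 (Suc j) \<tau>
      else 3 ^ Suc j * eisenstein (Suc j) (3 * \<tau>) - eisenstein (Suc j) \<tau>)
     - (polylog_neg j zeta3 - (- 1) ^ j * polylog_neg j (inverse zeta3)) / 2)"
proof (cases "even j")
  case True
  have "\<i> * of_real (sqrt 3) * (eisenstein_char chi32 (Suc j) \<tau> - dirichlet_L chi32 (- of_nat j) / 2) =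
    \<i> * of_real (sqrt 3) * eisenstein_char chi32 (Suc j) \<tau> - (polylog_neg j zeta3 - polylog_neg j (inverse zeta3)) / 2"
    unfolding dirichlet_L_chi32_neg[symmetric] by (simp add: ring_distribs)
  with sums_eisenstein_char[OF \<tau>, of j] True show ?thesis by simp
next
  case False
  have \<tau>3: "3 * \<tau> \<in> upper_half_plane" using \<tau> by (simp add: upper_half_plane_def)
  have "(\<lambda>n. 3 ^ Suc j * polylog_neg j (nome (3 * \<tau>) ^ Suc n) - polylog_neg j (nome \<tau> ^ Suc n)) sums
     (3 ^ Suc j * (eisenstein (Suc j) (3 * \<tau>) - riemann_zeta (- of_nat j) / 2) -
        (eisenstein (Suc j) \<tau> - riemann_zeta (- of_nat j) / 2))"
    by (intro sums_diff sums_mult sums_eisenstein \<tau> \<tau>3)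
  also have "(3 ^ Suc j * (eisenstein (Suc j) (3 * \<tau>) - riemann_zeta (- of_nat j) / 2) -
        (eisenstein (Suc j) \<tau> - riemann_zeta (- of_nat j) / 2)) =
      3 ^ Suc j * eisenstein (Suc j) (3 * \<tau>) - eisenstein (Suc j) \<tau> - ((3 ^ Suc j - 1) * riemann_zeta (- of_nat j)) / 2"
    by (simp add: field_simps)
  also have "\<dots> = 3 ^ Suc j * eisenstein (Suc j) (3 * \<tau>) - eisenstein (Suc j) \<tau> -
       (polylog_neg j zeta3 + polylog_neg j (inverse zeta3)) / 2"
    unfolding riemann_zeta_neg ..
  also have "(\<lambda>n. 3 ^ Suc j * polylog_neg j (nome (3 * \<tau>) ^ Suc n) - polylog_neg j (nome \<tau> ^ Suc n)) =
     (\<lambda>n. polylog_neg j (zeta3 * nome \<tau> ^ Suc n) + polylog_neg j (inverse zeta3 * nome \<tau> ^ Suc n))"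
  proof
    fix n
    have "norm ((nome \<tau> ^ Suc n) ^ 3) < 1"
      unfolding power_mult[symmetric] norm_power using norm_nome_less_1[OF \<tau>]
      by (simp add: power_less_one_iff del: power_Suc mult_Suc)
    hence "(nome \<tau> ^ Suc n) ^ 3 \<noteq> 1" by auto
    moreover have "nome (3 * \<tau>) ^ Suc n = (nome \<tau> ^ Suc n) ^ 3"
    proof -
      have "nome (3 * \<tau>) = nome \<tau> ^ 3" using nome_power[of \<tau> 3] by simp
      thus ?thesis by (simp only: power_mult[symmetric] mult.commute)
    qed
    ultimately show "3 ^ Suc j * polylog_neg j (nome (3 * \<tau>) ^ Suc n) - polylog_neg j (nome \<tau> ^ Suc n) =
      polylog_neg j (zeta3 * nome \<tau> ^ Suc n) + polylog_neg j (inverse zeta3 * nome \<tau> ^ Suc n)"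
      using polylog_neg_distribution[of "nome \<tau> ^ Suc n" j] by (simp del: power_Suc)
  qed
  finally show ?thesis using False by simp
qed

section \<open>Summation of the quotient over powers of the nome\<close>

lemma quadratic_nz: "norm x < 1 \<Longrightarrow> 1 + x + x ^ 2 \<noteq> (0 :: complex)"
proof
  assume x: "norm x < 1" "1 + x + x ^ 2 = 0"
  hence "norm (zeta3 * x) = 1 \<or> norm (inverse zeta3 * x) = 1" unfolding quadratic_factor by auto
  thus False using x by (auto simp: norm_mult)
qed

text \<open>The values \<open>S j\<close> stay abstract because the lemma is instantiated twice,
  with Eisenstein series for the formula and with \<open>eis_kronecker\<close> for
  modularity.\<close>

lemma sums_quotient:
  fixes k :: nat and Q :: "complex poly"
  assumes "k \<ge> 1" "degree Q \<le> 2 * k - 1"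
    and sym: "\<And>x. x \<noteq> 0 \<Longrightarrow> poly Q x = x ^ (2 * k) * poly Q (1 / x)" and "poly Q 0 = 0"
    and \<tau>: "\<tau> \<in> upper_half_plane"
    and S: "\<And>j. j < k \<Longrightarrow> (\<lambda>n. polylog_neg j (zeta3 * nome \<tau> ^ Suc n) -
                 (- 1) ^ j * polylog_neg j (inverse zeta3 * nome \<tau> ^ Suc n)) sums S j"
  shows "(\<lambda>n. poly Q (nome \<tau> ^ Suc n) / (1 + nome \<tau> ^ Suc n + nome \<tau> ^ (2 * Suc n)) ^ k) sums
           (\<Sum>j<k. c_coeff k Q (Suc j) * S j)"
proof -
  have "(\<lambda>n. \<Sum>j<k. c_coeff k Q (Suc j) * (polylog_neg j (zeta3 * nome \<tau> ^ Suc n) -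
           (- 1) ^ j * polylog_neg j (inverse zeta3 * nome \<tau> ^ Suc n))) sums (\<Sum>j<k. c_coeff k Q (Suc j) * S j)"
    by (intro sums_sum sums_mult S) auto
  also have "(\<lambda>n. \<Sum>j<k. c_coeff k Q (Suc j) * (polylog_neg j (zeta3 * nome \<tau> ^ Suc n) -
           (- 1) ^ j * polylog_neg j (inverse zeta3 * nome \<tau> ^ Suc n))) =
     (\<lambda>n. poly Q (nome \<tau> ^ Suc n) / (1 + nome \<tau> ^ Suc n + nome \<tau> ^ (2 * Suc n)) ^ k)"
  proof
    fix n
    have "norm (nome \<tau> ^ Suc n) < 1"
      using norm_nome_less_1[OF \<tau>] unfolding norm_power by (simp add: power_less_one_iff del: power_Suc mult_Suc)
    note nz = quadratic_nz[OF this]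
    have eq: "poly Q (nome \<tau> ^ Suc n) / (1 + nome \<tau> ^ Suc n + (nome \<tau> ^ Suc n) ^ 2) ^ k =
       (\<Sum>j<k. c_coeff k Q (Suc j) * (polylog_neg j (zeta3 * nome \<tau> ^ Suc n) -
           (- 1) ^ j * polylog_neg j (inverse zeta3 * nome \<tau> ^ Suc n)))"
      by (rule quotient_eq_polylog_neg[OF assms(1,2,4) _ nz]) (rule sym)
    have "nome \<tau> ^ (2 * Suc n) = (nome \<tau> ^ Suc n) ^ 2"
      by (simp only: power_mult[symmetric] mult.commute)
    with eq show "(\<Sum>j<k. c_coeff k Q (Suc j) * (polylog_neg j (zeta3 * nome \<tau> ^ Suc n) -
           (- 1) ^ j * polylog_neg j (inverse zeta3 * nome \<tau> ^ Suc n))) =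
       poly Q (nome \<tau> ^ Suc n) / (1 + nome \<tau> ^ Suc n + nome \<tau> ^ (2 * Suc n)) ^ k"
      by simp
  qed
  finally show ?thesis .
qed

lemma sums_quotient_eisenstein:
  fixes k :: nat and Q :: "complex poly"
  assumes Q: "k \<ge> 1" "degree Q \<le> 2 * k - 1"
    "\<And>x. x \<noteq> 0 \<Longrightarrow> poly Q x = x ^ (2 * k) * poly Q (1 / x)" "poly Q 0 = 0"
    and \<tau>: "\<tau> \<in> upper_half_plane"
  shows "(\<lambda>n. poly Q (nome \<tau> ^ Suc n) / (1 + nome \<tau> ^ Suc n + nome \<tau> ^ (2 * Suc n)) ^ k) sums
              (- poly Q 1 / (2 * 3 ^ k)
               + \<i> * of_real (sqrt 3) *
                   (\<Sum>l | l \<in> {1..k} \<and> odd l. c_coeff k Q l * eisenstein_char chi32 l \<tau>)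
               + (\<Sum>l | l \<in> {1..k} \<and> even l.
                   c_coeff k Q l * (3 ^ l * eisenstein l (3 * \<tau>) - eisenstein l \<tau>)))"
proof -
  define E where "E = (\<lambda>l. if odd l then \<i> * of_real (sqrt 3) * eisenstein_char chi32 l \<tau>
      else 3 ^ l * eisenstein l (3 * \<tau>) - eisenstein l \<tau>)"
  define P where "P = (\<lambda>j. polylog_neg j zeta3 - (- 1) ^ j * polylog_neg j (inverse zeta3))"
  \<comment> \<open>At x = 1 the denominator is 3^k, so all the constant terms together are half the
    quotient at 1, with a minus sign.\<close>
  have "poly Q 1 / 3 ^ k = (\<Sum>j<k. c_coeff k Q (Suc j) * P j)"
    using quotient_eq_polylog_neg[OF Q(1,2,4,3), of 1] by (simp add: P_def)
  hence "- poly Q 1 / (2 * 3 ^ k) = - (\<Sum>j<k. c_coeff k Q (Suc j) * P j) / 2"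
    by (simp add: field_simps)
  moreover have "(\<Sum>j<k. c_coeff k Q (Suc j) * E (Suc j)) = (\<Sum>l=1..k. c_coeff k Q l * E l)"
    by (rule sum.reindex_bij_witness[of _ "\<lambda>l. l - 1" Suc]) auto
  moreover have "(\<Sum>l=1..k. c_coeff k Q l * E l) =
      (\<Sum>l\<in>{l\<in>{1..k}. odd l} \<union> {l\<in>{1..k}. even l}. c_coeff k Q l * E l)"
    by (rule sum.cong) auto
  moreover have "\<dots> = (\<Sum>l | l \<in> {1..k} \<and> odd l. c_coeff k Q l * E l) + (\<Sum>l | l \<in> {1..k} \<and> even l. c_coeff k Q l * E l)"
    by (rule sum.union_disjoint) auto
  moreover have "(\<Sum>l | l \<in> {1..k} \<and> odd l. c_coeff k Q l * E l) =
      \<i> * of_real (sqrt 3) * (\<Sum>l | l \<in> {1..k} \<and> odd l. c_coeff k Q l * eisenstein_char chi32 l \<tau>)"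
    unfolding sum_distrib_left by (rule sum.cong) (auto simp: E_def)
  moreover have "(\<Sum>l | l \<in> {1..k} \<and> even l. c_coeff k Q l * E l) =
      (\<Sum>l | l \<in> {1..k} \<and> even l. c_coeff k Q l * (3 ^ l * eisenstein l (3 * \<tau>) - eisenstein l \<tau>))"
    by (rule sum.cong) (auto simp: E_def)
  moreover have "(\<Sum>j<k. c_coeff k Q (Suc j) * (E (Suc j) - P j / 2)) =
      (\<Sum>j<k. c_coeff k Q (Suc j) * E (Suc j)) + - (\<Sum>j<k. c_coeff k Q (Suc j) * P j) / 2"
    by (simp add: ring_distribs sum_subtractf sum_divide_distrib)
  ultimately have "(\<Sum>j<k. c_coeff k Q (Suc j) * (E (Suc j) - P j / 2)) = - poly Q 1 / (2 * 3 ^ k)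
      + \<i> * of_real (sqrt 3) * (\<Sum>l | l \<in> {1..k} \<and> odd l. c_coeff k Q l * eisenstein_char chi32 l \<tau>)
      + (\<Sum>l | l \<in> {1..k} \<and> even l. c_coeff k Q l * (3 ^ l * eisenstein l (3 * \<tau>) - eisenstein l \<tau>))"
    by (simp only: add_ac)
  moreover have "(\<lambda>n. poly Q (nome \<tau> ^ Suc n) / (1 + nome \<tau> ^ Suc n + nome \<tau> ^ (2 * Suc n)) ^ k) sums
      (\<Sum>j<k. c_coeff k Q (Suc j) * (E (Suc j) - P j / 2))"
  proof (rule sums_quotient[OF Q(1,2) _ Q(4) \<tau>])
    fix j
    show "(\<lambda>n. polylog_neg j (zeta3 * nome \<tau> ^ Suc n) -
            (- 1) ^ j * polylog_neg j (inverse zeta3 * nome \<tau> ^ Suc n)) sums (E (Suc j) - P j / 2)"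
      using sums_eisenstein_combination[OF \<tau>, of j] unfolding E_def P_def
      by (simp only: even_Suc not_not)
  qed (rule Q(3))
  ultimately show ?thesis by simp
qed

subsection \<open>The Eisenstein--Kronecker function\<close>

definition polylog_tail :: "nat \<Rightarrow> complex \<Rightarrow> complex \<Rightarrow> complex" where
  "polylog_tail j w q = (\<Sum>m. polylog_neg j (w * q ^ Suc m))"

text \<open>
  The function \<open>E\<^sub>1(z) = \<Sum>\<^sub>m \<pi> cot \<pi>(z + m\<tau>)\<close> (summed symmetrically)
  for \<open>j = 0\<close>, and its \<open>j\<close>-th derivative in \<open>z\<close> in general, written out in
  \<open>w = exp (2\<pi>iz)\<close> and \<open>q\<close>.
\<close>

definition eis_kronecker :: "nat \<Rightarrow> complex \<Rightarrow> complex \<Rightarrow> complex" where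
  "eis_kronecker j z \<tau> =
     - (of_real pi * \<i> * of_bool (j = 0)) - (2 * of_real pi * \<i>) ^ Suc j *
     (polylog_neg j (nome z) + polylog_tail j (nome z) (nome \<tau>)
        - (- 1) ^ j * polylog_tail j (nome (- z)) (nome \<tau>))"

definition lattice :: "complex \<Rightarrow> complex set" where
  "lattice \<tau> = {z. \<exists>m n :: int. z = of_int m * \<tau> + of_int n}"

lemma nome_add: "nome (z + z') = nome z * nome z'"
  by (simp add: nome_def exp_add[symmetric] ring_distribs)

lemma nome_minus: "nome (- z) = inverse (nome z)"
  by (simp add: nome_def exp_minus)

lemma nome_of_int [simp]: "nome (of_int n) = 1"
  by (simp add: nome_def exp_eq_1 mult_ac)

lemma nome_eq_1: "nome z = 1 \<Longrightarrow> \<exists>n::int. z = of_int n"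
proof -
  assume "nome z = 1"
  then obtain n where n: "Im z = 0" "2 * pi * Re z = of_int (2 * n) * pi"
    by (auto simp: nome_def exp_eq_1)
  hence "Re z = of_int n" by simp
  with n show ?thesis by (intro exI[of _ n]) (simp add: complex_eq_iff)
qed

lemma DERIV_nome [derivative_intros]:
  "(nome has_field_derivative 2 * of_real pi * \<i> * nome z) (at z within S)"
  unfolding nome_def by (auto intro!: derivative_eq_intros)

lemma holomorphic_nome [holomorphic_intros]: "f holomorphic_on S \<Longrightarrow> (\<lambda>z. nome (f z)) holomorphic_on S"
  unfolding nome_def by (intro holomorphic_intros)

text \<open>The bound is uniform in both w and q, so that it serves for holomorphy in z as well as
  in \<tau>. It holds only eventually, since early arguments need not be small.\<close>

lemma polylog_tail_dominated:
  fixes M r :: real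
  assumes "0 \<le> r" "r < 1" "0 \<le> M"
  obtains h where "summable (h :: nat \<Rightarrow> real)"
    "eventually (\<lambda>m. \<forall>w q. norm w \<le> M \<longrightarrow> norm q \<le> r \<longrightarrow> norm (polylog_neg j (w * q ^ Suc m)) \<le> h m) sequentially"
proof -
  obtain C where C: "C > 0" "\<And>y. norm y \<le> 1 / 2 \<Longrightarrow> norm (polylog_neg j y) \<le> C * norm y"
    using polylog_neg_bound by blast
  have "(\<lambda>m. M * r ^ Suc m) \<longlonglongrightarrow> M * 0"
    using assms by (intro tendsto_mult_left LIMSEQ_Suc[OF LIMSEQ_realpow_zero]) auto
  hence "eventually (\<lambda>m. M * r ^ Suc m < 1 / 2) sequentially"
    by (rule order_tendstoD) simp
  hence "eventually (\<lambda>m. \<forall>w q. norm w \<le> M \<longrightarrow> norm q \<le> r \<longrightarrow>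
           norm (polylog_neg j (w * q ^ Suc m)) \<le> C * (M * r ^ Suc m)) sequentially"
  proof eventually_elim
    case (elim m)
    show ?case
    proof (intro allI impI)
      fix w q :: complex assume wq: "norm w \<le> M" "norm q \<le> r"
      have "norm (w * q ^ Suc m) \<le> M * r ^ Suc m"
        unfolding norm_mult norm_power using wq assms by (intro mult_mono power_mono) auto
      moreover from this elim have "norm (polylog_neg j (w * q ^ Suc m)) \<le> C * norm (w * q ^ Suc m)"
        by (intro C) linarith
      ultimately show "norm (polylog_neg j (w * q ^ Suc m)) \<le> C * (M * r ^ Suc m)"
        using C(1) by (meson less_imp_le mult_left_mono order.trans)
    qed
  qed
  moreover have "summable (\<lambda>m. C * (M * (r * r ^ m)))"
    using assms by (intro summable_mult summable_geometric) auto
  ultimately show ?thesis by (intro that[of "\<lambda>m. C * (M * r ^ Suc m)"]) auto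
qed

lemma polylog_tail_summable:
  assumes "norm q < 1"
  shows "summable (\<lambda>m. polylog_neg j (w * q ^ Suc m))"
proof -
  obtain h where h: "summable (h :: nat \<Rightarrow> real)"
    "eventually (\<lambda>m. \<forall>w' q'. norm w' \<le> norm w \<longrightarrow> norm q' \<le> norm q \<longrightarrow>
        norm (polylog_neg j (w' * q' ^ Suc m)) \<le> h m) sequentially"
    using polylog_tail_dominated[of "norm q" "norm w" j] assms by auto
  from h(2) have "eventually (\<lambda>m. norm (polylog_neg j (w * q ^ Suc m)) \<le> h m) sequentially"
    by eventually_elim simp
  thus ?thesis using h(1) by (rule summable_comparison_test_ev)
qed

lemma polylog_tail_mult_q:
  assumes "norm q < 1"
  shows "polylog_tail j (w * q) q = polylog_tail j w q - polylog_neg j (w * q)"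
  using suminf_split_head[OF polylog_tail_summable[OF assms, of j w]]
  by (simp add: polylog_tail_def mult_ac)

text \<open>The open set is left general: it will be the complement of the lattice, and also a
  horizontal strip around 0, where the tail is regular although \<open>nome 0 = 1\<close>.\<close>

lemma DERIV_polylog_tail:
  assumes "open S" "\<tau> \<in> upper_half_plane" "z \<in> S"
    and nz: "\<And>z m. z \<in> S \<Longrightarrow> nome z * nome \<tau> ^ Suc m \<noteq> 1"
  shows "((\<lambda>z. polylog_tail j (nome z) (nome \<tau>)) has_field_derivative
           2 * of_real pi * \<i> * polylog_tail (Suc j) (nome z) (nome \<tau>)) (at z)"
proof -
  define q where "q = nome \<tau>"
  have q: "norm q < 1" "q \<noteq> 0" using norm_nome_less_1[OF assms(2)] by (auto simp: q_def)
  have "((\<lambda>z. \<Sum>m. polylog_neg j (nome z * q ^ Suc m)) has_field_derivative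
       (\<Sum>m. 2 * of_real pi * \<i> * polylog_neg (Suc j) (nome z * q ^ Suc m))) (at z)"
  proof (rule series_termwise_derivative(3)[OF assms(1) _ _ assms(3)])
    fix m z assume "z \<in> S"
    thus "((\<lambda>z. polylog_neg j (nome z * q ^ Suc m)) has_field_derivative
       2 * of_real pi * \<i> * polylog_neg (Suc j) (nome z * q ^ Suc m)) (at z)"
      using nz[of z m] q
      by (auto intro!: derivative_eq_intros DERIV_polylog_neg_comp simp: q_def simp del: power_Suc)
  next
    fix z0 assume "z0 \<in> S"
    define M where "M = exp (2 * pi * (\<bar>Im z0\<bar> + 1))"
    obtain h where h: "summable (h :: nat \<Rightarrow> real)"
      "eventually (\<lambda>m. \<forall>w' q'. norm w' \<le> M \<longrightarrow> norm q' \<le> norm q \<longrightarrow>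
        norm (polylog_neg j (w' * q' ^ Suc m)) \<le> h m) sequentially"
      using polylog_tail_dominated[of "norm q" M j] q by (auto simp: M_def)
    have M: "norm (nome z) \<le> M" if "z \<in> ball z0 1" for z
    proof -
      have "\<bar>Im z - Im z0\<bar> \<le> 1"
        using abs_Im_le_cmod[of "z - z0"] that by (auto simp: dist_norm norm_minus_commute)
      hence "- Im z \<le> \<bar>Im z0\<bar> + 1" by linarith
      hence "2 * pi * (- Im z) \<le> 2 * pi * (\<bar>Im z0\<bar> + 1)" by (intro mult_left_mono) auto
      thus ?thesis by (simp add: norm_nome M_def)
    qed
    show "\<exists>d h. d > 0 \<and> summable (h :: nat \<Rightarrow> real) \<and>
       (\<forall>\<^sub>F m in sequentially. \<forall>z\<in>ball z0 d \<inter> S. norm (polylog_neg j (nome z * q ^ Suc m)) \<le> h m)"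
      by (intro exI[of _ 1] exI[of _ h] conjI h(1) eventually_mono[OF h(2)]) (use M in auto)
  qed
  also have "(\<Sum>m. 2 * of_real pi * \<i> * polylog_neg (Suc j) (nome z * q ^ Suc m)) =
      2 * of_real pi * \<i> * polylog_tail (Suc j) (nome z) q"
    unfolding polylog_tail_def by (rule suminf_mult[OF polylog_tail_summable[OF q(1)]])
  finally show ?thesis by (simp add: polylog_tail_def q_def)
qed

lemma holomorphic_polylog_tail:
  assumes w: "norm w = 1"
  shows "(\<lambda>\<tau>. polylog_tail j w (nome \<tau>)) holomorphic_on upper_half_plane"
  unfolding polylog_tail_def
proof (rule series_holomorphic)
  show "open upper_half_plane" unfolding upper_half_plane_def by (rule open_halfspace_Im_gt)
  show "(\<lambda>\<tau>. polylog_neg j (w * nome \<tau> ^ Suc m)) holomorphic_on upper_half_plane" for m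
  proof (intro holomorphic_intros)
    fix \<tau> assume "\<tau> \<in> upper_half_plane"
    hence "norm (w * nome \<tau> ^ Suc m) < 1"
      unfolding norm_mult norm_power w
      using norm_nome_less_1 by (simp add: power_less_one_iff del: power_Suc)
    thus "w * nome \<tau> ^ Suc m \<noteq> 1" by auto
  qed
  fix \<tau>0 assume \<tau>0: "\<tau>0 \<in> upper_half_plane"
  define y where "y = Im \<tau>0"
  have y: "y > 0" using \<tau>0 by (simp add: y_def upper_half_plane_def)
  define r where "r = exp (- (2 * pi * (y / 2)))"
  have r: "0 \<le> r" "r < 1" using y by (auto simp: r_def)
  obtain h where h: "summable (h :: nat \<Rightarrow> real)"
    "eventually (\<lambda>m. \<forall>w' q'. norm w' \<le> norm w \<longrightarrow> norm q' \<le> r \<longrightarrow>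
      norm (polylog_neg j (w' * q' ^ Suc m)) \<le> h m) sequentially"
    using polylog_tail_dominated[of r "norm w" j] r by auto
  have le: "norm (nome \<tau>) \<le> r" if "\<tau> \<in> ball \<tau>0 (y / 2)" for \<tau>
  proof -
    have "\<bar>Im \<tau> - Im \<tau>0\<bar> \<le> y / 2"
      using abs_Im_le_cmod[of "\<tau> - \<tau>0"] that by (auto simp: dist_norm norm_minus_commute)
    hence "y / 2 \<le> Im \<tau>" unfolding y_def by linarith
    hence "2 * pi * (y / 2) \<le> 2 * pi * Im \<tau>" by (intro mult_left_mono) auto
    thus ?thesis by (simp add: norm_nome r_def)
  qed
  show "\<exists>d h. d > 0 \<and> summable (h :: nat \<Rightarrow> real) \<and>
       (\<forall>\<^sub>F m in sequentially. \<forall>\<tau>\<in>ball \<tau>0 d \<inter> upper_half_plane. norm (polylog_neg j (w * nome \<tau> ^ Suc m)) \<le> h m)"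
    by (intro exI[of _ "y / 2"] exI[of _ h] conjI h(1) eventually_mono[OF h(2)]) (use le y in auto)
qed

section \<open>The period lattice\<close>

lemma lattice_iff:
  assumes "\<tau> \<in> upper_half_plane"
  shows "z \<in> lattice \<tau> \<longleftrightarrow> Im z / Im \<tau> \<in> \<int> \<and> Re z - Im z / Im \<tau> * Re \<tau> \<in> \<int>"
proof
  have \<tau>: "Im \<tau> \<noteq> 0" using assms by (auto simp: upper_half_plane_def)
  { assume "z \<in> lattice \<tau>"
    then obtain m n :: int where "z = of_int m * \<tau> + of_int n" by (auto simp: lattice_def)
    thus "Im z / Im \<tau> \<in> \<int> \<and> Re z - Im z / Im \<tau> * Re \<tau> \<in> \<int>" using \<tau> by simp }
  { assume *: "Im z / Im \<tau> \<in> \<int> \<and> Re z - Im z / Im \<tau> * Re \<tau> \<in> \<int>"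
    obtain m where m: "Im z / Im \<tau> = of_int m" using Ints_cases[OF conjunct1[OF *]] .
    obtain n where n: "Re z - Im z / Im \<tau> * Re \<tau> = of_int n" using Ints_cases[OF conjunct2[OF *]] .
    note mn = m n
    have "Im z = of_int m * Im \<tau>" using mn(1) \<tau> by (simp add: field_simps)
    moreover have "Re z = of_int m * Re \<tau> + of_int n" using mn by simp
    ultimately have "z = of_int m * \<tau> + of_int n" by (simp add: complex_eq_iff)
    thus "z \<in> lattice \<tau>" by (auto simp: lattice_def) }
qed

text \<open>The coordinates with respect to \<tau> and 1 are continuous, so the lattice is an
  intersection of preimages of the closed set of integers.\<close>

lemma open_Compl_lattice:
  assumes "\<tau> \<in> upper_half_plane"
  shows "open (- lattice \<tau>)"
proof -
  have "Im \<tau> \<noteq> 0" using assms by (auto simp: upper_half_plane_def)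
  hence "closed ((\<lambda>z. Im z / Im \<tau>) -` \<int>)" "closed ((\<lambda>z. Re z - Im z / Im \<tau> * Re \<tau>) -` \<int>)"
    by (intro continuous_closed_vimage closed_Ints continuous_intros; simp)+
  moreover have "lattice \<tau> = ((\<lambda>z. Im z / Im \<tau>) -` \<int>) \<inter> ((\<lambda>z. Re z - Im z / Im \<tau> * Re \<tau>) -` \<int>)"
    using lattice_iff[OF assms] by auto
  ultimately have "closed (lattice \<tau>)" by (simp only: closed_Int)
  thus ?thesis by (rule open_Compl)
qed

lemma lattice_diff: "z \<in> lattice \<tau> \<Longrightarrow> z' \<in> lattice \<tau> \<Longrightarrow> z - z' \<in> lattice \<tau>"
proof -
  assume "z \<in> lattice \<tau>" "z' \<in> lattice \<tau>"
  then obtain m n m' n' :: int where "z = of_int m * \<tau> + of_int n" "z' = of_int m' * \<tau> + of_int n'"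
    by (auto simp: lattice_def)
  hence "z - z' = of_int (m - m') * \<tau> + of_int (n - n')" by (simp add: algebra_simps)
  thus ?thesis unfolding lattice_def by blast
qed

lemma lattice_0 [simp]: "0 \<in> lattice \<tau>"
  unfolding lattice_def by (auto intro!: exI[of _ 0])

lemma lattice_minus_iff [simp]: "- z \<in> lattice \<tau> \<longleftrightarrow> z \<in> lattice \<tau>"
  using lattice_diff[of 0 \<tau> z] lattice_diff[of 0 \<tau> "- z"] by auto

lemma lattice_add_iff: "z' \<in> lattice \<tau> \<Longrightarrow> z + z' \<in> lattice \<tau> \<longleftrightarrow> z \<in> lattice \<tau>"
  using lattice_diff[of "z + z'" \<tau> z'] lattice_diff[of z \<tau> "- z'"] by auto

lemma nome_neq_1:
  assumes "z \<notin> lattice \<tau>"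
  shows "nome z * nome \<tau> ^ m \<noteq> 1"
proof
  assume "nome z * nome \<tau> ^ m = 1"
  hence "nome (z + of_nat m * \<tau>) = 1" by (simp add: nome_add nome_power)
  then obtain n :: int where "z + of_nat m * \<tau> = of_int n" using nome_eq_1 by blast
  hence "z = of_int (- int m) * \<tau> + of_int n" by (simp add: algebra_simps)
  thus False using assms unfolding lattice_def by blast
qed

text \<open>The power of 2 pi i and the sign in the definition are exactly what differentiating
  \<open>nome z\<close> and \<open>nome (- z)\<close> produces; the constant occurs only for j = 0
  and disappears.\<close>

lemma DERIV_eis_kronecker:
  assumes \<tau>: "\<tau> \<in> upper_half_plane" and z: "z \<notin> lattice \<tau>"
  shows "((\<lambda>z. eis_kronecker j z \<tau>) has_field_derivative eis_kronecker (Suc j) z \<tau>) (at z)"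
proof -
  note opn = open_Compl_lattice[OF \<tau>]
  have *: "((\<lambda>z. polylog_tail j (nome z) (nome \<tau>)) has_field_derivative
         2 * of_real pi * \<i> * polylog_tail (Suc j) (nome z) (nome \<tau>)) (at z)" if "z \<notin> lattice \<tau>" for z
    by (rule DERIV_polylog_tail[OF opn \<tau>]) (use that nome_neq_1 in \<open>auto simp del: power_Suc\<close>)
  have 1: "((\<lambda>z. polylog_tail j (nome (- z)) (nome \<tau>)) has_field_derivative
         2 * of_real pi * \<i> * polylog_tail (Suc j) (nome (- z)) (nome \<tau>) * (- 1)) (at z)"
    by (rule DERIV_chain2[OF *]) (use z in \<open>auto intro!: derivative_eq_intros\<close>)
  have 2: "((\<lambda>z. polylog_neg j (nome z)) has_field_derivative
         2 * of_real pi * \<i> * polylog_neg (Suc j) (nome z)) (at z)"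
    using nome_neq_1[OF z, of 0] by (intro DERIV_polylog_neg_comp[OF DERIV_nome]) auto
  show ?thesis
    unfolding eis_kronecker_def
    by (rule derivative_eq_intros refl 1 2 *[OF z])+ (simp add: algebra_simps)
qed

text \<open>The two tails are exchanged. For j = 0 the summand -pi i is just what balances the
  constant left by inversion of the middle term.\<close>

lemma eis_kronecker_minus:
  assumes "z \<notin> lattice \<tau>"
  shows "eis_kronecker j (- z) \<tau> = (- 1) ^ Suc j * eis_kronecker j z \<tau>"
proof -
  have inv: "polylog_neg j (nome (- z)) = (- 1) ^ Suc j * polylog_neg j (nome z) - of_bool (j = 0)"
    using polylog_neg_inverse[of "nome z" j] nome_neq_1[OF assms, of 0]
    by (simp add: nome_minus inverse_eq_divide)
  show ?thesis
    unfolding eis_kronecker_def inv minus_minus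
    by (cases "j = 0"; cases "even j") (auto simp: algebra_simps)
qed

lemma eis_kronecker_add_of_int: "eis_kronecker j (z + of_int n) \<tau> = eis_kronecker j z \<tau>"
proof -
  have *: "nome (- (z + of_int n)) = nome (- z)"
    unfolding nome_minus nome_add by simp
  show ?thesis unfolding eis_kronecker_def * by (simp add: nome_add)
qed

text \<open>The shift moves every term one place along: the middle term is replaced by the first
  term of one tail and joins the other tail in inverted form. The inversion constant for j = 0,
  multiplied by 2 pi i, is the quasi-period.\<close>

lemma eis_kronecker_add_tau:
  assumes \<tau>: "\<tau> \<in> upper_half_plane" and z: "z \<notin> lattice \<tau>"
  shows "eis_kronecker j (z + \<tau>) \<tau> = eis_kronecker j z \<tau> - 2 * of_real pi * \<i> * of_bool (j = 0)"
proof -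
  define q where "q = nome \<tau>"
  have q: "norm q < 1" "q \<noteq> 0" using norm_nome_less_1[OF \<tau>] by (auto simp: q_def)
  have inv: "polylog_neg j (nome (- z)) = (- 1) ^ Suc j * polylog_neg j (nome z) - of_bool (j = 0)"
    using polylog_neg_inverse[of "nome z" j] nome_neq_1[OF z, of 0]
    by (simp add: nome_minus inverse_eq_divide)
  have "nome (- (z + \<tau>)) * q = nome (- z)"
    using nome_add[of "- (z + \<tau>)" \<tau>] by (simp add: q_def)
  hence 1: "polylog_tail j (nome (- (z + \<tau>))) q = polylog_tail j (nome (- z)) q + polylog_neg j (nome (- z))"
    using polylog_tail_mult_q[OF q(1), of j "nome (- (z + \<tau>))"] by simp
  have 2: "polylog_tail j (nome (z + \<tau>)) q = polylog_tail j (nome z) q - polylog_neg j (nome (z + \<tau>))"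
    using polylog_tail_mult_q[OF q(1), of j "nome z"] by (simp add: nome_add q_def)
  show ?thesis
    unfolding eis_kronecker_def q_def[symmetric] 1 2 inv
    by (cases "j = 0"; cases "even j") (auto simp: algebra_simps)
qed

lemma eis_kronecker_quasiperiod:
  assumes \<tau>: "\<tau> \<in> upper_half_plane" and z: "z \<notin> lattice \<tau>"
  shows "eis_kronecker j (z + (of_int m * \<tau> + of_int n)) \<tau> =
           eis_kronecker j z \<tau> - 2 * of_real pi * \<i> * of_int m * of_bool (j = 0)"
proof -
  have mult: "of_int m * \<tau> \<in> lattice \<tau>" for m
    unfolding lattice_def by (rule CollectI, rule exI[of _ m], rule exI[of _ 0]) simp
  have "eis_kronecker j (z + of_int m * \<tau>) \<tau> =
           eis_kronecker j z \<tau> - 2 * of_real pi * \<i> * of_int m * of_bool (j = 0)"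
  proof (induction m rule: int_induct[where k = 0])
    case (step1 m)
    have "z + of_int m * \<tau> \<notin> lattice \<tau>" using z lattice_add_iff[OF mult] by simp
    note shift = eis_kronecker_add_tau[OF \<tau> this, of j]
    have "z + of_int (m + 1) * \<tau> = z + of_int m * \<tau> + \<tau>" by (simp add: algebra_simps)
    hence "eis_kronecker j (z + of_int (m + 1) * \<tau>) \<tau> =
        eis_kronecker j z \<tau> - 2 * of_real pi * \<i> * of_int m * of_bool (j = 0) - 2 * of_real pi * \<i> * of_bool (j = 0)"
      by (simp only: shift step1)
    thus ?case by (simp add: algebra_simps)
  next
    case (step2 m)
    have "z + of_int (m - 1) * \<tau> \<notin> lattice \<tau>" using z lattice_add_iff[OF mult] by blast
    note shift = eis_kronecker_add_tau[OF \<tau> this, of j]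
    have "z + of_int m * \<tau> = z + of_int (m - 1) * \<tau> + \<tau>" by (simp add: algebra_simps)
    hence "eis_kronecker j (z + of_int (m - 1) * \<tau>) \<tau> =
        eis_kronecker j (z + of_int m * \<tau>) \<tau> + 2 * of_real pi * \<i> * of_bool (j = 0)"
      by (simp only: shift) simp
    also have "\<dots> = eis_kronecker j z \<tau> - 2 * of_real pi * \<i> * of_int m * of_bool (j = 0) + 2 * of_real pi * \<i> * of_bool (j = 0)"
      by (simp only: step2)
    finally show ?case by (simp add: algebra_simps)
  qed simp
  thus ?thesis using eis_kronecker_add_of_int[of j "z + of_int m * \<tau>" n \<tau>] by (simp add: add.assoc)
qed

lemma eis_kronecker_pole:
  assumes \<tau>: "\<tau> \<in> upper_half_plane"
  shows "\<exists>c. ((\<lambda>z. eis_kronecker 0 z \<tau> - 1 / z) \<longlongrightarrow> c) (at 0)"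
proof -
  define y where "y = Im \<tau>"
  have y: "y > 0" using \<tau> by (simp add: y_def upper_half_plane_def)
  \<comment> \<open>In this strip \<open>nome (\<plusminus>z)\<close> times any positive power of
    \<open>nome \<tau>\<close> has modulus below 1, so both tails are regular and only the middle
    term can be singular.\<close>
  define S where "S = {z. Im z > - y} \<inter> {z. Im z < y}"
  have S: "open S" "0 \<in> S" using y by (auto simp: S_def open_halfspace_Im_gt open_halfspace_Im_lt)
  have nz: "nome z * nome \<tau> ^ Suc m \<noteq> 1" if "z \<in> S" for z m
  proof -
    have "norm (nome z * nome \<tau> ^ Suc m) = norm (nome (z + of_nat (Suc m) * \<tau>))"
      by (simp only: nome_add nome_power)
    also have "\<dots> = exp (- (2 * pi * (Im z + y + real m * y)))"
      by (simp add: norm_nome y_def algebra_simps)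
    also have "\<dots> < 1"
    proof -
      have "0 \<le> real m * y" "- y < Im z" using y that by (auto simp: S_def)
      hence "0 < 2 * pi * (Im z + y + real m * y)" by (intro mult_pos_pos) auto
      thus ?thesis by simp
    qed
    finally show ?thesis by auto
  qed
  have cont: "isCont (\<lambda>z. polylog_tail 0 (nome z) (nome \<tau>)) 0"
    by (rule DERIV_isCont[OF DERIV_polylog_tail[OF S(1) \<tau> S(2) nz]])
  hence "(\<lambda>z. polylog_tail 0 (nome z) (nome \<tau>)) \<midarrow>0\<rightarrow> polylog_tail 0 (nome 0) (nome \<tau>)"
    unfolding isCont_def .
  moreover have "isCont (\<lambda>z. polylog_tail 0 (nome (- z)) (nome \<tau>)) 0"
    by (rule isCont_o2[where f = uminus]) (use cont in auto)
  hence "(\<lambda>z. polylog_tail 0 (nome (- z)) (nome \<tau>)) \<midarrow>0\<rightarrow> polylog_tail 0 (nome 0) (nome \<tau>)"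
    by (simp add: isCont_def)
  moreover obtain a where a:
    "\<And>z. z \<noteq> 0 \<Longrightarrow> norm z < 2 \<Longrightarrow> (\<lambda>n. a n * z ^ n) sums (polylog_neg 0 (exp (- z)) - 1 / z)"
    using polylog_neg_exp_expansion by blast
  hence "(\<lambda>z. polylog_neg 0 (exp (- z)) - 1 / z) \<midarrow>0\<rightarrow> a 0"
    by (intro powser_limit_0_strong[of 2]) auto
  \<comment> \<open>Substituting -2 pi i z shows that the middle term behaves like -1 / (2 pi i z);
    the prefactor -2 pi i then makes the residue 1.\<close>
  hence "(\<lambda>z. polylog_neg 0 (exp (- (- (2 * of_real pi * \<i> * z)))) - 1 / (- (2 * of_real pi * \<i> * z))) \<midarrow>0\<rightarrow> a 0"
  proof (rule filterlim_compose)
    show "filterlim (\<lambda>z. - (2 * of_real pi * \<i> * z)) (at 0) (at (0 :: complex))"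
      by (auto simp: filterlim_at eventually_at_filter intro!: tendsto_eq_intros)
  qed
  hence "(\<lambda>z. polylog_neg 0 (nome z) + 1 / (2 * of_real pi * \<i> * z)) \<midarrow>0\<rightarrow> a 0"
    by (simp add: nome_def)
  ultimately have "(\<lambda>z. - (of_real pi * \<i>) - (2 * of_real pi * \<i>) *
       ((polylog_neg 0 (nome z) + 1 / (2 * of_real pi * \<i> * z))
         + polylog_tail 0 (nome z) (nome \<tau>) - polylog_tail 0 (nome (- z)) (nome \<tau>))) \<midarrow>0\<rightarrow>
     - (of_real pi * \<i>) - (2 * of_real pi * \<i>) *
       (a 0 + polylog_tail 0 (nome 0) (nome \<tau>) - polylog_tail 0 (nome 0) (nome \<tau>))"
    by (intro tendsto_intros)
  also have "(\<lambda>z. - (of_real pi * \<i>) - (2 * of_real pi * \<i>) *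
       ((polylog_neg 0 (nome z) + 1 / (2 * of_real pi * \<i> * z))
         + polylog_tail 0 (nome z) (nome \<tau>) - polylog_tail 0 (nome (- z)) (nome \<tau>))) =
     (\<lambda>z. eis_kronecker 0 z \<tau> - 1 / z)"
    by (auto simp: eis_kronecker_def fun_eq_iff field_simps)
  finally show ?thesis by blast
qed

subsection \<open>The transformation law\<close>

lemma lattice_add: "z \<in> lattice \<tau> \<Longrightarrow> z' \<in> lattice \<tau> \<Longrightarrow> z + z' \<in> lattice \<tau>"
  using lattice_diff[of z \<tau> "- z'"] by simp

lemma lattice_isolated:
  assumes "\<tau> \<in> upper_half_plane"
  obtains r where "r > 0" "ball 0 r \<inter> lattice \<tau> = {0}"
proof -
  define r where "r = min 1 (Im \<tau>)"
  have y: "Im \<tau> > 0" using assms by (simp add: upper_half_plane_def)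
  have "z = 0" if z: "z \<in> ball 0 r" "z \<in> lattice \<tau>" for z
  proof -
    from z(2) obtain m n :: int where mn: "z = of_int m * \<tau> + of_int n" by (auto simp: lattice_def)
    have lt: "norm z < 1" "norm z < Im \<tau>" using z(1) by (auto simp: r_def)
    have "m = 0"
    proof (rule ccontr)
      assume "m \<noteq> 0"
      hence "1 * Im \<tau> \<le> \<bar>real_of_int m\<bar> * Im \<tau>" using y by (intro mult_right_mono) auto
      also have "\<dots> = \<bar>Im z\<bar>" using y by (simp add: mn abs_mult)
      finally show False using lt abs_Im_le_cmod[of z] by linarith
    qed
    moreover have "n = 0"
    proof (rule ccontr)
      assume "n \<noteq> 0"
      hence "1 \<le> \<bar>real_of_int n\<bar>" by linarith
      thus False using lt \<open>m = 0\<close> by (simp add: mn)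
    qed
    ultimately show "z = 0" by (simp add: mn)
  qed
  moreover have "r > 0" using y by (simp add: r_def)
  ultimately show ?thesis by (intro that[of r]) auto
qed

text \<open>A limit at 0 is enough, since periodicity carries it to every lattice point. The
  function extended in this way is entire, and its range is its image of the compact fundamental
  parallelogram, so Liouville's theorem applies.\<close>

lemma doubly_periodic_constant:
  assumes \<tau>: "\<tau> \<in> upper_half_plane"
    and hol: "D holomorphic_on - lattice \<tau>"
    and lim: "D \<midarrow>0\<rightarrow> l"
    and per: "\<And>z \<omega>. z \<notin> lattice \<tau> \<Longrightarrow> \<omega> \<in> lattice \<tau> \<Longrightarrow> D (z + \<omega>) = D z"
  obtains K where "\<And>z. z \<notin> lattice \<tau> \<Longrightarrow> D z = K"
proof -
  define g where "g = (\<lambda>z. if z \<in> lattice \<tau> then l else D z)"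
  have g_per: "g (z + \<omega>) = g z" if "\<omega> \<in> lattice \<tau>" for z \<omega>
    using per[OF _ that] lattice_add_iff[OF that, of z] by (auto simp: g_def)
  obtain r where r: "r > 0" "ball 0 r \<inter> lattice \<tau> = {0}"
    using lattice_isolated[OF \<tau>] .
  have "D holomorphic_on ball 0 r - {0}"
    by (rule holomorphic_on_subset[OF hol]) (use r in auto)
  hence "(\<lambda>z. if z = 0 then l else D z) holomorphic_on ball 0 r"
    by (rule removable_singularity) (use lim in auto)
  also have "?this \<longleftrightarrow> g holomorphic_on ball 0 r"
  proof (rule holomorphic_cong)
    fix z :: complex assume "z \<in> ball 0 r"
    hence "z \<in> lattice \<tau> \<longleftrightarrow> z = 0" using r(2) lattice_0 by blast
    thus "(if z = 0 then l else D z) = g z" by (simp add: g_def)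
  qed simp
  finally have g_hol0: "g holomorphic_on ball 0 r" .
  have "\<exists>g'. (g has_field_derivative g') (at z)" for z
  proof (cases "z \<in> lattice \<tau>")
    case True
    have "\<exists>g'. (g has_field_derivative g') (at 0)"
      using g_hol0 r(1) unfolding holomorphic_on_open[OF open_ball] by simp
    then obtain g' where g': "(g has_field_derivative g') (at 0)" ..
    have "((\<lambda>w. g (w - z)) has_field_derivative g' * 1) (at z)"
      by (rule DERIV_chain2[where f = g]) (use g' in \<open>auto intro!: derivative_eq_intros\<close>)
    also have "(\<lambda>w. g (w - z)) = g"
      using g_per[of "- z"] True by (auto simp: fun_eq_iff)
    finally show ?thesis by blast
  next
    case False
    have "\<exists>g'. (D has_field_derivative g') (at z)"
      using hol open_Compl_lattice[OF \<tau>] False by (auto simp: holomorphic_on_open)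
    then obtain g' where "(D has_field_derivative g') (at z)" ..
    hence "(g has_field_derivative g') (at z)"
      by (rule has_field_derivative_transform_within_open[OF _ open_Compl_lattice[OF \<tau>]])
         (use False in \<open>auto simp: g_def\<close>)
    thus ?thesis ..
  qed
  hence g_hol: "g holomorphic_on UNIV" by (simp add: holomorphic_on_open)
  define P where "P = (\<lambda>(s, t). complex_of_real s * \<tau> + of_real t) ` ({0..1} \<times> {0..1})"
  have "compact P"
    unfolding P_def case_prod_unfold
    by (intro compact_continuous_image compact_Times compact_Icc continuous_intros)
  hence "compact (g ` P)"
    by (intro compact_continuous_image holomorphic_on_imp_continuous_on holomorphic_on_subset[OF g_hol]) auto
  hence "bounded (g ` P)" by (rule compact_imp_bounded)
  moreover have "range g \<subseteq> g ` P"
  proof safe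
    fix z
    define s where "s = Im z / Im \<tau>"
    define t where "t = Re z - s * Re \<tau>"
    have y: "Im \<tau> > 0" using \<tau> by (simp add: upper_half_plane_def)
    have z: "z = of_real s * \<tau> + of_real t" using y by (simp add: complex_eq_iff s_def t_def)
    define \<omega> where "\<omega> = of_int \<lfloor>s\<rfloor> * \<tau> + of_int \<lfloor>t\<rfloor>"
    have \<omega>: "\<omega> \<in> lattice \<tau>" by (auto simp: lattice_def \<omega>_def)
    define p where "p = of_real (frac s) * \<tau> + of_real (frac t)"
    have "(frac s, frac t) \<in> {0..1} \<times> {0..1}"
      by (simp add: frac_lt_1 less_imp_le)
    hence "p \<in> P" unfolding P_def p_def by (intro image_eqI[of _ _ "(frac s, frac t)"]) auto
    moreover have "z = p + \<omega>" unfolding p_def \<omega>_def frac_def by (subst z) (simp add: algebra_simps)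
    hence "g z = g p" using g_per[OF \<omega>] by simp
    ultimately show "g z \<in> g ` P" by blast
  qed
  ultimately have "bounded (range g)" by (rule bounded_subset)
  hence "g constant_on UNIV" by (rule Liouville_theorem[OF g_hol])
  then obtain K where "\<And>z. g z = K" by (auto simp: constant_on_def)
  hence "D z = K" if "z \<notin> lattice \<tau>" for z using that by (metis g_def)
  thus ?thesis by (rule that)
qed

locale modular_transformation =
  fixes a b c d :: int and \<tau> :: complex
  assumes det: "a * d - b * c = 1" and \<tau>: "\<tau> \<in> upper_half_plane"
begin

definition J where "J = of_int c * \<tau> + of_int d"
definition \<tau>' where "\<tau>' = moebius_act (a, b, c, d) \<tau>"

lemma det': "of_int a * of_int d - of_int b * of_int c = (1 :: 'a :: ring_1)"
  by (metis det of_int_1 of_int_diff of_int_mult)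

lemma Im_tau_pos: "Im \<tau> > 0"
  using \<tau> by (simp add: upper_half_plane_def)

lemma J_nz: "J \<noteq> 0"
proof
  assume "J = 0"
  hence "Im J = 0" "Re J = 0" by auto
  moreover have "Im J = of_int c * Im \<tau>" "Re J = of_int c * Re \<tau> + of_int d" by (simp_all add: J_def)
  ultimately have "c = 0 \<and> d = 0" using Im_tau_pos by auto
  thus False using det by simp
qed

lemma tau'_J: "\<tau>' * J = of_int a * \<tau> + of_int b"
  using J_nz by (simp add: \<tau>'_def moebius_act_def J_def)

lemma Im_tau': "Im \<tau>' = Im \<tau> / (norm J)\<^sup>2"
proof -
  have "\<tau>' = (of_int a * \<tau> + of_int b) * cnj J / of_real ((norm J)\<^sup>2)"
    unfolding complex_norm_square tau'_J[symmetric] using J_nz by simp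
  hence "Im \<tau>' = Im ((of_int a * \<tau> + of_int b) * cnj J) / (norm J)\<^sup>2"
    by (simp only: Im_divide_of_real)
  also have "Im ((of_int a * \<tau> + of_int b) * cnj J) = (of_int a * of_int d - of_int b * of_int c) * Im \<tau>"
    by (simp add: J_def algebra_simps)
  finally show ?thesis by (simp add: det')
qed

lemma tau'_upper: "\<tau>' \<in> upper_half_plane"
  using Im_tau' Im_tau_pos J_nz by (simp add: upper_half_plane_def)

text \<open>Determinant 1 means that \<tau>' and 1, scaled by \<open>J\<close>, form another basis
  of the lattice of \<tau>. The new coefficient of \<tau>' is the one that enters the
  quasi-period.\<close>

lemma lattice_vector:
  "of_int m * \<tau> + of_int n = (of_int (m * d - n * c) * \<tau>' + of_int (a * n - b * m)) * J"
proof -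
  have "(of_int (m * d - n * c) * \<tau>' + of_int (a * n - b * m)) * J =
      of_int (m * d - n * c) * (of_int a * \<tau> + of_int b) + of_int (a * n - b * m) * (of_int c * \<tau> + of_int d)"
    unfolding tau'_J[symmetric] J_def[symmetric] by (simp add: algebra_simps)
  also have "\<dots> = (of_int a * of_int d - of_int b * of_int c) * (of_int m * \<tau> + of_int n)"
    by (simp add: algebra_simps)
  finally show ?thesis by (simp add: det')
qed

lemma lattice_iff': "z / J \<in> lattice \<tau>' \<longleftrightarrow> z \<in> lattice \<tau>"
proof
  assume "z \<in> lattice \<tau>"
  then obtain m n :: int where "z = of_int m * \<tau> + of_int n" by (auto simp: lattice_def)
  hence "z / J = of_int (m * d - n * c) * \<tau>' + of_int (a * n - b * m)"
    using lattice_vector[of m n] J_nz by simp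
  thus "z / J \<in> lattice \<tau>'" unfolding lattice_def by blast
next
  assume "z / J \<in> lattice \<tau>'"
  then obtain m n :: int where "z / J = of_int m * \<tau>' + of_int n" by (auto simp: lattice_def)
  hence "z = of_int m * (\<tau>' * J) + of_int n * J" using J_nz by (simp add: field_simps)
  also have "\<dots> = of_int (m * a + n * c) * \<tau> + of_int (m * b + n * d)"
    unfolding tau'_J by (simp add: J_def algebra_simps)
  finally show "z \<in> lattice \<tau>" unfolding lattice_def by blast
qed

text \<open>In the difference \<open>D\<close> of the two sides the poles cancel, since 1 / (z / J)
  = J / z. Along the lattice vector with coefficients m, n the quasi-periods add up to 2 pi i (-(m d
  - n c) + m J - c (m \<tau> + n)) = 0. So \<open>D\<close> is constant.\<close>

lemma eis_kronecker_0_transform: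
  assumes z: "z \<notin> lattice \<tau>"
  shows "eis_kronecker 0 (z / J) \<tau>' = J * eis_kronecker 0 z \<tau> + 2 * of_real pi * \<i> * of_int c * z"
proof -
  define D where "D = (\<lambda>z. eis_kronecker 0 (z / J) \<tau>' - J * eis_kronecker 0 z \<tau> - 2 * of_real pi * \<i> * of_int c * z)"
  have der: "\<exists>D'. (D has_field_derivative D') (at z)" if "z \<notin> lattice \<tau>" for z
  proof -
    have "((\<lambda>z. eis_kronecker 0 (z / J) \<tau>') has_field_derivative eis_kronecker (Suc 0) (z / J) \<tau>' * (1 / J)) (at z)"
      by (rule DERIV_chain2[OF DERIV_eis_kronecker[OF tau'_upper]])
         (use that lattice_iff' J_nz in \<open>auto intro!: derivative_eq_intros\<close>)
    from this DERIV_eis_kronecker[OF \<tau> that, of 0] show ?thesis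
      unfolding D_def by (intro exI) (rule derivative_intros | assumption)+
  qed
  hence hol: "D holomorphic_on - lattice \<tau>"
    using open_Compl_lattice[OF \<tau>] by (simp add: holomorphic_on_open)
  obtain l1 where l1: "(\<lambda>z. eis_kronecker 0 z \<tau>' - 1 / z) \<midarrow>0\<rightarrow> l1"
    using eis_kronecker_pole[OF tau'_upper] by blast
  obtain l2 where l2: "(\<lambda>z. eis_kronecker 0 z \<tau> - 1 / z) \<midarrow>0\<rightarrow> l2"
    using eis_kronecker_pole[OF \<tau>] by blast
  have "(\<lambda>z. eis_kronecker 0 (z / J) \<tau>' - 1 / (z / J)) \<midarrow>0\<rightarrow> l1"
    by (rule filterlim_compose[OF l1])
       (use J_nz in \<open>auto simp: filterlim_at eventually_at_filter intro!: tendsto_eq_intros\<close>)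
  hence "(\<lambda>z. (eis_kronecker 0 (z / J) \<tau>' - 1 / (z / J)) - J * (eis_kronecker 0 z \<tau> - 1 / z)
       - 2 * of_real pi * \<i> * of_int c * z) \<midarrow>0\<rightarrow> l1 - J * l2 - 2 * of_real pi * \<i> * of_int c * 0"
    by (intro tendsto_intros l2)
  also have "(\<lambda>z. (eis_kronecker 0 (z / J) \<tau>' - 1 / (z / J)) - J * (eis_kronecker 0 z \<tau> - 1 / z)
       - 2 * of_real pi * \<i> * of_int c * z) = D"
    by (simp add: D_def fun_eq_iff algebra_simps)
  finally have lim: "D \<midarrow>0\<rightarrow> l1 - J * l2 - 2 * of_real pi * \<i> * of_int c * 0" .
  have per: "D (z + \<omega>) = D z" if z: "z \<notin> lattice \<tau>" and "\<omega> \<in> lattice \<tau>" for z \<omega>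
  proof -
    from that(2) obtain m n :: int where \<omega>: "\<omega> = of_int m * \<tau> + of_int n" by (auto simp: lattice_def)
    have z': "z / J \<notin> lattice \<tau>'" using z lattice_iff' by simp
    have "(z + \<omega>) / J = z / J + (of_int (m * d - n * c) * \<tau>' + of_int (a * n - b * m))"
      unfolding \<omega> lattice_vector using J_nz by (simp add: add_divide_distrib)
    hence 1: "eis_kronecker 0 ((z + \<omega>) / J) \<tau>' = eis_kronecker 0 (z / J) \<tau>' - 2 * of_real pi * \<i> * of_int (m * d - n * c)"
      using eis_kronecker_quasiperiod[OF tau'_upper z', of 0 "m * d - n * c" "a * n - b * m"] by simp
    have 2: "eis_kronecker 0 (z + \<omega>) \<tau> = eis_kronecker 0 z \<tau> - 2 * of_real pi * \<i> * of_int m"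
      using eis_kronecker_quasiperiod[OF \<tau> z, of 0 m n] by (simp add: \<omega>)
    show ?thesis unfolding D_def 1 2 by (simp add: \<omega> J_def algebra_simps)
  qed
  obtain K where K: "\<And>z. z \<notin> lattice \<tau> \<Longrightarrow> D z = K"
    using doubly_periodic_constant[OF \<tau> hol lim per] by blast
  \<comment> \<open>A constant odd function is 0.\<close>
  have "D (- z) = - D z"
  proof -
    have z': "z / J \<notin> lattice \<tau>'" using z lattice_iff' by simp
    show ?thesis unfolding D_def
      using eis_kronecker_minus[OF z, of 0] eis_kronecker_minus[OF z', of 0] by simp
  qed
  hence "K = - K" using K[OF z] K[of "- z"] z by simp
  hence "D z = 0" using K[OF z] by simp
  thus ?thesis by (simp add: D_def algebra_simps)
qed

text \<open>The correction is linear in z for i = 0, so it becomes constant for i = 1 and vanishes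
  afterwards. This is why weight 2 is the exceptional weight.\<close>

lemma eis_kronecker_transform:
  assumes "z \<notin> lattice \<tau>"
  shows "eis_kronecker i (z / J) \<tau>' / J ^ Suc i = eis_kronecker i z \<tau> +
    (if i = 0 then 2 * of_real pi * \<i> * of_int c * z / J else if i = 1 then 2 * of_real pi * \<i> * of_int c / J else 0)"
  using assms
proof (induction i arbitrary: z)
  case 0
  thus ?case using eis_kronecker_0_transform[OF 0] J_nz by (simp add: field_simps)
next
  case (Suc i)
  have "((\<lambda>z. eis_kronecker i (z / J) \<tau>' / J ^ Suc i) has_field_derivative
      eis_kronecker (Suc i) (z / J) \<tau>' * (1 / J) / J ^ Suc i) (at z)"
    by (intro DERIV_cdivide DERIV_chain2[OF DERIV_eis_kronecker[OF tau'_upper]])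
       (use Suc.prems lattice_iff' J_nz in \<open>auto intro!: derivative_eq_intros\<close>)
  moreover have "((\<lambda>z. eis_kronecker i (z / J) \<tau>' / J ^ Suc i) has_field_derivative
      eis_kronecker (Suc i) z \<tau> + (if i = 0 then 2 * of_real pi * \<i> * of_int c / J else 0)) (at z)"
  proof (rule has_field_derivative_transform_within_open[OF _ open_Compl_lattice[OF \<tau>]])
    show "((\<lambda>z. eis_kronecker i z \<tau> + (if i = 0 then 2 * of_real pi * \<i> * of_int c * z / J
         else if i = 1 then 2 * of_real pi * \<i> * of_int c / J else 0)) has_field_derivative
      eis_kronecker (Suc i) z \<tau> + (if i = 0 then 2 * of_real pi * \<i> * of_int c / J else 0)) (at z)"
      using J_nz by (intro DERIV_add DERIV_eis_kronecker[OF \<tau> Suc.prems]) (auto intro!: derivative_eq_intros)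
  qed (use Suc in auto)
  ultimately have "eis_kronecker (Suc i) (z / J) \<tau>' * (1 / J) / J ^ Suc i =
      eis_kronecker (Suc i) z \<tau> + (if i = 0 then 2 * of_real pi * \<i> * of_int c / J else 0)"
    by (rule DERIV_unique)
  thus ?case using J_nz by (simp add: field_simps)
qed

end

subsection \<open>Modular forms from the 3-torsion point\<close>

lemma third_notin_lattice: "1 / 3 \<notin> lattice \<tau>" if "\<tau> \<in> upper_half_plane"
proof
  assume "1 / 3 \<in> lattice \<tau>"
  hence "(1 / 3 :: real) \<in> \<int>" using lattice_iff[OF that, of "1 / 3"] by simp
  then obtain n :: int where "1 / 3 = real_of_int n" by (elim Ints_cases)
  hence "real_of_int (3 * n) = real_of_int 1" by simp
  hence "3 * n = 1" by (simp only: of_int_eq_iff)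
  thus False by presburger
qed

section \<open>Characters modulo 3 and the action of \<open>Gamma0 3\<close>\<close>

definition chi_trivial3 :: "int \<Rightarrow> complex" where
  "chi_trivial3 m = (if 3 dvd m then 0 else 1)"

lemma prime_3: "prime (3 :: int)" by simp

lemma coprime_3_iff: "coprime a 3 \<longleftrightarrow> \<not> 3 dvd a" for a :: int
proof
  assume "coprime a 3"
  thus "\<not> 3 dvd a" using coprime_common_divisor[of a 3 3] by fastforce
next
  assume "\<not> 3 dvd a"
  hence "coprime 3 a" by (rule prime_imp_coprime[OF prime_3])
  thus "coprime a 3" by (simp only: coprime_commute)
qed

lemma dirichlet_character_trivial3: "is_dirichlet_character 3 chi_trivial3"
proof -
  have "3 dvd a * b \<longleftrightarrow> 3 dvd a \<or> 3 dvd b" for a b :: int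
    by (rule prime_dvd_mult_iff[OF prime_3])
  moreover have "3 dvd a + 3 \<longleftrightarrow> 3 dvd a" "\<not> 3 dvd (1 :: int)" for a :: int by presburger+
  ultimately show ?thesis
    unfolding is_dirichlet_character_def chi_trivial3_def of_nat_numeral coprime_3_iff by simp
qed

lemma dirichlet_character_chi32: "is_dirichlet_character 3 chi32"
proof -
  have "chi32 (a * b) = chi32 a * chi32 b" for a b
  proof -
    have ab: "a mod 3 = 0 \<or> a mod 3 = 1 \<or> a mod 3 = 2" "b mod 3 = 0 \<or> b mod 3 = 1 \<or> b mod 3 = 2"
      by presburger+
    have "a * b mod 3 = (a mod 3) * (b mod 3) mod 3" by (rule mod_mult_eq[symmetric])
    with ab show ?thesis unfolding chi32_def by (elim disjE) simp_all
  qed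
  moreover have "chi32 (a + 3) = chi32 a" for a by (simp add: chi32_def)
  moreover have "chi32 a = 0 \<longleftrightarrow> 3 dvd a" for a by (auto simp: chi32_def dvd_eq_mod_eq_0)
  moreover have "chi32 1 = 1" by (simp add: chi32_def)
  ultimately show ?thesis
    unfolding is_dirichlet_character_def of_nat_numeral coprime_3_iff by simp
qed

lemma Gamma0_3D:
  assumes "(a, b, c, d) \<in> Gamma0 3"
  shows "a * d - b * c = 1" "3 dvd c"
  using assms by (simp_all add: Gamma0_def SL2Z_def)

lemma not_3_dvd_right:
  fixes a b c d :: int
  assumes "a * d - b * c = 1" "3 dvd c"
  shows "\<not> 3 dvd d"
proof
  assume "3 dvd d"
  with assms(2) have "3 dvd a * d - b * c" by (intro dvd_diff dvd_mult)
  thus False using assms(1) by simp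
qed

text \<open>For d prime to 3 this is the sign congruent to d modulo 3, raised to the weight i +
  1.\<close>

definition eis_char :: "nat \<Rightarrow> int \<Rightarrow> complex" where
  "eis_char i = (if even i then chi32 else chi_trivial3)"

context modular_transformation begin

text \<open>The choice z = J / 3 makes z / J the fixed point 1/3. The matrix is arbitrary in SL2(Z),
  so the formula gives both the transformation under \<open>Gamma0 3\<close> and the behaviour at
  all cusps.\<close>

lemma eis_kronecker_third_slash:
  shows "J / 3 \<notin> lattice \<tau>"
    and "eis_kronecker i (1 / 3) \<tau>' / J ^ Suc i = eis_kronecker i (J / 3) \<tau> +
           (if i = 0 then 2 * of_real pi * \<i> * of_int c / 3 else if i = 1 then 2 * of_real pi * \<i> * of_int c / J else 0)"
proof -
  have eq: "J / 3 / J = 1 / 3" using J_nz by simp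
  show "J / 3 \<notin> lattice \<tau>"
    using lattice_iff'[of "J / 3"] third_notin_lattice[OF tau'_upper] unfolding eq by simp
  from eis_kronecker_transform[OF this, of i] show "eis_kronecker i (1 / 3) \<tau>' / J ^ Suc i = eis_kronecker i (J / 3) \<tau> +
           (if i = 0 then 2 * of_real pi * \<i> * of_int c / 3 else if i = 1 then 2 * of_real pi * \<i> * of_int c / J else 0)"
    unfolding eq using J_nz by (auto simp: field_simps)
qed

text \<open>If 3 divides c, then J / 3 is congruent to 1/3 or -1/3 modulo the lattice, and parity in
  z turns the sign into the character. In weight 1 the quasi-period -2 pi i c / 3 of this
  translation cancels the linear correction, so the form is genuinely modular.\<close>

lemma eis_kronecker_third_Gamma0:
  assumes "3 dvd c"
  shows "eis_kronecker i (1 / 3) \<tau>' = eis_char i d * J ^ Suc i *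
           (eis_kronecker i (1 / 3) \<tau> + (if i = 1 then 2 * of_real pi * \<i> * (of_int c / J) else 0))"
proof -
  obtain c' where c': "c = 3 * c'" using assms by (elim dvdE)
  have "\<not> 3 dvd d" by (rule not_3_dvd_right[OF det assms])
  hence "\<exists>d' \<epsilon>. d = 3 * d' + \<epsilon> \<and> (\<epsilon> = 1 \<or> \<epsilon> = -1)" by presburger
  then obtain d' \<epsilon> where d': "d = 3 * d' + \<epsilon>" "\<epsilon> = 1 \<or> \<epsilon> = -1" by blast
  have not_in: "of_int \<epsilon> / 3 \<notin> lattice \<tau>"
    using third_notin_lattice[OF \<tau>] lattice_minus_iff[of "1 / 3" \<tau>] d'(2) by auto
  have eq: "J / 3 = of_int \<epsilon> / 3 + (of_int c' * \<tau> + of_int d')"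
    unfolding J_def by (subst c', subst d'(1)) (simp add: field_simps)
  have "eis_kronecker i (J / 3) \<tau> = eis_kronecker i (of_int \<epsilon> / 3) \<tau> - 2 * of_real pi * \<i> * of_int c' * of_bool (i = 0)"
    unfolding eq by (rule eis_kronecker_quasiperiod[OF \<tau> not_in])
  also have "eis_kronecker i (of_int \<epsilon> / 3) \<tau> = of_int \<epsilon> ^ Suc i * eis_kronecker i (1 / 3) \<tau>"
    using d'(2) eis_kronecker_minus[OF third_notin_lattice[OF \<tau>], of i] by auto
  also have "(of_int \<epsilon> :: complex) ^ Suc i = eis_char i d"
  proof -
    have "\<epsilon> = 1 \<Longrightarrow> d mod 3 = 1" "\<epsilon> = -1 \<Longrightarrow> d mod 3 = 2" using d'(1) by presburger+
    thus ?thesis using d'(2) \<open>\<not> 3 dvd d\<close> by (auto simp: eis_char_def chi32_def chi_trivial3_def)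
  qed
  finally have "eis_kronecker i (1 / 3) \<tau>' / J ^ Suc i =
     eis_char i d * eis_kronecker i (1 / 3) \<tau> + (if i = 1 then 2 * of_real pi * \<i> * of_int c / J else 0)"
    unfolding eis_kronecker_third_slash(2) by (simp add: c')
  \<comment> \<open>In weight 2 the character is 1 at d, so the correction may be moved inside the
    bracket.\<close>
  moreover have "eis_char 1 d = 1" using \<open>\<not> 3 dvd d\<close> by (simp add: eis_char_def chi_trivial3_def)
  ultimately have "eis_kronecker i (1 / 3) \<tau>' / J ^ Suc i =
     eis_char i d * (eis_kronecker i (1 / 3) \<tau> + (if i = 1 then 2 * of_real pi * \<i> * (of_int c / J) else 0))"
    by (simp add: algebra_simps)
  moreover have "eis_kronecker i (1 / 3) \<tau>' = (eis_kronecker i (1 / 3) \<tau>' / J ^ Suc i) * J ^ Suc i"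
    using J_nz by simp
  ultimately show ?thesis by (simp only: mult_ac)
qed

end

section \<open>Boundedness at the cusps\<close>

lemma eis_kronecker_bounded:
  assumes c0: "c0 \<in> {-1, 0, 1 :: int}"
  obtains K where "\<And>\<tau>. Im \<tau> \<ge> 1 \<Longrightarrow> norm (eis_kronecker i ((of_int c0 * \<tau> + of_int d) / 3) \<tau>) \<le> K"
proof -
  obtain C where C: "C > 0" "\<And>y. norm y \<le> 1 / 2 \<Longrightarrow> norm (polylog_neg i y) \<le> C * norm y"
    using polylog_neg_bound by blast
  \<comment> \<open>The summands cover the three cases for the middle term: for c0 = 0 it does not
    depend on \<tau>, for c0 = 1 its argument is small, and for c0 = -1 its argument is large and
    inversion costs at most 1.\<close>
  define L where "L = norm (polylog_neg i (nome (of_int d / 3))) + C + 1"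
  define K where "K = pi + (2 * pi) ^ Suc i * (L + C + C)"
  have "norm (eis_kronecker i ((of_int c0 * \<tau> + of_int d) / 3) \<tau>) \<le> K" if \<tau>: "Im \<tau> \<ge> 1" for \<tau>
  proof -
    define z where "z = (of_int c0 * \<tau> + of_int d) / 3"
    \<comment> \<open>The cube root of |q|, which is the natural scale: \<open>nome z\<close> has
      modulus \<rho>, 1 or 1/\<rho>.\<close>
    define \<rho> where "\<rho> = exp (- (2 * pi * Im \<tau> / 3))"
    have "\<rho> \<le> exp (- 1)"
      unfolding \<rho>_def using \<tau> pi_gt3 mult_mono[of 3 "2 * pi" 1 "Im \<tau>"] by simp
    also have "exp (- 1 :: real) \<le> 1 / 2"
    proof -
      have "2 \<le> exp (1 :: real)" using exp_ge_add_one_self[of 1] by simp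
      hence "inverse (exp 1) \<le> inverse (2 :: real)" by (rule le_imp_inverse_le) simp
      thus ?thesis by (simp only: exp_minus inverse_eq_divide)
    qed
    finally have \<rho>: "0 < \<rho>" "\<rho> \<le> 1 / 2" by (auto simp: \<rho>_def)
    have q: "norm (nome \<tau>) = \<rho> ^ 3"
      by (simp add: norm_nome \<rho>_def exp_of_nat_mult[symmetric])
    have z: "norm (nome z) = exp (- (2 * pi * Im \<tau> / 3) * of_int c0)"
      by (simp add: norm_nome z_def)
    have z': "norm (nome (- z)) = exp (- (2 * pi * Im \<tau> / 3) * - of_int c0)"
      by (simp add: norm_nome z_def)
    have zc: "norm (nome z) = (if c0 = 1 then \<rho> else if c0 = 0 then 1 else 1 / \<rho>)"
      using c0 unfolding z by (auto simp: \<rho>_def exp_minus field_simps)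
    have zc': "norm (nome (- z)) = (if c0 = 1 then 1 / \<rho> else if c0 = 0 then 1 else \<rho>)"
      using c0 unfolding z' by (auto simp: \<rho>_def exp_minus field_simps)
    have tail: "norm (polylog_tail i w (nome \<tau>)) \<le> C" if w: "norm w * \<rho> \<le> 1" for w
    proof -
      have "norm (polylog_neg i (w * nome \<tau> ^ Suc m)) \<le> C * (1 / 2) ^ Suc m" for m
      proof -
        \<comment> \<open>One factor \<rho> is split off to compensate a w of modulus up to
          1/\<rho>; the remaining power still decays geometrically.\<close>
        have "3 * Suc m = Suc (3 * m + 2)" by simp
        hence "(\<rho> ^ 3) ^ Suc m = \<rho> * \<rho> ^ (3 * m + 2)"
          by (simp only: power_mult[symmetric] power_Suc[symmetric])
        hence "norm (w * nome \<tau> ^ Suc m) = (norm w * \<rho>) * \<rho> ^ (3 * m + 2)"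
          by (simp only: norm_mult norm_power q mult.assoc)
        also have "\<dots> \<le> 1 * \<rho> ^ Suc m"
          using \<rho> w by (intro mult_mono power_decreasing) auto
        also have "\<dots> \<le> (1 / 2) ^ Suc m" using \<rho> by (simp only: mult_1) (intro power_mono, auto)
        finally have le: "norm (w * nome \<tau> ^ Suc m) \<le> (1 / 2) ^ Suc m" .
        also have "(1 / 2 :: real) ^ Suc m \<le> 1 / 2" using power_decreasing[of 1 "Suc m" "1 / 2 :: real"] by simp
        finally have "norm (polylog_neg i (w * nome \<tau> ^ Suc m)) \<le> C * norm (w * nome \<tau> ^ Suc m)" by (rule C)
        also have "\<dots> \<le> C * (1 / 2) ^ Suc m" using le C(1) by (intro mult_left_mono) auto
        finally show ?thesis .
      qed
      moreover have sums: "(\<lambda>m. C * (1 / 2) ^ Suc m) sums (C * 1)"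
        by (intro sums_mult power_half_series)
      ultimately have "norm (polylog_tail i w (nome \<tau>)) \<le> (\<Sum>m. C * (1 / 2) ^ Suc m)"
        unfolding polylog_tail_def by (intro norm_suminf_le sums_summable[OF sums]) auto
      thus ?thesis using sums_unique[OF sums] by simp
    qed
    have "norm (nome z) * \<rho> \<le> 1" "norm (nome (- z)) * \<rho> \<le> 1"
      using \<rho> mult_mono[of \<rho> 1 \<rho> 1] unfolding zc zc' by auto
    note tails = tail[OF this(1)] tail[OF this(2)]
    have main: "norm (polylog_neg i (nome z)) \<le> L"
    proof -
      consider "c0 = 1" | "c0 = 0" | "c0 = -1" using c0 by auto
      thus ?thesis
      proof cases
        case 1
        hence "norm (polylog_neg i (nome z)) \<le> C * norm (nome z)" using \<rho> zc by (intro C) auto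
        also have "\<dots> \<le> C * 1" using \<rho> zc 1 C(1) by (intro mult_left_mono) auto
        finally show ?thesis
          using norm_ge_zero[of "polylog_neg i (nome (of_int d / 3))"] unfolding L_def by linarith
      next
        case 2
        thus ?thesis using C(1) by (simp add: L_def z_def)
      next
        case 3
        have "nome z \<noteq> 1" using zc 3 \<rho> by auto
        hence "nome (- z) \<noteq> 1" by (simp add: nome_minus)
        from polylog_neg_inverse[OF nome_nz this, of i]
        have "norm (polylog_neg i (nome z)) = norm ((- 1) ^ Suc i * polylog_neg i (nome (- z)) - of_bool (i = 0))"
          by (simp add: nome_minus inverse_eq_divide)
        also have "\<dots> \<le> norm (polylog_neg i (nome (- z))) + 1"
          by (rule order.trans[OF norm_triangle_ineq4]) (auto simp: norm_mult norm_power)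
        also have "norm (polylog_neg i (nome (- z))) \<le> C * norm (nome (- z))" using \<rho> zc' 3 by (intro C) auto
        also have "\<dots> \<le> C * 1" using \<rho> zc' 3 C(1) by (intro mult_left_mono) auto
        finally show ?thesis
          using norm_ge_zero[of "polylog_neg i (nome (of_int d / 3))"] unfolding L_def by linarith
      qed
    qed
    have "norm (eis_kronecker i z \<tau>) \<le> norm (of_real pi * \<i> * of_bool (i = 0)) +
        norm ((2 * of_real pi * \<i>) ^ Suc i * (polylog_neg i (nome z) + polylog_tail i (nome z) (nome \<tau>)
          - (- 1) ^ i * polylog_tail i (nome (- z)) (nome \<tau>)))"
      unfolding eis_kronecker_def by (rule order.trans[OF norm_triangle_ineq4]) simp
    also have "norm (of_real pi * \<i> * of_bool (i = 0) :: complex) \<le> pi"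
      by (simp add: norm_mult)
    also have "norm ((2 * of_real pi * \<i>) ^ Suc i * (polylog_neg i (nome z) + polylog_tail i (nome z) (nome \<tau>)
          - (- 1) ^ i * polylog_tail i (nome (- z)) (nome \<tau>))) =
       (2 * pi) ^ Suc i * norm (polylog_neg i (nome z) + polylog_tail i (nome z) (nome \<tau>)
          - (- 1) ^ i * polylog_tail i (nome (- z)) (nome \<tau>))"
      by (simp add: norm_mult norm_power)
    also have "norm (polylog_neg i (nome z) + polylog_tail i (nome z) (nome \<tau>)
          - (- 1) ^ i * polylog_tail i (nome (- z)) (nome \<tau>)) \<le> L + C + C"
      using main tails
      by (intro order.trans[OF norm_triangle_ineq4] add_mono order.trans[OF norm_triangle_ineq])
         (auto simp: norm_mult norm_power)
    finally show ?thesis by (simp add: K_def z_def)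
  qed
  thus ?thesis by (rule that)
qed

text \<open>A lattice translation reduces c modulo 3 to a residue in {-1, 0, 1}, which keeps the
  imaginary part of the argument within a third of that of \<tau>, safely away from the other rows
  of the lattice.\<close>

lemma eis_kronecker_third_slash_bounded:
  assumes det: "a * d - b * c = (1 :: int)"
  shows "Bfun (\<lambda>\<tau>. (of_int c * \<tau> + of_int d) powi (- (int (Suc i) - 2 * int 0)) *
           eis_kronecker i (1 / 3) (moebius_act (a, b, c, d) \<tau>)) (filtercomap Im at_top)"
proof -
  have "\<exists>c' c0. c = 3 * c' + c0 \<and> (c0 = -1 \<or> c0 = 0 \<or> c0 = 1)"
    by presburger
  then obtain c' c0 where c: "c = 3 * c' + c0" and c0: "c0 \<in> {-1, 0, 1 :: int}" by blast
  obtain K where K: "\<And>\<tau>. Im \<tau> \<ge> 1 \<Longrightarrow> norm (eis_kronecker i ((of_int c0 * \<tau> + of_int d) / 3) \<tau>) \<le> K"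
    using eis_kronecker_bounded[OF c0] by blast
  \<comment> \<open>The summands bound the reduced value, the quasi-period of the translation by c'
    \<tau>, and the correction term; the last uses |c| <= |J| for Im \<tau> >= 1.\<close>
  define B where "B = K + 2 * pi * \<bar>of_int c'\<bar> + 2 * pi * (\<bar>of_int c\<bar> + 1)"
  have bound: "norm ((of_int c * \<tau> + of_int d) powi (- (int (Suc i) - 2 * int 0)) *
           eis_kronecker i (1 / 3) (moebius_act (a, b, c, d) \<tau>)) \<le> B" if Im: "Im \<tau> \<ge> 1" for \<tau>
  proof -
    interpret modular_transformation a b c d \<tau>
      by unfold_locales (use det Im in \<open>auto simp: upper_half_plane_def\<close>)
    have eq: "J / 3 = (of_int c0 * \<tau> + of_int d) / 3 + (of_int c' * \<tau> + of_int 0)"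
      unfolding J_def by (subst c) (simp add: field_simps)
    have "of_int c' * \<tau> + of_int 0 \<in> lattice \<tau>" unfolding lattice_def by blast
    hence not_in: "(of_int c0 * \<tau> + of_int d) / 3 \<notin> lattice \<tau>"
      using eis_kronecker_third_slash(1) lattice_add unfolding eq by blast
    have "(of_int c * \<tau> + of_int d) powi (- (int (Suc i) - 2 * int 0)) *
           eis_kronecker i (1 / 3) (moebius_act (a, b, c, d) \<tau>) = eis_kronecker i (1 / 3) \<tau>' / J ^ Suc i"
    proof -
      have e: "- (int (Suc i) - 2 * int 0) = - int (Suc i)" by simp
      show ?thesis
        unfolding J_def[symmetric] \<tau>'_def[symmetric] e power_int_minus power_int_of_nat divide_inverse
        by (rule mult.commute)
    qed
    moreover define T where "T = (if i = 0 then 2 * of_real pi * \<i> * of_int c / 3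
        else if i = 1 then 2 * of_real pi * \<i> * of_int c / J else 0)"
    have "norm (eis_kronecker i (1 / 3) \<tau>' / J ^ Suc i) \<le> norm (eis_kronecker i (J / 3) \<tau>) + norm T"
    proof -
      have "eis_kronecker i (1 / 3) \<tau>' / J ^ Suc i = eis_kronecker i (J / 3) \<tau> + T"
        unfolding T_def by (rule eis_kronecker_third_slash(2))
      thus ?thesis by (simp only: norm_triangle_ineq)
    qed
    moreover have "norm (eis_kronecker i (J / 3) \<tau>) \<le> norm (eis_kronecker i ((of_int c0 * \<tau> + of_int d) / 3) \<tau>) +
        norm (2 * of_real pi * \<i> * of_int c' * of_bool (i = 0) :: complex)"
      unfolding eq by (subst eis_kronecker_quasiperiod[OF \<tau> not_in]) (rule norm_triangle_ineq4)
    moreover have "norm (eis_kronecker i ((of_int c0 * \<tau> + of_int d) / 3) \<tau>) \<le> K" by (rule K[OF Im])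
    moreover have "norm (2 * of_real pi * \<i> * of_int c' * of_bool (i = 0) :: complex) \<le> 2 * pi * \<bar>of_int c'\<bar>"
      by (simp add: norm_mult)
    moreover have "norm T \<le> 2 * pi * (\<bar>of_int c\<bar> + 1)"
    proof -
      have "\<bar>of_int c\<bar> * 1 \<le> \<bar>of_int c\<bar> * Im \<tau>" using Im by (intro mult_left_mono) auto
      also have "\<dots> = \<bar>Im J\<bar>" using Im by (simp add: J_def abs_mult)
      also have "\<dots> \<le> norm J" by (rule abs_Im_le_cmod)
      finally have "\<bar>of_int c\<bar> / norm J \<le> 1" using J_nz by (simp add: divide_le_eq)
      hence "2 * pi * (\<bar>of_int c\<bar> / norm J) \<le> 2 * pi * (\<bar>of_int c\<bar> + 1)"
        by (intro mult_left_mono) auto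
      moreover have "2 * pi * (\<bar>of_int c\<bar> / 3) \<le> 2 * pi * (\<bar>of_int c\<bar> + 1)"
        by (intro mult_left_mono) auto
      ultimately show ?thesis by (auto simp: T_def norm_mult norm_divide)
    qed
    ultimately show ?thesis unfolding B_def by simp
  qed
  hence "eventually (\<lambda>\<tau>. norm ((of_int c * \<tau> + of_int d) powi (- (int (Suc i) - 2 * int 0)) *
           eis_kronecker i (1 / 3) (moebius_act (a, b, c, d) \<tau>)) \<le> B) (filtercomap Im at_top)"
    unfolding eventually_filtercomap_at_top_linorder by blast
  thus ?thesis by (rule BfunI)
qed

lemma nome_third: "nome (1 / 3) = zeta3" "nome (- (1 / 3)) = inverse zeta3"
proof -
  show "nome (1 / 3) = zeta3" by (simp add: nome_def zeta3_def)
  thus "nome (- (1 / 3)) = inverse zeta3" by (simp only: nome_minus)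
qed

lemma holomorphic_eis_kronecker_third: "eis_kronecker i (1 / 3) holomorphic_on upper_half_plane"
  unfolding eis_kronecker_def[abs_def] nome_third
  by (intro holomorphic_intros holomorphic_polylog_tail) auto

text \<open>Depth 1 occurs only in weight 2, with the nonzero constant 2 pi i as second component.
  Otherwise the top component is the form itself, so the case of the zero function is split
  off.\<close>

lemma eis_kronecker_third_quasimodular:
  "is_quasimodular_form 3 (eis_char i) (int (Suc i)) (of_bool (i = 1)) (eis_kronecker i (1 / 3))"
proof (cases "\<forall>\<tau>\<in>upper_half_plane. eis_kronecker i (1 / 3) \<tau> = 0")
  case True
  thus ?thesis unfolding is_quasimodular_form_def
    using holomorphic_eis_kronecker_third dirichlet_character_chi32 dirichlet_character_trivial3
    by (simp add: eis_char_def)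
next
  case False
  define G where "G = (\<lambda>j :: nat. if j = 0 then eis_kronecker i (1 / 3) else (\<lambda>_. 2 * of_real pi * \<i>))"
  define h :: nat where "h = of_bool (i = 1)"
  have "\<exists>\<tau>\<in>upper_half_plane. G h \<tau> \<noteq> 0"
    using False by (auto simp: G_def h_def)
  moreover have "\<forall>j\<le>h. G j holomorphic_on upper_half_plane"
    by (auto simp: G_def holomorphic_eis_kronecker_third)
  moreover have "eis_kronecker i (1 / 3) (moebius_act (a, b, c, d) \<tau>) =
      eis_char i d * (of_int c * \<tau> + of_int d) powi int (Suc i) *
        (\<Sum>j\<le>h. G j \<tau> * (of_int c / (of_int c * \<tau> + of_int d)) ^ j)"
    if "(a, b, c, d) \<in> Gamma0 3" "\<tau> \<in> upper_half_plane" for a b c d \<tau>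
  proof -
    interpret modular_transformation a b c d \<tau>
      by unfold_locales (rule Gamma0_3D(1)[OF that(1)], rule that(2))
    have "3 dvd c" by (rule Gamma0_3D(2)[OF that(1)])
    moreover have "(\<Sum>j\<le>h. G j \<tau> * (of_int c / J) ^ j) =
       eis_kronecker i (1 / 3) \<tau> + (if i = 1 then 2 * of_real pi * \<i> * (of_int c / J) else 0)"
      by (simp add: h_def G_def)
    ultimately show ?thesis
      unfolding J_def[symmetric] \<tau>'_def[symmetric] power_int_of_nat
      by (simp only: eis_kronecker_third_Gamma0)
  qed
  moreover have "Bfun (\<lambda>\<tau>. (of_int c * \<tau> + of_int d) powi (- (int (Suc i) - 2 * int r)) *
       G r (moebius_act (a, b, c, d) \<tau>)) (filtercomap Im at_top)"
    if "r \<le> h" "(a, b, c, d) \<in> SL2Z" for r a b c d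
  proof (cases "r = 0")
    case True
    thus ?thesis using eis_kronecker_third_slash_bounded[of a d b c i] that(2)
      by (simp add: G_def SL2Z_def)
  next
    case False
    \<comment> \<open>Here the exponent w - 2 r is 0 and the component is constant.\<close>
    hence "r = 1" "i = 1" using that(1) by (auto simp: h_def of_bool_def split: if_splits)
    thus ?thesis by (auto simp: G_def)
  qed
  ultimately show ?thesis
    unfolding is_quasimodular_form_def h_def[symmetric]
    using holomorphic_eis_kronecker_third dirichlet_character_chi32 dirichlet_character_trivial3
    by (intro conjI disjI2 exI[of _ G]) (auto simp: eis_char_def)
qed

text \<open>Constants need a character modulo 3 as well; the principal one is 1 on the lower right
  entries, which are prime to 3.\<close>

lemma modular_form_const: "is_modular_form 3 chi_trivial3 0 (\<lambda>_. 1)"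
proof -
  have "chi_trivial3 d = 1" if "(a, b, c, d) \<in> Gamma0 3" for a b c d
  proof -
    have "\<not> 3 dvd d"
      using Gamma0_3D[OF that] by (rule not_3_dvd_right)
    thus ?thesis by (simp add: chi_trivial3_def)
  qed
  moreover have "\<i> \<in> upper_half_plane" by (simp add: upper_half_plane_def)
  ultimately show ?thesis
    unfolding is_modular_form_def is_quasimodular_form_def
    by (intro conjI disjI2 exI[of _ "\<lambda>_ _. 1"])
       (auto simp: dirichlet_character_trivial3)
qed

text \<open>At z = 1/3 the sum over n consists of the two tails of \<open>eis_kronecker\<close>; the
  rest of that function does not depend on \<tau>.\<close>

lemma sums_eis_kronecker_third:
  assumes "\<tau> \<in> upper_half_plane"
  shows "(\<lambda>n. polylog_neg j (zeta3 * nome \<tau> ^ Suc n) - (- 1) ^ j * polylog_neg j (inverse zeta3 * nome \<tau> ^ Suc n)) sums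
    (- eis_kronecker j (1 / 3) \<tau> / (2 * of_real pi * \<i>) ^ Suc j
      - (of_real pi * \<i> * of_bool (j = 0) / (2 * of_real pi * \<i>) ^ Suc j + polylog_neg j zeta3))"
proof -
  note summ = polylog_tail_summable[OF norm_nome_less_1[OF assms]]
  have nz: "(2 * of_real pi * \<i>) ^ Suc j \<noteq> (0 :: complex)" by simp
  have "(\<lambda>n. polylog_neg j (zeta3 * nome \<tau> ^ Suc n) - (- 1) ^ j * polylog_neg j (inverse zeta3 * nome \<tau> ^ Suc n)) sums
     (polylog_tail j zeta3 (nome \<tau>) - (- 1) ^ j * polylog_tail j (inverse zeta3) (nome \<tau>))"
    unfolding polylog_tail_def by (intro sums_diff sums_mult summable_sums summ)
  also have "polylog_tail j zeta3 (nome \<tau>) - (- 1) ^ j * polylog_tail j (inverse zeta3) (nome \<tau>) =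
     - eis_kronecker j (1 / 3) \<tau> / (2 * of_real pi * \<i>) ^ Suc j
      - (of_real pi * \<i> * of_bool (j = 0) / (2 * of_real pi * \<i>) ^ Suc j + polylog_neg j zeta3)"
    unfolding eis_kronecker_def nome_third using nz
    by (simp add: field_simps del: power_Suc)
  finally show ?thesis .
qed

lemma quotient_modular_combination:
  fixes k :: nat and Q :: "complex poly"
  assumes Q: "k \<ge> 1" "degree Q \<le> 2 * k - 1"
    "\<And>x. x \<noteq> 0 \<Longrightarrow> poly Q x = x ^ (2 * k) * poly Q (1 / x)" "poly Q 0 = 0"
  shows "modular_combination 3 k
           (\<lambda>\<tau>. \<Sum>n. poly Q (nome \<tau> ^ Suc n) / (1 + nome \<tau> ^ Suc n + nome \<tau> ^ (2 * Suc n)) ^ k)"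
proof -
  define \<beta> where "\<beta> = (\<lambda>j. - c_coeff k Q (Suc j) / (2 * of_real pi * \<i>) ^ Suc j)"
  define P where "P = (\<lambda>j. of_real pi * \<i> * of_bool (j = 0) / (2 * of_real pi * \<i>) ^ Suc j + polylog_neg j zeta3)"
  \<comment> \<open>The indices below k carry weights 1 to k; the extra index k holds the total of
    the constants, as a form of weight 0.\<close>
  define b where "b = (\<lambda>i. if i < k then \<beta> i else - (\<Sum>j<k. c_coeff k Q (Suc j) * P j))"
  define w where "w = (\<lambda>i. if i < k then Suc i else 0)"
  define \<psi> where "\<psi> = (\<lambda>i. if i < k then eis_char i else chi_trivial3)"
  define g where "g = (\<lambda>i. if i < k then eis_kronecker i (1 / 3) else (\<lambda>_. 1))"
  have forms: "w i \<le> k \<and> (is_modular_form 3 (\<psi> i) (int (w i)) (g i) \<or>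
          w i = 2 \<and> (\<exists>h. is_quasimodular_form 3 (\<psi> i) 2 h (g i)))" if "i < Suc k" for i
  proof (cases "i < k")
    case True
    thus ?thesis using eis_kronecker_third_quasimodular[of i]
      by (cases "i = 1") (auto simp: w_def \<psi>_def g_def is_modular_form_def)
  next
    case False
    thus ?thesis using modular_form_const by (simp add: w_def \<psi>_def g_def)
  qed
  have eq: "(\<Sum>n. poly Q (nome \<tau> ^ Suc n) / (1 + nome \<tau> ^ Suc n + nome \<tau> ^ (2 * Suc n)) ^ k) =
      (\<Sum>i<Suc k. b i * g i \<tau>)" if \<tau>: "\<tau> \<in> upper_half_plane" for \<tau>
  proof -
    have "(\<lambda>n. poly Q (nome \<tau> ^ Suc n) / (1 + nome \<tau> ^ Suc n + nome \<tau> ^ (2 * Suc n)) ^ k) sums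
        (\<Sum>j<k. c_coeff k Q (Suc j) * (- eis_kronecker j (1 / 3) \<tau> / (2 * of_real pi * \<i>) ^ Suc j - P j))"
      by (rule sums_quotient[OF Q(1,2) _ Q(4) \<tau>])
         (use sums_eis_kronecker_third[OF \<tau>] Q(3) in \<open>simp_all only: P_def\<close>)
    moreover have "(\<Sum>j<k. c_coeff k Q (Suc j) * (- eis_kronecker j (1 / 3) \<tau> / (2 * of_real pi * \<i>) ^ Suc j - P j))
        = (\<Sum>j<k. \<beta> j * eis_kronecker j (1 / 3) \<tau>) - (\<Sum>j<k. c_coeff k Q (Suc j) * P j)"
      unfolding sum_subtractf[symmetric] by (rule sum.cong) (simp_all add: \<beta>_def algebra_simps)
    moreover have "\<dots> = (\<Sum>i<Suc k. b i * g i \<tau>)"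
      by (simp add: b_def g_def)
    ultimately show ?thesis by (simp add: sums_iff)
  qed
  show ?thesis
    unfolding modular_combination_def
    by (rule exI[of _ "Suc k"], rule exI[of _ b], rule exI[of _ w], rule exI[of _ \<psi>], rule exI[of _ g])
       (use forms eq in blast)
qed

theorem theorem3p4:
  fixes k :: nat and Q :: "complex poly"
  assumes "k \<ge> 1"
    and "degree Q \<le> 2 * k - 1"
    and "\<And>x. x \<noteq> 0 \<Longrightarrow> poly Q x = x ^ (2 * k) * poly Q (1 / x)"
    and "poly Q 0 = 0"
  shows "(\<forall>\<tau>\<in>upper_half_plane.
            (\<lambda>n. poly Q (nome \<tau> ^ Suc n) / (1 + nome \<tau> ^ Suc n + nome \<tau> ^ (2 * Suc n)) ^ k) sums
              (- poly Q 1 / (2 * 3 ^ k)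
               + \<i> * of_real (sqrt 3) *
                   (\<Sum>l | l \<in> {1..k} \<and> odd l. c_coeff k Q l * eisenstein_char chi32 l \<tau>)
               + (\<Sum>l | l \<in> {1..k} \<and> even l.
                   c_coeff k Q l * (3 ^ l * eisenstein l (3 * \<tau>) - eisenstein l \<tau>)))) \<and>
         modular_combination 3 k
           (\<lambda>\<tau>. \<Sum>n. poly Q (nome \<tau> ^ Suc n) / (1 + nome \<tau> ^ Suc n + nome \<tau> ^ (2 * Suc n)) ^ k)"
  using sums_quotient_eisenstein[OF assms] quotient_modular_combination[OF assms] by blast

end
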